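(* (a) For every integer $n\geqslant 1$, the automorphism group of the Calogero-Moser space $\mathcal C_n$ acts infinitely transitively on $\mathcal C_n$: for every $m\in\mathbb N$ and any two $m$-tuples of pairwise distinct points $(a_1,\dots,a_m)$ and $(b_1,\dots,b_m)$ of $\mathcal C_n$ there is an automorphism $\varphi$ of $\mathcal C_n$ with $\varphi(a_i)=b_i$ for all $i$. (b) Let $n_1,\dots,n_k$ be pairwise distinct positive integers. Then the group $G$, acting diagonally on $\mathcal C_{n_1}\times\dots\times\mathcal C_{n_k}$ (equivalently, on the disjoint union $\mathcal C_{n_1}\sqcup\dots\sqcup\mathcal C_{n_k}$), acts collectively infinitely transitively: for any nonnegative integers $m_1,\dots,m_k$ and any two families consisting, for each $j=1,\dots,k$, of $m_j$ pairwise distinct points $a_{j,1},\dots,a_{j,m_j}$ of $\mathcal C_{n_j}$, respectively $m_j$ pairwise distinct points $b_{j,1},\dots,b_{j,m_j}$ of $\mathcal C_{n_j}$, there exists $g\in G$ with $g.a_{j,l}=b_{j,l}$ for all $j$ and all $l$.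
   Context: For $n\geqslant 1$ the Calogero-Moser space is $\mathcal C_n=\{(X,Y)\in Mat_n(\mathbb C)\times Mat_n(\mathbb C): \mathrm{rk}([X,Y]+I_n)=1\}/\!\!/PGL_n(\mathbb C)$, where $PGL_n(\mathbb C)$ acts by simultaneous conjugation $g.(X,Y)=(gXg^{-1},gYg^{-1})$; it is a smooth irreducible affine variety of dimension $2n$. $G$ is the group generated by the transformations $(X,Y)\mapsto (X+p(Y),Y)$ and $(X,Y)\mapsto (X,Y+q(X))$, where $p,q$ range over complex polynomials in one variable; these formulas commute with conjugation and preserve the rank condition, so $G$ acts by automorphisms on each $\mathcal C_n$, and diagonally on products and disjoint unions of such spaces. *)

theory Defs
  imports "Jordan_Normal_Form.DL_Rank" "HOL-Computational_Algebra.Polynomial"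
begin

type_synonym cmat = "complex mat"
type_synonym cpair = "cmat \<times> cmat"

fun mat_poly_coeffs :: "complex list \<Rightarrow> cmat \<Rightarrow> cmat" where
  "mat_poly_coeffs [] A = 0\<^sub>m (dim_row A) (dim_row A)"
| "mat_poly_coeffs (c # cs) A = c \<cdot>\<^sub>m 1\<^sub>m (dim_row A) + A * mat_poly_coeffs cs A"

definition mat_poly :: "complex poly \<Rightarrow> cmat \<Rightarrow> cmat" where
  "mat_poly p A = mat_poly_coeffs (coeffs p) A"

definition CM_locus :: "nat \<Rightarrow> cpair set" where
  "CM_locus n = {(X, Y). X \<in> carrier_mat n n \<and> Y \<in> carrier_mat n n \<and>
      vec_space.rank n (X * Y - Y * X + 1\<^sub>m n) = 1}"

text \<open>Orbit under simultaneous conjugation (GL_n and PGL_n have the same orbits).\<close>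
definition conj_orbit :: "nat \<Rightarrow> cpair \<Rightarrow> cpair set" where
  "conj_orbit n XY = {(g * fst XY * h, g * snd XY * h) | g h.
      g \<in> carrier_mat n n \<and> h \<in> carrier_mat n n \<and> g * h = 1\<^sub>m n \<and> h * g = 1\<^sub>m n}"

text \<open>Points of the Calogero-Moser space C_n: the action of PGL_n on the locus is free with
  closed orbits (Wilson), so the points of the quotient are exactly the orbits.\<close>
definition CM :: "nat \<Rightarrow> cpair set set" where
  "CM n = conj_orbit n ` CM_locus n"

inductive_set polyfun :: "nat \<Rightarrow> (cpair \<Rightarrow> complex) set" for n where
  pf_const: "(\<lambda>_. c) \<in> polyfun n"
| pf_X: "i < n \<Longrightarrow> j < n \<Longrightarrow> (\<lambda>XY. fst XY $$ (i, j)) \<in> polyfun n"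
| pf_Y: "i < n \<Longrightarrow> j < n \<Longrightarrow> (\<lambda>XY. snd XY $$ (i, j)) \<in> polyfun n"
| pf_add: "f \<in> polyfun n \<Longrightarrow> g \<in> polyfun n \<Longrightarrow> (\<lambda>XY. f XY + g XY) \<in> polyfun n"
| pf_mult: "f \<in> polyfun n \<Longrightarrow> g \<in> polyfun n \<Longrightarrow> (\<lambda>XY. f XY * g XY) \<in> polyfun n"

text \<open>Regular functions on C_n: functions on the points whose pull-back to the locus is the
  restriction of a polynomial function (coordinate ring = invariants of C[locus]).\<close>
definition CM_regular :: "nat \<Rightarrow> (cpair set \<Rightarrow> complex) \<Rightarrow> bool" where
  "CM_regular n f \<longleftrightarrow> (\<exists>P \<in> polyfun n. \<forall>XY \<in> CM_locus n. f (conj_orbit n XY) = P XY)"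

definition CM_morphism :: "nat \<Rightarrow> (cpair set \<Rightarrow> cpair set) \<Rightarrow> bool" where
  "CM_morphism n \<phi> \<longleftrightarrow> (\<forall>x \<in> CM n. \<phi> x \<in> CM n) \<and>
      (\<forall>f. CM_regular n f \<longrightarrow> CM_regular n (f \<circ> \<phi>))"

definition CM_aut :: "nat \<Rightarrow> (cpair set \<Rightarrow> cpair set) \<Rightarrow> bool" where
  "CM_aut n \<phi> \<longleftrightarrow> bij_betw \<phi> (CM n) (CM n) \<and> CM_morphism n \<phi> \<and>
      CM_morphism n (the_inv_into (CM n) \<phi>)"

definition shiftX :: "complex poly \<Rightarrow> cpair \<Rightarrow> cpair" where
  "shiftX p XY = (fst XY + mat_poly p (snd XY), snd XY)"

definition shiftY :: "complex poly \<Rightarrow> cpair \<Rightarrow> cpair" where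
  "shiftY q XY = (fst XY, snd XY + mat_poly q (fst XY))"

text \<open>The group G generated by the shifts. Since shiftX p and shiftX (-p) are mutually
  inverse (similarly for shiftY), the monoid generated under composition is the group.\<close>
inductive_set Ggrp :: "(cpair \<Rightarrow> cpair) set" where
  G_id: "id \<in> Ggrp"
| G_X: "g \<in> Ggrp \<Longrightarrow> shiftX p \<circ> g \<in> Ggrp"
| G_Y: "g \<in> Ggrp \<Longrightarrow> shiftY q \<circ> g \<in> Ggrp"

text \<open>Induced action on points of C_n (orbits), well defined since G commutes with conjugation.\<close>
definition G_act :: "(cpair \<Rightarrow> cpair) \<Rightarrow> cpair set \<Rightarrow> cpair set" where
  "G_act g x = g ` x"

end

theory Submission
  imports Defs "Jordan_Normal_Form.Schur_Decomposition"
begin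

text \<open>
  By a word of shifts every finite family of distinct points can be brought to general position: all first
  matrices diagonalizable with simple, pairwise disjoint spectra. These are nonvanishing conditions for
  functions that are polynomial along the paths in the group obtained by scaling shifts, so it suffices to
  satisfy them one at a time.

  For simplicity of the spectrum, take the number of eigenvalues of \<open>X\<close> maximal on the orbit. If an
  eigenvalue is multiple, the compression of \<open>Y + q(X)\<close> to its generalized eigenspace has two
  eigenvalues for some \<open>q\<close>; otherwise the traces of low powers of \<open>Y + tX\<close> and
  \<open>Y + tX\<^sup>2\<close> on that space contradict the rank-one condition. Adding a large multiple of a polynomial
  in \<open>X\<close> that separates the eigenvalues then produces more eigenvalues for the second matrix, which the
  group can exchange with the first. For disjointness of two spectra, a point with
  \<open>X = diag(x\<^sub>i)\<close> has \<open>Y\<^sub>i\<^sub>j = 1/(x\<^sub>i - x\<^sub>j)\<close> and the shifts \<open>Y + q(X)\<close> change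
  the diagonal of \<open>Y\<close> arbitrarily; deleting indices one by one shows that the characteristic polynomials of
  two different such points are coprime for suitable \<open>q\<close>.

  In general position, interpolation shifts all \<open>Y\<close> independently, to \<open>c + d/dx\<close> acting on polynomials
  of degree less than \<open>n\<close>, with distinct constants \<open>c\<close>, while \<open>X\<close> becomes multiplication by
  \<open>x\<close> modulo a monic polynomial. By the Chinese remainder theorem polynomials in these \<open>Y\<close> can be
  prescribed independently, and they move each \<open>X\<close> to multiplication by \<open>x\<close> modulo
  \<open>x\<^sup>n\<close>. So every family is equivalent to one depending only on the sizes.
\<close>

section \<open>Matrix polynomials, conjugation and words of shifts\<close>

text \<open>The obstacle is that one word applies the same polynomials to all points at once. Since
  \<open>p(B)\<close> depends only on \<open>p\<close> modulo the characteristic polynomial of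
  \<open>B\<close>, coprime characteristic polynomials are exactly what lets one polynomial act
  differently on different points. No topology on the group enters: two words are joined by a line
  of words, and two one-variable polynomials that are not identically zero are nonzero at a common
  parameter. The trace contradiction runs as follows. Let \<open>m\<close> be the dimension of a
  generalized eigenspace of \<open>X\<close>, and \<open>P\<close> the compression to it of
  \<open>[X,Y] + 1\<close>. Then \<open>tr P = m\<close>, and rank one gives
  \<open>P^2 = m P\<close>. Were all compressions of \<open>Y + q(X)\<close> to have one eigenvalue,
  the vanishing traces would give \<open>tr(P X Y) = tr(P Y X) = 0\<close> for the centred
  compressions. As \<open>P = XY - YX + 1\<close> there, this means \<open>tr(P^2) = tr P\<close>,
  so \<open>m^2 = m\<close>. The coprimality argument rests on one number: the characteristic
  polynomial has second-order coefficients \<open>1/(i-j)^2\<close>, one for each pair of positions,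
  and removing a position removes nonzero terms. In (a) the automorphisms come from the same words,
  so it remains to see that words act by regular maps.\<close>

lemma sq_mult: "A \<in> carrier_mat n n \<Longrightarrow> B \<in> carrier_mat n n \<Longrightarrow> A * B \<in> carrier_mat n n" 
  by simp

context
  fixes n :: nat
begin

text \<open>Together these laws rewrite a noncommutative polynomial in \<open>n\<close> by
  \<open>n\<close> matrices to a sum of right-bracketed words; most matrix identities below are
  settled by this normal form.\<close>

lemma sq_carrier:
  fixes A B :: "'a::comm_ring_1 mat"
  assumes "A \<in> carrier_mat n n" "B \<in> carrier_mat n n"
  shows "A * B \<in> carrier_mat n n" "A + B \<in> carrier_mat n n" "A - B \<in> carrier_mat n n"
  using assms by auto

lemma sq_assoc:
  fixes A B C :: "'a::comm_ring_1 mat"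
  assumes "A \<in> carrier_mat n n" "B \<in> carrier_mat n n" "C \<in> carrier_mat n n"
  shows "(A * B) * C = A * (B * C)"
  using assms by (rule assoc_mult_mat)

lemma sq_distrib:
  fixes A B C :: "'a::comm_ring_1 mat"
  assumes "A \<in> carrier_mat n n" "B \<in> carrier_mat n n" "C \<in> carrier_mat n n"
  shows "A * (B + C) = A * B + A * C" "(A + B) * C = A * C + B * C"
    "A * (B - C) = A * B - A * C" "(A - B) * C = A * C - B * C"
  using assms by (auto intro: mult_add_distrib_mat add_mult_distrib_mat
      mult_minus_distrib_mat minus_mult_distrib_mat)

lemma sq_smult:
  fixes A B C :: "'a::comm_ring_1 mat"
  assumes "A \<in> carrier_mat n n" "B \<in> carrier_mat n n"
  shows "A * (c \<cdot>\<^sub>m B) = c \<cdot>\<^sub>m (A * B)" "(c \<cdot>\<^sub>m A) * B = c \<cdot>\<^sub>m (A * B)"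
  using assms by auto

lemma sq_one:
  fixes A :: "'a::comm_ring_1 mat"
  assumes "A \<in> carrier_mat n n"
  shows "A * 1\<^sub>m n = A" "1\<^sub>m n * A = A" "A * 0\<^sub>m n n = 0\<^sub>m n n" "0\<^sub>m n n * A = 0\<^sub>m n n"
    "A + 0\<^sub>m n n = A" "0\<^sub>m n n + A = A" "A - 0\<^sub>m n n = A" "A - A = 0\<^sub>m n n"
  using assms by auto

lemma sq_vec:
  fixes A B :: "'a::comm_ring_1 mat"
  assumes "A \<in> carrier_mat n n" "B \<in> carrier_mat n n" "v \<in> carrier_vec n"
  shows "(A * B) *\<^sub>v v = A *\<^sub>v (B *\<^sub>v v)" "(A + B) *\<^sub>v v = A *\<^sub>v v + B *\<^sub>v v"
    "(A - B) *\<^sub>v v = A *\<^sub>v v - B *\<^sub>v v" "A *\<^sub>v (c \<cdot>\<^sub>v v) = c \<cdot>\<^sub>v (A *\<^sub>v v)"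
    "(c \<cdot>\<^sub>m A) *\<^sub>v v = c \<cdot>\<^sub>v (A *\<^sub>v v)"
  using assms by (auto simp: add_mult_distrib_mat_vec minus_mult_distrib_mat_vec intro!: eq_vecI)

text \<open>In right-bracketed words an inverse pair appears in this shape.\<close>

lemma sq_cancel:
  fixes A B C :: "'a::comm_ring_1 mat"
  assumes "A * B = 1\<^sub>m n" "A \<in> carrier_mat n n" "B \<in> carrier_mat n n" "C \<in> carrier_mat n n"
  shows "A * (B * C) = C"
  using assms sq_assoc[of A B C] by simp

end

lemmas sq_ring = sq_carrier sq_assoc sq_distrib sq_smult sq_one

section \<open>Evaluating polynomials at a square matrix\<close>

lemma mat_poly_0: "A \<in> carrier_mat n n \<Longrightarrow> mat_poly 0 A = 0\<^sub>m n n"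
  by (simp add: mat_poly_def)

text \<open>Replaces the coefficient list by induction over \<open>pCons\<close>; the case
  \<open>c = 0\<close>, \<open>p = 0\<close>, whose coefficient list is empty, fits as well.\<close>

lemma mat_poly_pCons:
  assumes "A \<in> carrier_mat n n"
  shows "mat_poly (pCons c p) A = c \<cdot>\<^sub>m 1\<^sub>m n + A * mat_poly p A"
  using assms by (auto simp: mat_poly_def cCons_def intro!: eq_matI)

lemma mat_poly_dim [simp]: "dim_row (mat_poly p A) = dim_row A" "dim_col (mat_poly p A) = dim_row A"
proof -
  have "dim_row (mat_poly_coeffs cs A) = dim_row A \<and> dim_col (mat_poly_coeffs cs A) = dim_row A" for cs
    by (induct cs) auto
  then show "dim_row (mat_poly p A) = dim_row A" "dim_col (mat_poly p A) = dim_row A"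
    by (auto simp: mat_poly_def)
qed

lemma mat_poly_carrier [simp]: "A \<in> carrier_mat n n \<Longrightarrow> mat_poly p A \<in> carrier_mat n n"
proof (induct p rule: pCons_induct)
  case 0
  then show ?case by (simp add: mat_poly_0)
next
  case (pCons a p)
  then show ?case by (simp add: mat_poly_pCons)
qed

context
  fixes A :: cmat and n :: nat
  assumes A: "A \<in> carrier_mat n n"
begin

lemma mat_poly_const: "mat_poly [:c:] A = c \<cdot>\<^sub>m 1\<^sub>m n"
  using A by (simp add: mat_poly_pCons mat_poly_0)

lemma mat_poly_1: "mat_poly 1 A = 1\<^sub>m n"
  unfolding one_pCons mat_poly_const by (intro eq_matI) auto

lemma mat_poly_smult: "mat_poly (Polynomial.smult c p) A = c \<cdot>\<^sub>m mat_poly p A"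
proof (induct p rule: pCons_induct)
  case 0
  then show ?case using A by (simp add: mat_poly_0)
next
  case (pCons a p)
  have [simp]: "mat_poly p A \<in> carrier_mat n n" using A by simp
  show ?case using A pCons
    by (simp add: mat_poly_pCons[where n=n] sq_ring[where n=n])
      (intro eq_matI, auto simp: algebra_simps)
qed

lemma mat_poly_add: "mat_poly (p + q) A = mat_poly p A + mat_poly q A"
proof (induct p arbitrary: q rule: pCons_induct)
  case 0
  then show ?case using A by (simp add: mat_poly_0)
next
  case (pCons a p)
  obtain b r where q: "q = pCons b r" by (cases q)
  have [simp]: "mat_poly s A \<in> carrier_mat n n" for s using A by simp
  show ?case using A unfolding q
    by (simp add: mat_poly_pCons[where n=n] pCons(2) sq_ring[where n=n])
      (intro eq_matI, auto simp: algebra_simps simp del: index_mult_mat(1))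
qed

lemma mat_poly_diff: "mat_poly (p - q) A = mat_poly p A - mat_poly q A"
proof -
  have "p - q = p + Polynomial.smult (-1) q" by simp
  then show ?thesis using A
    by (simp only: mat_poly_add mat_poly_smult) (intro eq_matI, auto)
qed

lemma mat_poly_mult: "mat_poly (p * q) A = mat_poly p A * mat_poly q A"
proof (induct p rule: pCons_induct)
  case 0
  then show ?case using A by (simp add: mat_poly_0[where n=n] sq_ring[where n=n])
next
  case (pCons a p)
  have [simp]: "mat_poly s A \<in> carrier_mat n n" for s using A by simp
  show ?case using A
    by (simp add: mult_pCons_left mat_poly_add mat_poly_smult mat_poly_pCons[where n=n] pCons(2) sq_ring[where n=n])
      (intro eq_matI, auto simp del: index_mult_mat(1))
qed

lemma mat_poly_X: "mat_poly [:c, 1:] A = c \<cdot>\<^sub>m 1\<^sub>m n + A"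
proof -
  have "mat_poly [:c, 1:] A = c \<cdot>\<^sub>m 1\<^sub>m n + A * (1 \<cdot>\<^sub>m 1\<^sub>m n)"
    using A by (subst mat_poly_pCons[of _ n]) (simp_all add: mat_poly_const)
  then show ?thesis using A by (simp add: sq_ring[where n=n]) (intro eq_matI, auto)
qed

lemma mat_poly_comm:
  assumes B: "B \<in> carrier_mat n n" and "A * B = B * A"
  shows "mat_poly p A * B = B * mat_poly p A"
proof (induct p rule: pCons_induct)
  case 0
  then show ?case using A B by (simp add: mat_poly_0)
next
  case (pCons a p)
  have M[simp]: "mat_poly s A \<in> carrier_mat n n" for s using A by simp
  have "A * (B * mat_poly p A) = B * (A * mat_poly p A)"
    using sq_assoc[OF A B M, of p] sq_assoc[OF B A M, of p] assms by simp
  then show ?case using A B pCons(2)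
    by (simp add: mat_poly_pCons sq_ring[where n=n])
qed

lemma mat_poly_comm_self: "mat_poly p A * A = A * mat_poly p A"
  using A by (intro mat_poly_comm) auto

lemma mat_poly_comm2: "mat_poly p A * mat_poly q A = mat_poly q A * mat_poly p A"
  by (simp add: mat_poly_mult[symmetric] mult.commute)

lemma mat_poly_conj:
  assumes g: "g \<in> carrier_mat n n" and h: "h \<in> carrier_mat n n" and "g * h = 1\<^sub>m n" "h * g = 1\<^sub>m n"
  shows "mat_poly p (g * A * h) = g * mat_poly p A * h"
proof (induct p rule: pCons_induct)
  case 0
  then show ?case using A g h by (simp add: mat_poly_0[where n=n] sq_ring[where n=n])
next
  case (pCons a p)
  have M[simp]: "mat_poly s A \<in> carrier_mat n n" for s using A by simp
  have c: "g * A * h \<in> carrier_mat n n" using A g h by simp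
  have "mat_poly (pCons a p) (g * A * h) = a \<cdot>\<^sub>m 1\<^sub>m n + g * A * h * (g * mat_poly p A * h)"
    unfolding mat_poly_pCons[OF c] pCons(2) ..
  also have "\<dots> = g * mat_poly (pCons a p) A * h"
    using A g h assms(3,4) by (simp add: mat_poly_pCons[where n=n] sq_ring[where n=n] sq_cancel[where n=n])
  finally show ?case .
qed

text \<open>Here \<open>g\<close> is an arbitrary square matrix: \<open>diagonalize\<close> applies
  this to a matrix of eigenvectors while its invertibility is still being proved.\<close>

lemma mat_poly_intertwine:
  assumes B: "B \<in> carrier_mat n n" and g: "g \<in> carrier_mat n n" and gA: "g * A = B * g"
  shows "g * mat_poly p A = mat_poly p B * g"
proof (induct p rule: pCons_induct)
  case 0
  then show ?case using A g B by (simp add: mat_poly_0[where n=n] sq_ring[where n=n])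
next
  case (pCons a p)
  have M[simp]: "mat_poly s A \<in> carrier_mat n n" "mat_poly s B \<in> carrier_mat n n" for s using A B by auto
  have "g * (A * mat_poly p A) = B * (mat_poly p B * g)"
    using sq_assoc[OF g A M(1), of p] sq_assoc[OF B g M(1), of p] sq_assoc[OF B M(2) g] gA pCons(2) by simp
  then show ?case
    using A g B by (simp add: mat_poly_pCons[where n=n] sq_ring[where n=n])
qed

lemma mat_poly_eigenvector:
  assumes v: "v \<in> carrier_vec n" and "A *\<^sub>v v = k \<cdot>\<^sub>v v"
  shows "mat_poly p A *\<^sub>v v = poly p k \<cdot>\<^sub>v v"
proof (induct p rule: pCons_induct)
  case 0
  then show ?case using A v by (auto simp: mat_poly_0[where n=n] intro!: eq_vecI)
next
  case (pCons a p)
  have M[simp]: "mat_poly s A \<in> carrier_mat n n" for s using A by simp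
  show ?case using A assms pCons(2)
    by (simp add: mat_poly_pCons[where n=n] sq_vec[where n=n]) 
      (intro eq_vecI, auto simp: algebra_simps)
qed

end

section \<open>Pairs of matrices and their conjugation orbits\<close>

definition pairs :: "nat \<Rightarrow> cpair set" where
  "pairs n = carrier_mat n n \<times> carrier_mat n n"

definition comm_mat :: "nat \<Rightarrow> cpair \<Rightarrow> cmat" where
  "comm_mat n a = fst a * snd a - snd a * fst a + 1\<^sub>m n"

definition inverses :: "nat \<Rightarrow> cmat \<Rightarrow> cmat \<Rightarrow> bool" where
  "inverses n g h \<longleftrightarrow> g \<in> carrier_mat n n \<and> h \<in> carrier_mat n n \<and> g * h = 1\<^sub>m n \<and> h * g = 1\<^sub>m n"

definition conj_pair :: "cmat \<Rightarrow> cmat \<Rightarrow> cpair \<Rightarrow> cpair" where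
  "conj_pair g h a = (g * fst a * h, g * snd a * h)"

lemma conj_orbit_alt: "conj_orbit n a = {conj_pair g h a | g h. inverses n g h}"
  by (auto simp: conj_orbit_def inverses_def conj_pair_def)

lemma inverses_sym: "inverses n g h \<Longrightarrow> inverses n h g"
  by (auto simp: inverses_def)

lemma inverses_mult: "inverses n g h \<Longrightarrow> inverses n g' h' \<Longrightarrow> inverses n (g * g') (h' * h)"
  by (auto simp: inverses_def sq_ring[where n=n] sq_cancel[where n=n])

lemma inverses_one: "inverses n (1\<^sub>m n) (1\<^sub>m n)"
  by (auto simp: inverses_def)

lemma pairsD: "a \<in> pairs n \<Longrightarrow> fst a \<in> carrier_mat n n \<and> snd a \<in> carrier_mat n n"
  by (auto simp: pairs_def)

lemma conj_pair_pairs: "a \<in> pairs n \<Longrightarrow> inverses n g h \<Longrightarrow> conj_pair g h a \<in> pairs n"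
  by (auto simp: pairs_def conj_pair_def inverses_def)

lemma conj_pair_conj_pair:
  assumes "a \<in> pairs n" "inverses n g h" "inverses n g' h'"
  shows "conj_pair g h (conj_pair g' h' a) = conj_pair (g * g') (h' * h) a"
  using assms by (auto simp: pairs_def conj_pair_def inverses_def sq_ring[where n=n])

lemma conj_pair_one: "a \<in> pairs n \<Longrightarrow> conj_pair (1\<^sub>m n) (1\<^sub>m n) a = a"
  by (auto simp: pairs_def conj_pair_def)

lemma self_orbit: "a \<in> pairs n \<Longrightarrow> a \<in> conj_orbit n a"
  using conj_pair_one[of a n, symmetric] inverses_one[of n] unfolding conj_orbit_alt mem_Collect_eq by blast

lemma orbit_pairs: "a \<in> pairs n \<Longrightarrow> b \<in> conj_orbit n a \<Longrightarrow> b \<in> pairs n"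
  using conj_pair_pairs unfolding conj_orbit_alt by blast

lemma orbit_trans:
  assumes a: "a \<in> pairs n" and "b \<in> conj_orbit n a" "c \<in> conj_orbit n b"
  shows "c \<in> conj_orbit n a"
proof -
  obtain g h g' h' where "inverses n g h" "b = conj_pair g h a" "inverses n g' h'" "c = conj_pair g' h' b"
    using assms unfolding conj_orbit_alt by blast
  then have "c = conj_pair (g' * g) (h * h') a" "inverses n (g' * g) (h * h')"
    using conj_pair_conj_pair[OF a] inverses_mult by auto
  then show ?thesis unfolding conj_orbit_alt by blast
qed

lemma orbit_sym:
  assumes a: "a \<in> pairs n" and "b \<in> conj_orbit n a"
  shows "a \<in> conj_orbit n b"
proof -
  obtain g h where gh: "inverses n g h" and b: "b = conj_pair g h a"
    using assms unfolding conj_orbit_alt by blast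
  have "conj_pair h g b = a"
    using conj_pair_conj_pair[OF a inverses_sym[OF gh] gh] conj_pair_one[OF a] gh
    unfolding b inverses_def by simp
  then show ?thesis using inverses_sym[OF gh] unfolding conj_orbit_alt by blast
qed

lemma orbit_eq_iff:
  assumes "a \<in> pairs n"
  shows "conj_orbit n b = conj_orbit n a \<and> b \<in> pairs n \<longleftrightarrow> b \<in> conj_orbit n a"
proof
  assume "conj_orbit n b = conj_orbit n a \<and> b \<in> pairs n"
  then show "b \<in> conj_orbit n a" using self_orbit[of b n] by simp
next
  assume b: "b \<in> conj_orbit n a"
  have b': "b \<in> pairs n" using orbit_pairs[OF assms b] .
  show "conj_orbit n b = conj_orbit n a \<and> b \<in> pairs n"
    using orbit_trans[OF b' orbit_sym[OF assms b]] orbit_trans[OF assms b] b' by blast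
qed

lemma orbit_eqI: "a \<in> pairs n \<Longrightarrow> b \<in> conj_orbit n a \<Longrightarrow> conj_orbit n b = conj_orbit n a"
  using orbit_eq_iff by blast

section \<open>Words of shifts acting on pairs\<close>

text \<open>A word of shifts; \<open>True\<close> marks a shift of the first matrix.\<close>

fun act :: "(bool \<times> complex poly) list \<Rightarrow> cpair \<Rightarrow> cpair" where
  "act [] a = a"
| "act ((b, p) # w) a = (if b then shiftX p (act w a) else shiftY p (act w a))"

lemma act_append: "act (u @ v) a = act u (act v a)"
  by (induct u) auto

lemma act_Ggrp: "act w \<in> Ggrp"
proof (induct w)
  case Nil
  have "act [] = id" by (rule ext) simp
  then show ?case using G_id by metis
next
  case (Cons a w)
  obtain b p where a: "a = (b, p)" by (cases a)
  have "act (a # w) = (if b then shiftX p else shiftY p) \<circ> act w" unfolding a by auto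
  then show ?case using Cons G_X G_Y by metis
qed

lemma act_pairs: "a \<in> pairs n \<Longrightarrow> act w a \<in> pairs n"
  by (induct w) (auto simp: shiftX_def shiftY_def pairs_def mem_Times_iff)

text \<open>A polynomial in \<open>Y\<close> commutes with \<open>Y\<close>, so adding it to
  \<open>X\<close> leaves the commutator unchanged. Words therefore preserve the rank
  condition.\<close>

lemma comm_mat_shift:
  assumes "a \<in> pairs n"
  shows "comm_mat n (shiftX p a) = comm_mat n a" "comm_mat n (shiftY p a) = comm_mat n a"
proof -
  obtain X Y where a: "a = (X, Y)" and X: "X \<in> carrier_mat n n" and Y: "Y \<in> carrier_mat n n"
    using assms by (auto simp: pairs_def)
  have "mat_poly p X * X = X * mat_poly p X" "mat_poly p Y * Y = Y * mat_poly p Y"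
    using X Y mat_poly_comm_self by auto
  then show "comm_mat n (shiftX p a) = comm_mat n a" "comm_mat n (shiftY p a) = comm_mat n a"
    using X Y unfolding a comm_mat_def shiftX_def shiftY_def 
    by (auto simp: sq_ring[where n=n] intro!: eq_matI)
qed

lemma comm_mat_act: "a \<in> pairs n \<Longrightarrow> comm_mat n (act w a) = comm_mat n a"
  by (induct w) (auto simp: comm_mat_shift act_pairs)

lemma comm_mat_conj_pair:
  assumes "a \<in> pairs n" "inverses n g h"
  shows "comm_mat n (conj_pair g h a) = g * comm_mat n a * h"
  using assms unfolding comm_mat_def conj_pair_def pairs_def inverses_def
  by (auto simp: sq_ring[where n=n] sq_cancel[where n=n])

lemma act_conj_pair:
  assumes "a \<in> pairs n" "inverses n g h"
  shows "act w (conj_pair g h a) = conj_pair g h (act w a)"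
proof (induct w)
  case Nil
  then show ?case by simp
next
  case (Cons s w)
  obtain b p where s: "s = (b, p)" by (cases s)
  have "shiftX p (conj_pair g h c) = conj_pair g h (shiftX p c)" 
    "shiftY p (conj_pair g h c) = conj_pair g h (shiftY p c)" if "c \<in> pairs n" for c
    using that assms(2) mat_poly_conj[where n=n and g=g and h=h]
    unfolding pairs_def shiftX_def shiftY_def conj_pair_def inverses_def
    by (auto simp: sq_distrib[where n=n] sq_carrier[where n=n])
  then show ?case using Cons act_pairs[OF assms(1)] unfolding s by simp
qed

fun inv_word :: "(bool \<times> complex poly) list \<Rightarrow> (bool \<times> complex poly) list" where
  "inv_word w = rev (map (\<lambda>(b, p). (b, - p)) w)"

lemma shift_minus:
  assumes "a \<in> pairs n"
  shows "shiftX (- p) (shiftX p a) = a" "shiftY (- p) (shiftY p a) = a"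
proof -
  have *: "mat_poly (- p) A = 0\<^sub>m n n - mat_poly p A" if "A \<in> carrier_mat n n" for A
    using mat_poly_diff[OF that, of 0 p] mat_poly_0[OF that] by simp
  obtain X Y where a: "a = (X, Y)" and X: "X \<in> carrier_mat n n" and Y: "Y \<in> carrier_mat n n"
    using assms by (auto simp: pairs_def)
  have "mat_poly p X \<in> carrier_mat n n" "mat_poly p Y \<in> carrier_mat n n"
    using X Y by auto
  then show "shiftX (- p) (shiftX p a) = a" "shiftY (- p) (shiftY p a) = a"
    using X Y unfolding a shiftX_def shiftY_def 
    by (auto simp: * intro!: eq_matI simp del: mat_poly_carrier)
qed

lemma act_inv: "a \<in> pairs n \<Longrightarrow> act (inv_word w) (act w a) = a"
proof (induct w)
  case (Cons s w)
  have "act w a \<in> pairs n" using act_pairs[OF Cons(2)] .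
  then show ?case using Cons by (cases s) (auto simp: act_append shift_minus[where n=n])
qed simp

lemma act_inv': assumes "a \<in> pairs n" shows "act w (act (inv_word w) a) = a"
proof -
  have "inv_word (inv_word w) = w" by (induct w) auto
  then show ?thesis using act_inv[OF assms, of "inv_word w"] by metis
qed

lemma act_orbit:
  assumes "a \<in> pairs n"
  shows "act w ` conj_orbit n a = conj_orbit n (act w a)"
proof -
  have "act w ` conj_orbit n a = {act w (conj_pair g h a) | g h. inverses n g h}"
    unfolding conj_orbit_alt by blast
  also have "\<dots> = {conj_pair g h (act w a) | g h. inverses n g h}"
    using act_conj_pair[OF assms] by metis
  finally show ?thesis unfolding conj_orbit_alt .
qed

lemma act_orbit_mem: "a \<in> pairs n \<Longrightarrow> b \<in> conj_orbit n a \<Longrightarrow> act w b \<in> conj_orbit n (act w a)"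
  using act_orbit by blast

text \<open>Rank at most one, written as an outer product: this form passes to all products
  \<open>g * P * h\<close> and yields the trace identity \<open>rank_one_sandwich\<close>.\<close>

definition rank_one :: "nat \<Rightarrow> cmat \<Rightarrow> bool" where
  "rank_one n P \<longleftrightarrow> (\<exists>v w. \<forall>i<n. \<forall>j<n. P $$ (i, j) = v i * w j)"

text \<open>All columns are multiples of one nonzero column, as two independent columns would give
  rank at least 2.\<close>

lemma rank_one_if_rank_1:
  assumes A: "A \<in> carrier_mat n n" and r: "vec_space.rank n A = 1"
  shows "rank_one n A"
proof (cases "\<forall>i<n. \<forall>j<n. A $$ (i, j) = 0")
  case True
  then show ?thesis unfolding rank_one_def
    by (intro exI[of _ "\<lambda>_. 0"]) simp
next
  case False
  then obtain i0 j0 where ij0: "i0 < n" "j0 < n" "A $$ (i0, j0) \<noteq> 0" by auto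
  let ?u = "col A j0"
  have u: "?u \<in> carrier_vec n" "?u \<noteq> 0\<^sub>v n" "?u \<in> set (cols A)"
  proof -
    show "?u \<in> carrier_vec n" "?u \<in> set (cols A)" using A ij0 by (auto intro: nth_mem[of j0 "cols A", simplified])
    have "?u $ i0 \<noteq> 0\<^sub>v n $ i0" using A ij0 by simp
    then show "?u \<noteq> 0\<^sub>v n" by auto
  qed
  have "\<exists>c. col A j = c \<cdot>\<^sub>v ?u" if j: "j < n" for j
  proof (rule ccontr)
    assume *: "\<not> ?thesis"
    interpret vec_space "TYPE(complex)" n .
    let ?c = "col A j"
    have c: "?c \<in> carrier_vec n" "?c \<in> set (cols A)" using A j nth_mem[of j "cols A"] by (auto simp del: nth_mem)
    have ne: "?c \<noteq> ?u" using * by (metis one_smult_vec)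
    let ?S = "{?u, ?c}"
    have not_in: "y \<notin> span {x}" if x: "x \<in> carrier_vec n" and y: "\<forall>k. y \<noteq> k \<cdot>\<^sub>v x" for x y
    proof
      assume "y \<in> span {x}"
      then obtain f where "y = lincomb f {x}"
        using finite_span[of "{x}"] x by auto
      then have "y = f x \<cdot>\<^sub>v x" using x by (simp add: lincomb_def)
      then show False using y by blast
    qed
    have uc: "?u \<noteq> k \<cdot>\<^sub>v ?c" for k
    proof
      assume uk: "?u = k \<cdot>\<^sub>v ?c"
      then have "k \<noteq> 0" using u c by auto
      then have "?c = inverse k \<cdot>\<^sub>v ?u" unfolding uk by (simp add: smult_smult_assoc)
      then show False using * by blast
    qed
    have "?c \<noteq> k \<cdot>\<^sub>v ?u" for k using * by blast
    then have "?c \<notin> span {?u}" "?u \<notin> span {?c}"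
      using not_in u(1) c(1) uc by blast+
    moreover have "?S - {?u} = {?c}" "?S - {?c} = {?u}" using ne by auto
    ultimately have "\<not> (\<exists>z\<in>?S. z \<in> span (?S - {z}))" by auto
    then have "lin_indpt ?S"
      using lindep_span[of ?S] u(1) c(1) by simp
    then have "card ?S \<le> rank A"
      using u(3) c(2) by (intro rank_ge_card_indpt[OF A]) auto
    then show False using ne r by simp
  qed
  then obtain c where c: "\<And>j. j < n \<Longrightarrow> col A j = c j \<cdot>\<^sub>v ?u"
    by metis
  have "A $$ (i, j) = ?u $ i * c j" if "i < n" "j < n" for i j
  proof -
    have "A $$ (i, j) = col A j $ i" using that A by simp
    also have "\<dots> = ?u $ i * c j" unfolding c[OF that(2)] using that A by simp
    finally show ?thesis .
  qed
  then show ?thesis unfolding rank_one_def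
    by (intro exI[of _ "\<lambda>i. ?u $ i"] exI[of _ c]) simp
qed

section \<open>Characteristic polynomials of Calogero-Moser matrices\<close>

text \<open>Stated for bounds \<open>a\<close>, \<open>b\<close> in place of degrees, so that a top
  coefficient may be zero; products are compared below at such formal top degrees.\<close>

lemma coeff_mult_top:
  fixes p q :: "'a::comm_semiring_1 poly"
  assumes "\<And>k. k > a \<Longrightarrow> coeff p k = 0" "\<And>k. k > b \<Longrightarrow> coeff q k = 0"
  shows "coeff (p * q) (a + b) = coeff p a * coeff q b"
proof -
  have "coeff (p * q) (a + b) = (\<Sum>i\<le>a + b. coeff p i * coeff q (a + b - i))"
    by (rule coeff_mult)
  also have "\<dots> = (\<Sum>i\<in>{a}. coeff p i * coeff q (a + b - i))"
  proof (rule sum.mono_neutral_right)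
    show "\<forall>i\<in>{..a + b} - {a}. coeff p i * coeff q (a + b - i) = 0"
    proof
      fix i assume i: "i \<in> {..a + b} - {a}"
      show "coeff p i * coeff q (a + b - i) = 0"
      proof (cases "i > a")
        case True
        then show ?thesis using assms(1) by simp
      next
        case False
        then have "a + b - i > b" using i by auto
        then show ?thesis using assms(2) by simp
      qed
    qed
  qed auto
  finally show ?thesis by simp
qed

text \<open>Entries of \<open>z - Y\<close> as polynomials in \<open>z\<close>, where
  \<open>Y\<close> has \<open>1 / (s - t)\<close> off the diagonal and \<open>d\<close> on
  it.\<close>

definition cm_entry :: "(complex \<Rightarrow> complex) \<Rightarrow> complex \<Rightarrow> complex \<Rightarrow> complex poly" where
  "cm_entry d s t = (if s = t then [:- d s, 1:] else [:- (1 / (s - t)):])"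

definition perm_term :: "complex set \<Rightarrow> (complex \<Rightarrow> complex) \<Rightarrow> (complex \<Rightarrow> complex) \<Rightarrow> complex poly" where
  "perm_term S d \<pi> = of_int (sign \<pi>) * (\<Prod>s\<in>S. cm_entry d s (\<pi> s))"

text \<open>The characteristic polynomial of the Calogero-Moser matrix with rows and columns indexed by
  a finite set of positions, and its part \<open>cm_rest\<close> not containing the diagonal entry at
  \<open>i\<close>. Indexing by the positions themselves makes deletion of an index easy.\<close>

definition cm_poly :: "complex set \<Rightarrow> (complex \<Rightarrow> complex) \<Rightarrow> complex poly" where
  "cm_poly S d = (\<Sum>\<pi> | \<pi> permutes S. perm_term S d \<pi>)"

definition cm_rest :: "complex set \<Rightarrow> complex \<Rightarrow> (complex \<Rightarrow> complex) \<Rightarrow> complex poly" where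
  "cm_rest S i d = - (\<Sum>\<pi> | \<pi> permutes S \<and> \<pi> i \<noteq> i. perm_term S d \<pi>)"

lemma cm_poly_empty [simp]: "cm_poly {} d = 1"
  by (simp add: cm_poly_def perm_term_def)

text \<open>Permutations fixing \<open>i\<close> contribute the diagonal factor times the minor, the
  others \<open>- cm_rest\<close>. With this sign, a root is a solution of
  \<open>(z - d i) * minor = rest\<close>, an equation affine in \<open>d i\<close>.\<close>

lemma cm_poly_expand:
  assumes S: "finite S" "i \<in> S"
  shows "cm_poly S d = [:- d i, 1:] * cm_poly (S - {i}) d - cm_rest S i d"
proof -
  have fin: "finite {\<pi>. \<pi> permutes S}" using S finite_permutations by blast
  have "{\<pi>. \<pi> permutes S \<and> \<pi> i = i} = {\<pi>. \<pi> permutes S - {i}}"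
  proof (intro equalityI subsetI CollectI)
    fix \<pi> assume "\<pi> \<in> {\<pi>. \<pi> permutes S \<and> \<pi> i = i}"
    then show "\<pi> permutes S - {i}" by (auto intro: permutes_superset)
  next
    fix \<pi> assume "\<pi> \<in> {\<pi>. \<pi> permutes S - {i}}"
    then show "\<pi> permutes S \<and> \<pi> i = i" 
      using permutes_subset[of \<pi> "S - {i}" S] permutes_not_in[of \<pi> "S - {i}" i] by auto
  qed
  moreover have "perm_term S d \<pi> = [:- d i, 1:] * perm_term (S - {i}) d \<pi>" if "\<pi> i = i" for \<pi>
    using that S unfolding perm_term_def by (subst prod.remove[of S i]) (simp_all add: cm_entry_def mult_ac)
  ultimately have fixed: "(\<Sum>\<pi> | \<pi> permutes S \<and> \<pi> i = i. perm_term S d \<pi>) = [:- d i, 1:] * cm_poly (S - {i}) d"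
    unfolding cm_poly_def sum_distrib_left by (intro sum.cong) auto
  have "cm_poly S d = (\<Sum>\<pi> | \<pi> permutes S \<and> \<pi> i = i. perm_term S d \<pi>) +
      (\<Sum>\<pi> | \<pi> permutes S \<and> \<pi> i \<noteq> i. perm_term S d \<pi>)"
    unfolding cm_poly_def using fin by (subst sum.union_disjoint[symmetric]) (auto intro: sum.cong)
  then show ?thesis unfolding fixed cm_rest_def by simp
qed

lemma cm_poly_cong: "(\<And>s. s \<in> S \<Longrightarrow> d s = d' s) \<Longrightarrow> cm_poly S d = cm_poly S d'"
  unfolding cm_poly_def perm_term_def by (intro sum.cong arg_cong2[of _ _ _ _ "(*)"] prod.cong refl)
    (auto simp: cm_entry_def)

lemma cm_rest_cong:
  assumes "\<And>s. s \<in> S - {i} \<Longrightarrow> d s = d' s"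
  shows "cm_rest S i d = cm_rest S i d'"
proof -
  have "perm_term S d \<pi> = perm_term S d' \<pi>" if "\<pi> i \<noteq> i" for \<pi>
    unfolding perm_term_def
  proof (intro arg_cong2[of _ _ _ _ "(*)"] prod.cong refl)
    fix s assume "s \<in> S"
    then show "cm_entry d s (\<pi> s) = cm_entry d' s (\<pi> s)"
      using assms[of s] that by (cases "s = i") (simp_all add: cm_entry_def)
  qed
  then show ?thesis unfolding cm_rest_def by (intro arg_cong[of _ _ uminus] sum.cong) auto
qed

text \<open>A fixed point contributes a linear factor and a moved point a constant, so the degree is
  at most the number of fixed points.\<close>

lemma coeff_perm_term:
  assumes S: "finite S" and k: "k + card {s \<in> S. \<pi> s \<noteq> s} > card S"
  shows "coeff (perm_term S d \<pi>) k = 0"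
proof -
  have "degree (\<Prod>s\<in>S. cm_entry d s (\<pi> s)) \<le> (\<Sum>s\<in>S. degree (cm_entry d s (\<pi> s)))"
    using degree_prod_sum_le[OF S, of "\<lambda>s. cm_entry d s (\<pi> s)"] by (simp add: comp_def)
  also have "\<dots> = (\<Sum>s\<in>S. if \<pi> s = s then 1 else 0)"
    by (intro sum.cong) (auto simp: cm_entry_def)
  also have "\<dots> = card {s \<in> S. \<pi> s = s}" using S by (simp add: sum.If_cases Int_def)
  finally have "degree (\<Prod>s\<in>S. cm_entry d s (\<pi> s)) \<le> card {s \<in> S. \<pi> s = s}" .
  moreover have "card {s \<in> S. \<pi> s = s} + card {s \<in> S. \<pi> s \<noteq> s} = card S"
    using S by (subst card_Un_disjoint[symmetric]) (auto intro: arg_cong[of _ _ card])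
  ultimately have "degree (\<Prod>s\<in>S. cm_entry d s (\<pi> s)) < k" using k by linarith
  then have "coeff (\<Prod>s\<in>S. cm_entry d s (\<pi> s)) k = 0" by (rule coeff_eq_0)
  then show ?thesis unfolding perm_term_def by (cases \<pi> rule: sign_cases) auto
qed

lemma moved_pair:
  assumes "\<pi> permutes S" "\<pi> i \<noteq> i"
  shows "{i, \<pi> i} \<subseteq> {s \<in> S. \<pi> s \<noteq> s}"
proof -
  have "i \<in> S" using assms permutes_not_in by metis
  then have "\<pi> i \<in> S" using assms permutes_in_image by metis
  moreover have "\<pi> (\<pi> i) \<noteq> \<pi> i" using assms permutes_inj[of \<pi> S] by (auto dest: injD)
  ultimately show ?thesis using assms \<open>i \<in> S\<close> by auto
qed

text \<open>A permutation that moves \<open>i\<close> also moves its image, so at least two linear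
  factors are lost.\<close>

lemma coeff_cm_rest_high:
  assumes S: "finite S" and k: "k + 2 > card S"
  shows "coeff (cm_rest S i d) k = 0"
proof -
  have "coeff (perm_term S d \<pi>) k = 0" if \<pi>: "\<pi> permutes S" "\<pi> i \<noteq> i" for \<pi>
  proof -
    have "2 = card {i, \<pi> i}" using \<pi> by auto
    also have "\<dots> \<le> card {s \<in> S. \<pi> s \<noteq> s}" using S moved_pair[OF \<pi>] by (intro card_mono) auto
    finally show ?thesis using k by (intro coeff_perm_term[OF S]) linarith
  qed
  then show ?thesis unfolding cm_rest_def coeff_minus coeff_sum by simp
qed

lemma cm_poly_monic:
  assumes "finite S"
  shows "degree (cm_poly S d) = card S \<and> coeff (cm_poly S d) (card S) = 1"
  using assms
proof (induct S rule: finite_induct)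
  case empty
  then show ?case by simp
next
  case (insert i S)
  have e: "cm_poly (insert i S) d = [:- d i, 1:] * cm_poly S d - cm_rest (insert i S) i d"
    using cm_poly_expand[of "insert i S" i d] insert by simp
  have "coeff (cm_poly (insert i S) d) k = coeff ([:- d i, 1:] * cm_poly S d) k" if "k > card S" for k
    unfolding e using insert that by (simp add: coeff_cm_rest_high)
  moreover have "coeff ([:- d i, 1:] * cm_poly S d) (Suc (card S)) = 1"
    using insert by (simp add: coeff_eq_0)
  moreover have "coeff ([:- d i, 1:] * cm_poly S d) k = 0" if "k > Suc (card S)" for k
    using insert that by (cases k) (simp_all add: coeff_eq_0)
  ultimately have "coeff (cm_poly (insert i S) d) (Suc (card S)) = 1"
    "\<And>k. k > Suc (card S) \<Longrightarrow> coeff (cm_poly (insert i S) d) k = 0" by simp_all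
  moreover from this have "degree (cm_poly (insert i S) d) = Suc (card S)"
    by (intro antisym degree_le le_degree) auto
  ultimately show ?case using insert by simp
qed

text \<open>Only permutations moving exactly two points, hence transpositions of \<open>i\<close>
  with some \<open>j\<close>, reach this degree. The sign of the transposition and the entries
  \<open>-1/(i-j)\<close> and \<open>-1/(j-i)\<close> multiply to \<open>1/(i-j)^2\<close>; the
  minus in front comes from \<open>cm_rest\<close>.\<close>

lemma coeff_cm_rest_top:
  assumes S: "finite S" "i \<in> S" and k: "k + 2 = card S"
  shows "coeff (cm_rest S i d) k = (\<Sum>j\<in>S - {i}. - (1 / (i - j)\<^sup>2))"
proof -
  let ?M = "{\<pi>. \<pi> permutes S \<and> \<pi> i \<noteq> i}" and ?f = "\<lambda>j. Transposition.transpose i j"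
  have fin: "finite ?M" by (rule finite_subset[OF _ finite_permutations[OF S(1)]]) blast
  have inj: "inj_on ?f (S - {i})"
  proof (rule inj_onI)
    fix j k assume "?f j = ?f k"
    then have "?f j i = ?f k i" by simp
    then show "j = k" by simp
  qed
  have sub: "?f ` (S - {i}) \<subseteq> ?M" using S by (auto intro: permutes_swap_id)
  have rest: "coeff (perm_term S d \<pi>) k = 0" if \<pi>: "\<pi> \<in> ?M - ?f ` (S - {i})" for \<pi>
  proof -
    have p: "\<pi> permutes S" "\<pi> i \<noteq> i" using \<pi> by auto
    have "card {s \<in> S. \<pi> s \<noteq> s} \<noteq> 2"
    proof
      assume c: "card {s \<in> S. \<pi> s \<noteq> s} = 2"
      have eq: "{i, \<pi> i} = {s \<in> S. \<pi> s \<noteq> s}"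
        by (rule card_subset_eq) (use S p moved_pair[OF p] c in auto)
      have "\<pi> (\<pi> i) = i"
      proof (rule ccontr)
        assume *: "\<pi> (\<pi> i) \<noteq> i"
        have inj: "inj \<pi>" using p permutes_inj by blast
        have "\<pi> (\<pi> i) \<noteq> \<pi> i" using p(2) inj_eq[OF inj] by simp
        then have "\<pi> (\<pi> i) \<notin> {s \<in> S. \<pi> s \<noteq> s}" using * eq by auto
        moreover have "\<pi> (\<pi> i) \<in> S" using p S permutes_in_image[OF p(1)] by simp
        ultimately have "\<pi> (\<pi> (\<pi> i)) = \<pi> (\<pi> i)" by auto
        then show False using inj_eq[OF inj] p(2) by simp
      qed
      moreover have "\<pi> s = s" if "s \<notin> {i, \<pi> i}" for s
      proof -
        have "s \<notin> {s \<in> S. \<pi> s \<noteq> s}" using that eq by simp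
        then show ?thesis using permutes_not_in[OF p(1), of s] by blast
      qed
      ultimately have "\<pi> s = ?f (\<pi> i) s" for s
        by (cases "s = i"; cases "s = \<pi> i") (simp_all add: Transposition.transpose_def)
      then have "\<pi> = ?f (\<pi> i)" by (rule ext)
      moreover have "\<pi> i \<in> S - {i}" using p S permutes_in_image[OF p(1), of i] by simp
      ultimately have "\<pi> \<in> ?f ` (S - {i})" by (rule image_eqI)
      then show False using \<pi> by simp
    qed
    moreover have "2 \<le> card {s \<in> S. \<pi> s \<noteq> s}"
    proof -
      have "2 = card {i, \<pi> i}" using p by auto
      also have "\<dots> \<le> card {s \<in> S. \<pi> s \<noteq> s}" using S moved_pair[OF p] by (intro card_mono) auto
      finally show ?thesis .
    qed
    ultimately show ?thesis using k by (intro coeff_perm_term[OF S(1)]) linarith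
  qed
  have transp: "coeff (perm_term S d (?f j)) k = 1 / (i - j)\<^sup>2" if j: "j \<in> S - {i}" for j
  proof -
    let ?Q = "\<Prod>s\<in>S - {i} - {j}. [:- d s, 1:]"
    have "(\<Prod>s\<in>S. cm_entry d s (?f j s)) = 
        cm_entry d i j * (cm_entry d j i * (\<Prod>s\<in>S - {i} - {j}. cm_entry d s (?f j s)))"
      using S j by (simp add: prod.remove[of S i] prod.remove[of "S - {i}" j])
    also have "(\<Prod>s\<in>S - {i} - {j}. cm_entry d s (?f j s)) = ?Q"
      by (intro prod.cong) (auto simp: cm_entry_def Transposition.transpose_def)
    finally have e: "(\<Prod>s\<in>S. cm_entry d s (?f j s)) = cm_entry d i j * (cm_entry d j i * ?Q)" .
    have ij: "i \<noteq> j" using j by auto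
    have "- ((1 / (i - j)) * (1 / (j - i))) = 1 / (i - j)\<^sup>2"
      using ij by (simp add: power2_eq_square divide_simps)
    then have "- (cm_entry d i j * cm_entry d j i) = [:1 / (i - j)\<^sup>2:]"
      using ij by (simp add: cm_entry_def mult.commute)
    moreover have "perm_term S d (?f j) = - (cm_entry d i j * cm_entry d j i) * ?Q"
      unfolding perm_term_def e using ij by (simp add: sign_swap_id)
    ultimately have "perm_term S d (?f j) = [:1 / (i - j)\<^sup>2:] * ?Q" by simp
    moreover have "degree ?Q = card (S - {i} - {j})" 
      by (subst degree_prod_sum_eq) auto
    moreover have "card (S - {i} - {j}) = k" using S j k by simp
    moreover have "lead_coeff ?Q = 1" by (subst lead_coeff_prod) simp
    ultimately show ?thesis by simp
  qed
  have "(\<Sum>\<pi>\<in>?M. coeff (perm_term S d \<pi>) k) = (\<Sum>\<pi>\<in>?f ` (S - {i}). coeff (perm_term S d \<pi>) k)"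
    using fin sub rest by (intro sum.mono_neutral_right) auto
  also have "\<dots> = (\<Sum>j\<in>S - {i}. 1 / (i - j)\<^sup>2)"
    using inj transp by (simp add: sum.reindex)
  finally show ?thesis unfolding cm_rest_def coeff_minus coeff_sum by (simp add: sum_negf)
qed

text \<open>Each \<open>z\<close> with \<open>a z\<close> nonzero excludes a single value of
  \<open>t\<close>. This picks a diagonal entry that avoids finitely many candidates for a common
  root.\<close>

lemma finite_bad_values:
  fixes a c y :: "complex \<Rightarrow> complex"
  assumes "finite Z"
  shows "\<exists>t. \<forall>z\<in>Z. a z \<noteq> 0 \<longrightarrow> (z - y z - t) * a z \<noteq> c z"
proof -
  have "finite ((\<lambda>z. z - y z - c z / a z) ` Z)" using assms by simp
  then obtain t where t: "t \<notin> (\<lambda>z. z - y z - c z / a z) ` Z"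
    using ex_new_if_finite infinite_UNIV_char_0 by blast
  have "(z - y z - t) * a z \<noteq> c z" if "z \<in> Z" "a z \<noteq> 0" for z
  proof
    assume "(z - y z - t) * a z = c z"
    then have "t = z - y z - c z / a z" using that by (simp add: field_simps)
    then show False using t that by blast
  qed
  then show ?thesis by blast
qed

lemma poly_cm_poly_upd:
  assumes "finite S" "i \<in> S"
  shows "poly (cm_poly S (d(i := t))) z = (z - t) * poly (cm_poly (S - {i}) d) z - poly (cm_rest S i d) z"
proof -
  have "cm_poly (S - {i}) (d(i := t)) = cm_poly (S - {i}) d" by (rule cm_poly_cong) auto
  moreover have "cm_rest S i (d(i := t)) = cm_rest S i d" by (rule cm_rest_cong) auto
  ultimately show ?thesis by (subst cm_poly_expand[OF assms]) (simp add: algebra_simps)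
qed

section \<open>Making characteristic polynomials coprime by a choice of diagonal\<close>

definition no_common_root :: "complex poly \<Rightarrow> complex poly \<Rightarrow> bool" where
  "no_common_root p q \<longleftrightarrow> (\<forall>z. \<not> (poly p z = 0 \<and> poly q z = 0))"

lemma no_common_root_sym: "no_common_root p q \<longleftrightarrow> no_common_root q p"
  by (auto simp: no_common_root_def)

text \<open>Induction by deleting a second index \<open>j\<close> and then choosing the diagonal
  entry \<open>t\<close> at \<open>j\<close>. Common roots are confined to the zeros of a polynomial
  that does not involve \<open>t\<close>; at each of these one of the two smaller polynomials is
  nonzero by induction, so only finitely many \<open>t\<close> are bad.\<close>

lemma minor_no_common_root:
  assumes "finite S" "i \<in> S"
  shows "\<exists>d. no_common_root (cm_poly S d) (cm_poly (S - {i}) d)"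
  using assms
proof (induct "card S" arbitrary: S i)
  case 0
  then show ?case by simp
next
  case (Suc m)
  show ?case
  proof (cases "S = {i}")
    case True
    then show ?thesis by (simp add: no_common_root_def)
  next
    case False
    then obtain j where j: "j \<in> S" "j \<noteq> i" using Suc(4) by blast
    let ?T = "S - {j}"
    have i: "i \<in> ?T" using j Suc by simp
    have "\<exists>d. no_common_root (cm_poly ?T d) (cm_poly (?T - {i}) d)"
      using Suc j by (intro Suc(1)) auto
    then obtain d where d: "no_common_root (cm_poly ?T d) (cm_poly (?T - {i}) d)" by blast
    have T': "?T - {i} = S - {i} - {j}" by auto
    define A where "A = cm_poly ?T d"
    define B where "B = cm_poly (S - {i} - {j}) d"
    define C where "C = cm_rest S j d"
    define D where "D = cm_rest (S - {i}) j d"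
    \<comment> \<open>At a common root \<open>(z - t) * A = C\<close> and
      \<open>(z - t) * B = D\<close>; eliminating \<open>z - t\<close> gives
      \<open>A * D = B * C\<close>, whatever \<open>t\<close> is.\<close>
    define E where "E = A * D - B * C"
    have AB: "no_common_root A B" using d unfolding T' A_def B_def .
    obtain r where r: "card S = r + 2" "card (S - {i}) = r + 1" "card ?T = r + 1" "card (S - {i} - {j}) = r"
    proof -
      have "{i, j} \<subseteq> S" using Suc j by auto
      then have "card {i, j} \<le> card S" using Suc card_mono by blast
      then have "2 \<le> card S" using j by simp
      then show thesis using that[of "card S - 2"] Suc j by simp
    qed
    have finS: "finite S" "finite (S - {i})" "finite ?T" "finite (S - {i} - {j})" using Suc by auto
    have "E \<noteq> 0"
    proof -
      have A: "coeff A (r + 1) = 1" "\<And>k. k > r + 1 \<Longrightarrow> coeff A k = 0"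
        using cm_poly_monic[OF finS(3), of d] r by (auto simp: A_def coeff_eq_0)
      have B: "coeff B r = 1" "\<And>k. k > r \<Longrightarrow> coeff B k = 0"
        using cm_poly_monic[OF finS(4), of d] r by (auto simp: B_def coeff_eq_0)
      have C: "coeff C r = (\<Sum>k\<in>S - {j}. - (1 / (j - k)\<^sup>2))" "\<And>k. k > r \<Longrightarrow> coeff C k = 0"
        using coeff_cm_rest_top[OF finS(1) j(1), of r d] coeff_cm_rest_high[OF finS(1)] r by (auto simp: C_def)
      \<comment> \<open>\<open>D\<close> has formal top degree \<open>r - 1\<close>, which makes no
        sense for \<open>r = 0\<close>; multiplying by the variable raises it to
        \<open>r\<close>.\<close>
      let ?Z = "monom 1 1 :: complex poly"
      have D: "coeff (?Z * D) r = (\<Sum>k\<in>S - {i} - {j}. - (1 / (j - k)\<^sup>2))"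
        "\<And>k. k > r \<Longrightarrow> coeff (?Z * D) k = 0"
      proof -
        show "coeff (?Z * D) k = 0" if "k > r" for k
          using that coeff_cm_rest_high[OF finS(2), of "k - 1" j d] r
          by (cases k) (auto simp: D_def coeff_monom_mult)
        show "coeff (?Z * D) r = (\<Sum>k\<in>S - {i} - {j}. - (1 / (j - k)\<^sup>2))"
        proof (cases r)
          case 0
          have "S - {i} - {j} = {}" using r(4) finS(4) unfolding 0 by (simp only: card_0_eq)
          then show ?thesis unfolding \<open>S - {i} - {j} = {}\<close> 0 by (simp add: coeff_monom_mult)
        next
          case (Suc r')
          have "j \<in> S - {i}" using j by simp
          then show ?thesis
            using Suc coeff_cm_rest_top[OF finS(2), of j r' d] r by (simp add: D_def coeff_monom_mult)
        qed
      qed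
      have ZB: "coeff (?Z * B) (r + 1) = 1" "\<And>k. k > r + 1 \<Longrightarrow> coeff (?Z * B) k = 0"
        using B by (auto simp: coeff_monom_mult)
      \<comment> \<open>The two products have equal formal top degree. Their top coefficients are
        sums of \<open>1/(j-k)^2\<close> over the other positions without and with \<open>i\<close>,
        so the difference is the single nonzero term of \<open>i\<close>.\<close>
      have "?Z * E = A * (?Z * D) - (?Z * B) * C" by (simp add: E_def algebra_simps)
      then have "coeff (?Z * E) (r + 1 + r) = coeff A (r + 1) * coeff (?Z * D) r - coeff (?Z * B) (r + 1) * coeff C r"
        using coeff_mult_top[of "r + 1" A r "?Z * D", OF A(2) D(2)]
          coeff_mult_top[of "r + 1" "?Z * B" r C, OF ZB(2) C(2)] by simp
      also have "\<dots> = (\<Sum>k\<in>S - {i} - {j}. - (1 / (j - k)\<^sup>2)) - (\<Sum>k\<in>S - {j}. - (1 / (j - k)\<^sup>2))"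
        unfolding A D C ZB by simp
      also have "(\<Sum>k\<in>S - {j}. - (1 / (j - k)\<^sup>2)) = - (1 / (j - i)\<^sup>2) + (\<Sum>k\<in>S - {i} - {j}. - (1 / (j - k)\<^sup>2))"
        using finS i T' by (subst sum.remove[of _ i]) auto
      finally have "coeff (?Z * E) (r + 1 + r) = 1 / (j - i)\<^sup>2" by simp
      also have "\<dots> \<noteq> 0" using j by simp
      finally show ?thesis by auto
    qed
    then have fin: "finite {z. poly E z = 0}" by (rule poly_roots_finite)
    \<comment> \<open>At each zero of \<open>E\<close>, whichever of the two equations has a nonzero
      coefficient is made to fail.\<close>
    obtain t where t: "\<forall>z\<in>{z. poly E z = 0}. (if poly A z \<noteq> 0 then poly A z else poly B z) \<noteq> 0 \<longrightarrow>
        (z - 0 - t) * (if poly A z \<noteq> 0 then poly A z else poly B z) \<noteq>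
        (if poly A z \<noteq> 0 then poly C z else poly D z)"
      using finite_bad_values[OF fin, of "\<lambda>z. if poly A z \<noteq> 0 then poly A z else poly B z" "\<lambda>_. 0"
        "\<lambda>z. if poly A z \<noteq> 0 then poly C z else poly D z"] by blast
    have "no_common_root (cm_poly S (d(j := t))) (cm_poly (S - {i}) (d(j := t)))"
      unfolding no_common_root_def
    proof (intro allI notI)
      fix z assume "poly (cm_poly S (d(j := t))) z = 0 \<and> poly (cm_poly (S - {i}) (d(j := t))) z = 0"
      then have z: "(z - t) * poly A z = poly C z" "(z - t) * poly B z = poly D z"
        using poly_cm_poly_upd[OF finS(1) j(1), of d t z] poly_cm_poly_upd[OF finS(2), of j d t z] j
        by (auto simp: A_def B_def C_def D_def)
      have "poly E z = 0" unfolding E_def by (simp add: z[symmetric])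
      moreover have "poly A z \<noteq> 0 \<or> poly B z \<noteq> 0" using AB by (auto simp: no_common_root_def)
      ultimately show False using t z by (auto split: if_splits)
    qed
    then show ?thesis by blast
  qed
qed

text \<open>The same \<open>q\<close> is added to both diagonals, as one shift acts on both points.
  An index at which the data differ is deleted; if a difference remains, induction applies and the
  value of \<open>q\<close> at the deleted index avoids finitely many bad values. Otherwise the two
  polynomials differ essentially by a minor and \<open>minor_no_common_root\<close>
  finishes.\<close>

lemma separating_shift:
  assumes "finite S" "finite S'" "S \<noteq> S' \<or> (\<exists>s\<in>S. y s \<noteq> y' s)"
  shows "\<exists>q. no_common_root (cm_poly S (\<lambda>s. y s + q s)) (cm_poly S' (\<lambda>s. y' s + q s))"
  using assms
proof (induct "card S + card S'" arbitrary: S S' y y' rule: less_induct)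
  case less
  \<comment> \<open>A position belonging to one set only; stated for arbitrary sets and data so that
    it serves both orders of the two points.\<close>
  have *: "\<exists>q. no_common_root (cm_poly S (\<lambda>s. y s + q s)) (cm_poly S' (\<lambda>s. y' s + q s))"
    if IH: "\<And>T T' y y'. card T + card T' < card S + card S' \<Longrightarrow> finite T \<Longrightarrow> finite T' \<Longrightarrow>
       T \<noteq> T' \<or> (\<exists>s\<in>T. y s \<noteq> y' s) \<Longrightarrow>
       \<exists>q. no_common_root (cm_poly T (\<lambda>s. y s + q s)) (cm_poly T' (\<lambda>s. y' s + q s))"
      and fin: "finite S" "finite S'" and i: "i \<in> S" "i \<notin> S'" for S S' i and y y' :: "complex \<Rightarrow> complex"
  proof (cases "S - {i} \<noteq> S' \<or> (\<exists>s\<in>S - {i}. y s \<noteq> y' s)")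
    case True
    have "card (S - {i}) < card S" using fin i by (meson card_Diff1_less)
    then obtain q where q: "no_common_root (cm_poly (S - {i}) (\<lambda>s. y s + q s)) (cm_poly S' (\<lambda>s. y' s + q s))"
      using IH[of "S - {i}" S' y y'] True fin by auto
    define A where "A = cm_poly (S - {i}) (\<lambda>s. y s + q s)"
    define C where "C = cm_rest S i (\<lambda>s. y s + q s)"
    define B where "B = cm_poly S' (\<lambda>s. y' s + q s)"
    have "B \<noteq> 0" using cm_poly_monic[OF fin(2), of "\<lambda>s. y' s + q s"] unfolding B_def by auto
    then have "finite {z. poly B z = 0}" by (rule poly_roots_finite)
    from finite_bad_values[OF this, of "poly A" "\<lambda>_. y i" "poly C"]
    obtain t where t: "\<And>z. poly B z = 0 \<Longrightarrow> poly A z \<noteq> 0 \<Longrightarrow> (z - y i - t) * poly A z \<noteq> poly C z" by auto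
    have e1: "(\<lambda>s. y s + (q(i := t)) s) = (\<lambda>s. y s + q s)(i := y i + t)" by auto
    have e2: "cm_poly S' (\<lambda>s. y' s + (q(i := t)) s) = B"
      unfolding B_def using i by (intro cm_poly_cong) auto
    have "no_common_root (cm_poly S (\<lambda>s. y s + (q(i := t)) s)) (cm_poly S' (\<lambda>s. y' s + (q(i := t)) s))"
      using t q unfolding e2 e1 no_common_root_def poly_cm_poly_upd[OF fin(1) i(1)]
      by (auto simp: A_def B_def C_def diff_diff_add)
    then show ?thesis by blast
  next
    case False
    \<comment> \<open>Here \<open>S'\<close> is \<open>S\<close> without \<open>i\<close>, with
      equal data, so the second polynomial is a minor of the first.\<close>
    obtain d where d: "no_common_root (cm_poly S d) (cm_poly (S - {i}) d)"
      using minor_no_common_root[OF fin(1) i(1)] by blast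
    have "cm_poly S' (\<lambda>s. y' s + (d s - y s)) = cm_poly (S - {i}) d"
    proof -
      have "S' = S - {i}" using False by simp
      show ?thesis unfolding \<open>S' = S - {i}\<close> by (rule cm_poly_cong) (use False in auto)
    qed
    moreover have "(\<lambda>s. y s + (d s - y s)) = d" by auto
    ultimately show ?thesis using d by (intro exI[of _ "\<lambda>s. d s - y s"]) simp
  qed
  consider i where "i \<in> S" "i \<notin> S'" | i where "i \<in> S'" "i \<notin> S" | i where "S = S'" "i \<in> S" "y i \<noteq> y' i"
    using less(4) by blast
  then show ?case
  proof cases
    case 1
    show ?thesis by (rule *[OF _ less(2,3) 1]) (rule less(1))
  next
    case 2
    have "\<exists>q. no_common_root (cm_poly S' (\<lambda>s. y' s + q s)) (cm_poly S (\<lambda>s. y s + q s))"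
      by (rule *[OF _ less(3,2) 2]) (rule less(1), auto)
    then show ?thesis using no_common_root_sym by blast
  next
    case 3
    let ?T = "S - {i}"
    have fin: "finite S" "finite ?T" using less by auto
    show ?thesis
    proof (cases "\<exists>s\<in>?T. y s \<noteq> y' s")
      case True
      have "card ?T < card S" using fin 3 by (meson card_Diff1_less)
      then obtain q where q: "no_common_root (cm_poly ?T (\<lambda>s. y s + q s)) (cm_poly ?T (\<lambda>s. y' s + q s))"
        using less(1)[of ?T ?T y y'] True fin 3 by auto
      define A where "A = cm_poly ?T (\<lambda>s. y s + q s)"
      define B where "B = cm_poly ?T (\<lambda>s. y' s + q s)"
      define C where "C = cm_rest S i (\<lambda>s. y s + q s)"
      define D where "D = cm_rest S i (\<lambda>s. y' s + q s)"
      \<comment> \<open>Obtained by eliminating \<open>t\<close> from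
        \<open>(z - y i - t) * A = C\<close> and \<open>(z - y' i - t) * B = D\<close>. Since
        \<open>C\<close> and \<open>D\<close> have degree below \<open>r\<close>, its coefficient at
        \<open>2 r\<close> is \<open>y' i - y i\<close>, which is nonzero.\<close>
      define E where "E = [:y' i - y i:] * (A * B) - C * B + D * A"
      obtain r where r: "card S = r + 1" "card ?T = r" using fin 3
        by (metis Suc_eq_plus1 card_Suc_Diff1)
      have "E \<noteq> 0"
      proof -
        have A: "coeff A r = 1" "\<And>k. k > r \<Longrightarrow> coeff A k = 0"
          using cm_poly_monic[OF fin(2)] r by (auto simp: A_def coeff_eq_0)
        have B: "coeff B r = 1" "\<And>k. k > r \<Longrightarrow> coeff B k = 0"
          using cm_poly_monic[OF fin(2)] r by (auto simp: B_def coeff_eq_0)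
        have C: "coeff C r = 0" "\<And>k. k > r \<Longrightarrow> coeff C k = 0"
          using coeff_cm_rest_high[OF fin(1)] r by (auto simp: C_def)
        have D: "coeff D r = 0" "\<And>k. k > r \<Longrightarrow> coeff D k = 0"
          using coeff_cm_rest_high[OF fin(1)] r by (auto simp: D_def)
        have "coeff E (r + r) = y' i - y i"
          using coeff_mult_top[OF A(2) B(2)] coeff_mult_top[OF C(2) B(2)] coeff_mult_top[OF D(2) A(2)]
            A(1) B(1) C(1) D(1) by (simp add: E_def)
        then show ?thesis using 3 by auto
      qed
      then have "finite {z. poly E z = 0}" by (rule poly_roots_finite)
      from finite_bad_values[OF this, of "\<lambda>z. if poly A z \<noteq> 0 then poly A z else poly B z"
          "\<lambda>z. if poly A z \<noteq> 0 then y i else y' i" "\<lambda>z. if poly A z \<noteq> 0 then poly C z else poly D z"]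
      obtain t where t: "\<And>z. poly E z = 0 \<Longrightarrow> (if poly A z \<noteq> 0 then poly A z else poly B z) \<noteq> 0 \<Longrightarrow>
        (z - (if poly A z \<noteq> 0 then y i else y' i) - t) * (if poly A z \<noteq> 0 then poly A z else poly B z) \<noteq>
        (if poly A z \<noteq> 0 then poly C z else poly D z)" by auto
      have e: "(\<lambda>s. f s + (q(i := t)) s) = (\<lambda>s. f s + q s)(i := f i + t)" for f by auto
      have "no_common_root (cm_poly S (\<lambda>s. y s + (q(i := t)) s)) (cm_poly S (\<lambda>s. y' s + (q(i := t)) s))"
        unfolding no_common_root_def
      proof (intro allI notI)
        fix z
        assume "poly (cm_poly S (\<lambda>s. y s + (q(i := t)) s)) z = 0 \<and> poly (cm_poly S (\<lambda>s. y' s + (q(i := t)) s)) z = 0"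
        then have z: "(z - y i - t) * poly A z = poly C z" "(z - y' i - t) * poly B z = poly D z"
          unfolding e poly_cm_poly_upd[OF fin(1) 3(2)] by (auto simp: A_def B_def C_def D_def diff_diff_add)
        have "poly E z = 0" unfolding E_def by (simp add: z[symmetric] algebra_simps)
        moreover have "poly A z \<noteq> 0 \<or> poly B z \<noteq> 0" using q by (auto simp: no_common_root_def A_def B_def)
        ultimately show False using t[of z] z by (cases "poly A z = 0") auto
      qed
      then show ?thesis using 3 by blast
    next
      case False
      \<comment> \<open>The data differ at \<open>i\<close> alone. The second polynomial is then the
        first minus \<open>y' i - y i\<close> times the minor, so a common root would be shared by
        the first polynomial and its minor.\<close>
      obtain d where d: "no_common_root (cm_poly S d) (cm_poly ?T d)"
        using minor_no_common_root[OF fin(1) 3(2)] by blast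
      define d' where "d' = (\<lambda>s. y' s + (d s - y s))"
      have "cm_poly ?T d' = cm_poly ?T d" "cm_rest S i d' = cm_rest S i d"
      proof -
        have "d' s = d s" if "s \<in> S - {i}" for s using False that unfolding d'_def by auto
        then show "cm_poly ?T d' = cm_poly ?T d" "cm_rest S i d' = cm_rest S i d"
          using cm_poly_cong[of ?T d' d] cm_rest_cong[of S i d' d] by simp_all
      qed
      then have "cm_poly S d' = cm_poly S d - [:y' i - y i:] * cm_poly ?T d"
      proof -
        have l: "[:- d' i, 1:] = [:- d i, 1:] - [:y' i - y i:]" by (simp add: d'_def)
        show ?thesis
          unfolding cm_poly_expand[OF fin(1) 3(2), of d] cm_poly_expand[OF fin(1) 3(2), of d']
            \<open>cm_poly ?T d' = cm_poly ?T d\<close> \<open>cm_rest S i d' = cm_rest S i d\<close> l left_diff_distrib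
          by (simp only: diff_diff_add add.commute)
      qed
      then have "no_common_root (cm_poly S d) (cm_poly S d')"
        using d 3 by (auto simp: no_common_root_def)
      moreover have "(\<lambda>s. y s + (d s - y s)) = d" by auto
      ultimately show ?thesis using 3 unfolding d'_def by (intro exI[of _ "\<lambda>s. d s - y s"]) simp
    qed
  qed
qed

section \<open>Polynomial paths in the group\<close>

definition polyfun1 :: "(complex \<Rightarrow> complex) \<Rightarrow> bool" where
  "polyfun1 f \<longleftrightarrow> (\<exists>p. \<forall>t. f t = poly p t)"

lemma polyfun1_const: "polyfun1 (\<lambda>t. c)"
  unfolding polyfun1_def by (rule exI[of _ "[:c:]"]) simp

lemma polyfun1_id: "polyfun1 (\<lambda>t. t)"
  unfolding polyfun1_def by (rule exI[of _ "[:0, 1:]"]) simp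

lemma polyfun1_add:
  assumes "polyfun1 f" "polyfun1 g"
  shows "polyfun1 (\<lambda>t. f t + g t)"
proof -
  obtain p q where "\<forall>t. f t = poly p t" "\<forall>t. g t = poly q t"
    using assms unfolding polyfun1_def by auto
  then show ?thesis unfolding polyfun1_def by (intro exI[of _ "p + q"]) simp
qed

lemma polyfun1_mult:
  assumes "polyfun1 f" "polyfun1 g"
  shows "polyfun1 (\<lambda>t. f t * g t)"
proof -
  obtain p q where "\<forall>t. f t = poly p t" "\<forall>t. g t = poly q t"
    using assms unfolding polyfun1_def by auto
  then show ?thesis unfolding polyfun1_def by (intro exI[of _ "p * q"]) simp
qed

lemma polyfun1_diff:
  assumes "polyfun1 f" "polyfun1 g"
  shows "polyfun1 (\<lambda>t. f t - g t)"
  using polyfun1_add[OF assms(1) polyfun1_mult[OF polyfun1_const[of "-1"] assms(2)]] by simp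

lemma polyfun1_sum:
  assumes "\<And>i. i \<in> I \<Longrightarrow> polyfun1 (f i)"
  shows "polyfun1 (\<lambda>t. \<Sum>i\<in>I. f i t)"
  using assms by (induct I rule: infinite_finite_induct) (auto intro: polyfun1_const polyfun1_add)

lemma polyfun1_prod:
  assumes "\<And>i. i \<in> I \<Longrightarrow> polyfun1 (f i)"
  shows "polyfun1 (\<lambda>t. \<Prod>i\<in>I. f i t)"
  using assms by (induct I rule: infinite_finite_induct) (auto intro: polyfun1_const polyfun1_mult)

lemma polyfun1_isCont: "polyfun1 f \<Longrightarrow> isCont f x"
proof -
  assume "polyfun1 f"
  then obtain p where "f = poly p" unfolding polyfun1_def by (auto simp: fun_eq_iff)
  then show ?thesis by simp
qed

lemma polyfun1_common_nonzero:
  assumes "polyfun1 f" "polyfun1 g" "f s \<noteq> 0" "g t \<noteq> 0"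
  shows "\<exists>x. f x \<noteq> 0 \<and> g x \<noteq> 0"
proof -
  obtain p q where p: "\<forall>t. f t = poly p t" "\<forall>t. g t = poly q t"
    using assms unfolding polyfun1_def by auto
  then have "p \<noteq> 0" "q \<noteq> 0" using assms by auto
  then have "p * q \<noteq> 0" by simp
  then have "\<exists>x. poly (p * q) x \<noteq> 0" by (metis poly_all_0_iff_0)
  then show ?thesis using p by auto
qed

definition polymat :: "nat \<Rightarrow> (complex \<Rightarrow> cmat) \<Rightarrow> bool" where
  "polymat n A \<longleftrightarrow> (\<forall>t. A t \<in> carrier_mat n n) \<and> (\<forall>i<n. \<forall>j<n. polyfun1 (\<lambda>t. A t $$ (i, j)))"

lemma polymatD: "polymat n A \<Longrightarrow> A t \<in> carrier_mat n n"
  "polymat n A \<Longrightarrow> i < n \<Longrightarrow> j < n \<Longrightarrow> polyfun1 (\<lambda>t. A t $$ (i, j))"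
  by (auto simp: polymat_def)

lemma polymat_const: "A \<in> carrier_mat n n \<Longrightarrow> polymat n (\<lambda>t. A)"
  by (auto simp: polymat_def polyfun1_const)

lemma polymat_add:
  assumes "polymat n A" "polymat n B"
  shows "polymat n (\<lambda>t. A t + B t)"
  unfolding polymat_def
proof (intro conjI allI impI)
  fix i j assume ij: "i < n" "j < n"
  have "(\<lambda>t. (A t + B t) $$ (i, j)) = (\<lambda>t. A t $$ (i, j) + B t $$ (i, j))"
    using ij by (intro ext) (simp add: carrier_matD[OF polymatD(1)[OF assms(1)]] carrier_matD[OF polymatD(1)[OF assms(2)]])
  then show "polyfun1 (\<lambda>t. (A t + B t) $$ (i, j))"
    using polyfun1_add polymatD(2)[OF assms(1) ij] polymatD(2)[OF assms(2) ij] by simp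
qed (use assms in \<open>auto simp: polymatD(1)\<close>)

lemma polymat_smult:
  assumes "polyfun1 f" "polymat n B"
  shows "polymat n (\<lambda>t. f t \<cdot>\<^sub>m B t)"
  unfolding polymat_def
proof (intro conjI allI impI)
  fix i j assume ij: "i < n" "j < n"
  have "(\<lambda>t. (f t \<cdot>\<^sub>m B t) $$ (i, j)) = (\<lambda>t. f t * B t $$ (i, j))"
    using ij by (intro ext) (simp add: carrier_matD[OF polymatD(1)[OF assms(2)]])
  then show "polyfun1 (\<lambda>t. (f t \<cdot>\<^sub>m B t) $$ (i, j))"
    using polyfun1_mult assms(1) polymatD(2)[OF assms(2) ij] by simp
qed (use assms in \<open>auto simp: polymatD(1)\<close>)

lemma polymat_mult:
  assumes "polymat n A" "polymat n B"
  shows "polymat n (\<lambda>t. A t * B t)"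
  unfolding polymat_def
proof (intro conjI allI impI)
  fix i j assume ij: "i < n" "j < n"
  have "(\<lambda>t. (A t * B t) $$ (i, j)) = (\<lambda>t. \<Sum>k\<in>{0..<n}. A t $$ (i, k) * B t $$ (k, j))"
    using ij by (intro ext) (simp add: scalar_prod_def carrier_matD[OF polymatD(1)[OF assms(1)]] carrier_matD[OF polymatD(1)[OF assms(2)]])
  moreover have "polyfun1 (\<lambda>t. \<Sum>k\<in>{0..<n}. A t $$ (i, k) * B t $$ (k, j))"
    by (intro polyfun1_sum polyfun1_mult polymatD(2)[OF assms(1)] polymatD(2)[OF assms(2)] ij) auto
  ultimately show "polyfun1 (\<lambda>t. (A t * B t) $$ (i, j))" by simp
qed (rule sq_mult[OF polymatD(1)[OF assms(1)] polymatD(1)[OF assms(2)]])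

lemma polymat_det:
  assumes "polymat n A"
  shows "polyfun1 (\<lambda>t. det (A t))"
proof -
  have "polyfun1 (\<lambda>t. \<Sum>p\<in>{p. p permutes {0..<n}}. signof p * (\<Prod>i = 0..<n. A t $$ (i, p i)))"
    by (intro polyfun1_sum polyfun1_mult polyfun1_const polyfun1_prod polymatD(2)[OF assms])
      (auto simp: permutes_in_image)
  then show ?thesis using det_def'[OF polymatD(1)[OF assms]] by simp
qed

lemma polymat_mat_poly:
  assumes "polymat n A"
  shows "polymat n (\<lambda>t. mat_poly p (A t))"
proof (induct p rule: pCons_induct)
  case 0
  then show ?case using mat_poly_0[OF polymatD(1)[OF assms]] polymat_const[of "0\<^sub>m n n" n] by simp
next
  case (pCons a p)
  have "polymat n (\<lambda>t. a \<cdot>\<^sub>m 1\<^sub>m n + A t * mat_poly p (A t))"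
    by (intro polymat_add polymat_mult assms pCons(2) polymat_const) auto
  then show ?case using mat_poly_pCons[OF polymatD(1)[OF assms]] by simp
qed

text \<open>The uniform degree bound permits a Horner recursion of fixed depth although
  \<open>degree (p t)\<close> may vary. Needed because the characteristic polynomial along a path
  itself moves with \<open>t\<close>.\<close>

lemma polymat_mat_poly_var:
  assumes "polymat n A" "\<And>k. polyfun1 (\<lambda>t. coeff (p t) k)" "\<And>t. degree (p t) \<le> d"
  shows "polymat n (\<lambda>t. mat_poly (p t) (A t))"
  using assms(2,3)
proof (induct d arbitrary: p)
  case 0
  have "p t = [:coeff (p t) 0:]" for t using 0(2)[of t] by (metis degree_eq_zeroE coeff_pCons_0 le_zero_eq)
  then have "mat_poly (p t) (A t) = coeff (p t) 0 \<cdot>\<^sub>m 1\<^sub>m n" for t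
    using mat_poly_const[OF polymatD(1)[OF assms(1)]] by metis
  moreover have "polymat n (\<lambda>t. coeff (p t) 0 \<cdot>\<^sub>m 1\<^sub>m n)"
    by (intro polymat_smult 0 polymat_const) auto
  ultimately show ?case by simp
next
  case (Suc d)
  define q where "q = (\<lambda>t. poly_shift 1 (p t))"
  have p: "p t = pCons (coeff (p t) 0) (q t)" for t
    unfolding q_def by (intro poly_eqI) (simp add: coeff_pCons coeff_poly_shift split: nat.split)
  have "polymat n (\<lambda>t. mat_poly (q t) (A t))"
  proof (rule Suc(1))
    show "polyfun1 (\<lambda>t. coeff (q t) k)" for k
      using Suc(2)[of "k + 1"] by (simp add: q_def coeff_poly_shift)
    show "degree (q t) \<le> d" for t
      using Suc(3)[of t] by (intro degree_le) (auto simp: q_def coeff_poly_shift coeff_eq_0)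
  qed
  then have "polymat n (\<lambda>t. coeff (p t) 0 \<cdot>\<^sub>m 1\<^sub>m n + A t * mat_poly (q t) (A t))"
    by (intro polymat_add polymat_mult polymat_smult polymat_const assms(1) Suc(2)) auto
  moreover have "mat_poly (p t) (A t) = coeff (p t) 0 \<cdot>\<^sub>m 1\<^sub>m n + A t * mat_poly (q t) (A t)" for t
    using mat_poly_pCons[OF polymatD(1)[OF assms(1)]] p[of t] by metis
  ultimately show ?case by simp
qed

lemma polyfun1_coeff_prod:
  assumes "\<And>i k. i \<in> I \<Longrightarrow> polyfun1 (\<lambda>t. coeff (f i t) k)"
  shows "polyfun1 (\<lambda>t. coeff (\<Prod>i\<in>I. f i t) k)"
  using assms
proof (induct I arbitrary: k rule: infinite_finite_induct)
  case (insert i I)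
  then show ?case
    by (simp add: coeff_mult) (intro polyfun1_sum polyfun1_mult, auto)
qed (auto intro: polyfun1_const)

lemma polyfun1_coeff_char_poly:
  assumes "polymat n A"
  shows "polyfun1 (\<lambda>t. coeff (char_poly (A t)) k)"
proof -
  define C where "C = (\<lambda>t. [:0, 1:] \<cdot>\<^sub>m 1\<^sub>m n + map_mat (\<lambda>a. [:- a:]) (A t))"
  have c: "C t \<in> carrier_mat n n" for t
    using polymatD(1)[OF assms] by (simp add: C_def)
  have char: "char_poly (A t) = det (C t)" for t
    unfolding char_poly_defs C_def carrier_matD(1)[OF polymatD(1)[OF assms]] ..
  have entry: "C t $$ (i, j) = (if i = j then [:- A t $$ (i, j), 1:] else [:- A t $$ (i, j):])"
    if "i < n" "j < n" for i j t
    using that by (simp add: C_def carrier_matD[OF polymatD(1)[OF assms]])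
  have *: "polyfun1 (\<lambda>t. coeff (C t $$ (i, j)) k)" if ij: "i < n" "j < n" for i j k
  proof -
    have m: "polyfun1 (\<lambda>t. - A t $$ (i, j))"
      using polyfun1_diff[OF polyfun1_const[of 0] polymatD(2)[OF assms ij]] by simp
    consider "k = 0" | "k = 1" | "k > 1" by linarith
    then show ?thesis
    proof cases
      case 1
      then have "coeff (C t $$ (i, j)) k = - A t $$ (i, j)" for t 
        using entry[OF ij] by simp
      then show ?thesis using m by simp
    next
      case 2
      then have "coeff (C t $$ (i, j)) k = (if i = j then 1 else 0)" for t 
        using entry[OF ij] by simp
      then show ?thesis using polyfun1_const by simp
    next
      case 3
      then have "coeff (C t $$ (i, j)) k = 0" for t 
        using entry[OF ij] by (simp add: coeff_eq_0)
      then show ?thesis using polyfun1_const by simp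
    qed
  qed
  have "polyfun1 (\<lambda>t. \<Sum>p\<in>{p. p permutes {0..<n}}. of_int (sign p) * coeff (\<Prod>i = 0..<n. C t $$ (i, p i)) k)"
    by (intro polyfun1_sum polyfun1_mult polyfun1_const polyfun1_coeff_prod *)
      (auto simp: permutes_in_image)
  moreover have "coeff (char_poly (A t)) k = (\<Sum>p\<in>{p. p permutes {0..<n}}. of_int (sign p) * coeff (\<Prod>i = 0..<n. C t $$ (i, p i)) k)" for t
    unfolding char det_def'[OF c] coeff_sum
  proof (rule sum.cong[OF refl])
    fix p :: "nat \<Rightarrow> nat"
    show "coeff (signof p * (\<Prod>i = 0..<n. C t $$ (i, p i))) k =
      of_int (sign p) * coeff (\<Prod>i = 0..<n. C t $$ (i, p i)) k"
      by (cases p rule: sign_cases) simp_all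
  qed
  ultimately show ?thesis by simp
qed

text \<open>Splitting \<open>p\<close> into linear factors turns the determinant into a product of
  values of the characteristic polynomial. Up to a nonzero constant it is the resultant of the two
  polynomials.\<close>

lemma det_mat_poly_eq_0_iff:
  assumes A: "A \<in> carrier_mat n n" and "p \<noteq> 0"
  shows "det (mat_poly p A) = 0 \<longleftrightarrow> (\<exists>z. poly p z = 0 \<and> eigenvalue A z)"
proof
  assume "\<exists>z. poly p z = 0 \<and> eigenvalue A z"
  then obtain z v where z: "poly p z = 0" and "eigenvector A v z" by (auto simp: eigenvalue_def)
  then have v: "v \<in> carrier_vec n" "v \<noteq> 0\<^sub>v n" "A *\<^sub>v v = z \<cdot>\<^sub>v v" using A by (auto simp: eigenvector_def)
  have "mat_poly p A *\<^sub>v v = 0\<^sub>v n"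
    using mat_poly_eigenvector[OF A v(1,3)] z v by auto
  then show "det (mat_poly p A) = 0"
    using v A det_0_iff_vec_prod_zero_field[of "mat_poly p A" n] by auto
next
  assume "det (mat_poly p A) = 0"
  moreover have "\<forall>z. poly p z = 0 \<longrightarrow> \<not> eigenvalue A z \<Longrightarrow> det (mat_poly p A) \<noteq> 0"
    using \<open>p \<noteq> 0\<close>
  proof (induct "degree p" arbitrary: p)
    case 0
    then obtain c where "p = [:c:]" "c \<noteq> 0" by (metis degree_eq_zeroE pCons_eq_0_iff)
    then show ?case by (simp add: mat_poly_const[OF A])
  next
    case (Suc d)
    then have "degree p \<noteq> 0" by simp
    then have "\<not> constant (poly p)" by (simp add: constant_degree)
    then obtain z where z: "poly p z = 0" using fundamental_theorem_of_algebra by blast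
    then obtain q where q: "p = [:- z, 1:] * q" using poly_eq_0_iff_dvd by blast
    have "q \<noteq> 0" using q Suc by auto
    have "degree p = 1 + degree q" unfolding q using \<open>q \<noteq> 0\<close> by (subst degree_mult_eq) auto
    then have "det (mat_poly q A) \<noteq> 0" using Suc q \<open>q \<noteq> 0\<close> by (intro Suc(1)) auto
    moreover have "det (mat_poly [:- z, 1:] A) \<noteq> 0"
    proof -
      have "mat_poly [:- z, 1:] A = char_matrix A z"
        unfolding char_matrix_def mat_poly_X[OF A] using A by (intro eq_matI) auto
      then show ?thesis using eigenvalue_det[OF A, of z] Suc(3) z by auto
    qed
    ultimately show ?case unfolding q mat_poly_mult[OF A] using A
      by (subst det_mult[of _ n]) auto
  qed
  ultimately show "\<exists>z. poly p z = 0 \<and> eigenvalue A z" by blast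
qed

text \<open>Up to sign the discriminant of the characteristic polynomial, in a form that is visibly
  polynomial along paths.\<close>

definition simple_spectrum :: "cmat \<Rightarrow> bool" where
  "simple_spectrum A \<longleftrightarrow> det (mat_poly (pderiv (char_poly A)) A) \<noteq> 0"

text \<open>Up to sign the resultant of the two characteristic polynomials.\<close>

definition disjoint_spectra :: "cmat \<Rightarrow> cmat \<Rightarrow> bool" where
  "disjoint_spectra A B \<longleftrightarrow> det (mat_poly (char_poly A) B) \<noteq> 0"

lemma char_poly_neq_0: "(A :: cmat) \<in> carrier_mat n n \<Longrightarrow> char_poly A \<noteq> 0"
  using degree_monic_char_poly[of A n] by auto

lemma disjoint_spectra_iff:
  assumes "A \<in> carrier_mat n n" "B \<in> carrier_mat m m"
  shows "disjoint_spectra A B \<longleftrightarrow> (\<forall>z. \<not> (eigenvalue A z \<and> eigenvalue B z))"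
  unfolding disjoint_spectra_def 
  using det_mat_poly_eq_0_iff[OF assms(2) char_poly_neq_0[OF assms(1)]] eigenvalue_root_char_poly[OF assms(1)]
  by blast

lemma simple_spectrum_iff:
  assumes A: "A \<in> carrier_mat n n" and n: "n > 0"
  shows "simple_spectrum A \<longleftrightarrow> rsquarefree (char_poly A)"
proof -
  have "pderiv (char_poly A) \<noteq> 0"
    using degree_monic_char_poly[OF A] n by (auto simp: pderiv_eq_0_iff)
  then show ?thesis
    unfolding simple_spectrum_def rsquarefree_roots
    using det_mat_poly_eq_0_iff[OF A] eigenvalue_root_char_poly[OF A] by blast
qed

lemma char_poly_conj:
  fixes A :: cmat
  assumes "A \<in> carrier_mat n n" "inverses n g h"
  shows "char_poly (g * A * h) = char_poly A"
proof -
  have "similar_mat (g * A * h) A"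
    by (rule similar_matI[of _ _ g h n]) (use assms in \<open>auto simp: inverses_def\<close>)
  then show ?thesis by (rule char_poly_similar)
qed

section \<open>Paths between words and generic conditions along them\<close>

text \<open>The words \<open>u\<close> scaled by \<open>t\<close> and \<open>v\<close> scaled by \<open>1 - t\<close>
  form a polynomial path joining the two group elements.\<close>

definition scale_word :: "complex \<Rightarrow> (bool \<times> complex poly) list \<Rightarrow> (bool \<times> complex poly) list" where
  "scale_word c w = map (\<lambda>(b, p). (b, Polynomial.smult c p)) w"

lemma scale_word_1: "scale_word 1 w = w"
  by (induct w) (auto simp: scale_word_def)

lemma act_scale_word_0: "a \<in> pairs n \<Longrightarrow> act (scale_word 0 w) a = a"
proof (induct w)
  case (Cons s w)
  have "shiftX 0 a = a" "shiftY 0 a = a"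
    using Cons(2) by (auto simp: shiftX_def shiftY_def pairs_def mat_poly_0[where n=n])
  then show ?case using Cons by (cases s) (auto simp: scale_word_def)
qed (simp add: scale_word_def)

lemma polymat_act_scale:
  assumes "polymat n (\<lambda>t. fst (a t))" "polymat n (\<lambda>t. snd (a t))" "polyfun1 f"
  shows "polymat n (\<lambda>t. fst (act (scale_word (f t) w) (a t))) \<and>
    polymat n (\<lambda>t. snd (act (scale_word (f t) w) (a t)))"
proof (induct w)
  case Nil
  then show ?case using assms by (simp add: scale_word_def)
next
  case (Cons s w)
  obtain b p where s: "s = (b, p)" by (cases s)
  define c where "c = (\<lambda>t. act (scale_word (f t) w) (a t))"
  have X: "polymat n (\<lambda>t. fst (c t))" and Y: "polymat n (\<lambda>t. snd (c t))" using Cons by (auto simp: c_def)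
  have "polymat n (\<lambda>t. fst (c t) + f t \<cdot>\<^sub>m mat_poly p (snd (c t)))" "polymat n (\<lambda>t. snd (c t) + f t \<cdot>\<^sub>m mat_poly p (fst (c t)))"
    by (intro polymat_add polymat_smult assms polymat_mat_poly X Y)+
  then have "polymat n (\<lambda>t. fst (c t) + mat_poly (Polynomial.smult (f t) p) (snd (c t)))"
    "polymat n (\<lambda>t. snd (c t) + mat_poly (Polynomial.smult (f t) p) (fst (c t)))"
    using mat_poly_smult[OF polymatD(1)[OF X]] mat_poly_smult[OF polymatD(1)[OF Y]] by simp_all
  moreover have "act (scale_word (f t) (s # w)) (a t) = 
      (if b then shiftX (Polynomial.smult (f t) p) (c t) else shiftY (Polynomial.smult (f t) p) (c t))" for t
    by (simp add: s scale_word_def c_def)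
  ultimately show ?case using X Y by (cases b) (simp_all add: shiftX_def shiftY_def)
qed

definition word_path :: "(bool \<times> complex poly) list \<Rightarrow> (bool \<times> complex poly) list \<Rightarrow> complex \<Rightarrow>
    (bool \<times> complex poly) list" where
  "word_path u v t = scale_word t u @ scale_word (1 - t) v"

lemma polymat_word_path:
  assumes "a \<in> pairs n"
  shows "polymat n (\<lambda>t. fst (act (word_path u v t) a))"
proof -
  have f: "polyfun1 (\<lambda>t. 1 - t)" by (intro polyfun1_diff polyfun1_const polyfun1_id)
  have "polymat n (\<lambda>t. fst (act (scale_word (1 - t) v) a)) \<and> polymat n (\<lambda>t. snd (act (scale_word (1 - t) v) a))"
    using polymat_act_scale[of n "\<lambda>t. a" "\<lambda>t. 1 - t" v] f polymat_const pairsD[OF assms] by auto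
  then show ?thesis
    using polymat_act_scale[of n "\<lambda>t. act (scale_word (1 - t) v) a" "\<lambda>t. t" u] polyfun1_id
    by (auto simp: word_path_def act_append)
qed

lemma word_path_ends:
  assumes "a \<in> pairs n"
  shows "act (word_path u v 1) a = act u a" "act (word_path u v 0) a = act v a"
  using assms by (simp_all add: word_path_def act_append scale_word_1 act_scale_word_0[of _ n] act_pairs)

text \<open>Open dense conditions on group elements: a condition is the nonvanishing of a function that is
  polynomial along all these paths.\<close>

definition path_poly :: "((bool \<times> complex poly) list \<Rightarrow> complex) \<Rightarrow> bool" where
  "path_poly F \<longleftrightarrow> (\<forall>u v. polyfun1 (\<lambda>t. F (word_path u v t)) \<and> F (word_path u v 1) = F u \<and> F (word_path u v 0) = F v)"

lemma path_poly_mult: "path_poly F \<Longrightarrow> path_poly G \<Longrightarrow> path_poly (\<lambda>w. F w * G w)"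
  by (auto simp: path_poly_def intro: polyfun1_mult)

lemma path_poly_const: "path_poly (\<lambda>w. c)"
  by (auto simp: path_poly_def intro: polyfun1_const)

lemma path_poly_prod: "(\<And>i. i \<in> I \<Longrightarrow> path_poly (F i)) \<Longrightarrow> path_poly (\<lambda>w. \<Prod>i\<in>I. F i w)"
  by (induct I rule: infinite_finite_induct) (auto intro: path_poly_const path_poly_mult)

text \<open>Plays the part of irreducibility of the group. Join a word good for the earlier
  conditions to a word good for the new one: the product of the old conditions and the new one are
  both nonzero polynomials in \<open>t\<close>, so some \<open>t\<close> satisfies all.\<close>

lemma path_poly_simultaneous:
  assumes "finite I" "\<And>i. i \<in> I \<Longrightarrow> path_poly (F i)" "\<And>i. i \<in> I \<Longrightarrow> \<exists>w. F i w \<noteq> 0"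
  shows "\<exists>w. \<forall>i\<in>I. F i w \<noteq> 0"
  using assms
proof (induct I rule: finite_induct)
  case empty
  then show ?case by simp
next
  case (insert i I)
  then obtain u where u: "\<forall>i\<in>I. F i u \<noteq> 0" by auto
  obtain v where v: "F i v \<noteq> 0" using insert(5)[of i] by blast
  define P where "P = (\<lambda>w. \<Prod>i\<in>I. F i w)"
  have P: "path_poly P" unfolding P_def by (rule path_poly_prod) (use insert in auto)
  have Pu: "P u \<noteq> 0" using u insert by (simp add: P_def)
  have Fi: "path_poly (F i)" using insert by simp
  obtain t where "P (word_path u v t) \<noteq> 0" "F i (word_path u v t) \<noteq> 0"
    using polyfun1_common_nonzero[of "\<lambda>t. P (word_path u v t)" "\<lambda>t. F i (word_path u v t)" 1 0]
      P Fi Pu v unfolding path_poly_def by auto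
  then show ?case using insert(1) by (intro exI[of _ "word_path u v t"]) (auto simp: P_def)
qed

lemma path_poly_simple_spectrum:
  assumes a: "a \<in> pairs n"
  shows "path_poly (\<lambda>w. det (mat_poly (pderiv (char_poly (fst (act w a)))) (fst (act w a))))"
  unfolding path_poly_def
proof (intro allI conjI)
  fix u v
  let ?A = "\<lambda>t. fst (act (word_path u v t) a)"
  have A: "polymat n ?A" by (rule polymat_word_path[OF a])
  show "polyfun1 (\<lambda>t. det (mat_poly (pderiv (char_poly (?A t))) (?A t)))"
  proof (rule polymat_det[of n], rule polymat_mat_poly_var[of n _ _ n])
    show "polyfun1 (\<lambda>t. coeff (pderiv (char_poly (?A t))) k)" for k
      unfolding coeff_pderiv by (intro polyfun1_mult polyfun1_const polyfun1_coeff_char_poly[OF A])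
    show "degree (pderiv (char_poly (?A t))) \<le> n" for t
      using degree_monic_char_poly[OF polymatD(1)[OF A]] by (auto simp: degree_pderiv)
  qed (rule A)
qed (simp_all add: word_path_ends[OF a])

lemma path_poly_disjoint_spectra:
  assumes a: "a \<in> pairs n" and b: "b \<in> pairs m"
  shows "path_poly (\<lambda>w. det (mat_poly (char_poly (fst (act w a))) (fst (act w b))))"
  unfolding path_poly_def
proof (intro allI conjI)
  fix u v
  let ?A = "\<lambda>t. fst (act (word_path u v t) a)" and ?B = "\<lambda>t. fst (act (word_path u v t) b)"
  have A: "polymat n ?A" and B: "polymat m ?B" by (rule polymat_word_path[OF a], rule polymat_word_path[OF b])
  show "polyfun1 (\<lambda>t. det (mat_poly (char_poly (?A t)) (?B t)))"
  proof (rule polymat_det[of m], rule polymat_mat_poly_var[of m _ _ n])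
    show "polyfun1 (\<lambda>t. coeff (char_poly (?A t)) k)" for k
      by (rule polyfun1_coeff_char_poly[OF A])
    show "degree (char_poly (?A t)) \<le> n" for t
      using degree_monic_char_poly[OF polymatD(1)[OF A]] by auto
  qed (rule B)
qed (simp_all add: word_path_ends[OF a] word_path_ends[OF b])

section \<open>Traces and the Cayley-Hamilton theorem\<close>

definition mtrace :: "'a::comm_ring_1 mat \<Rightarrow> 'a" where
  "mtrace A = (\<Sum>i<dim_row A. A $$ (i, i))"

context
  fixes n :: nat
begin

lemma mtrace_add:
  "A \<in> carrier_mat n n \<Longrightarrow> B \<in> carrier_mat n n \<Longrightarrow> mtrace (A + B) = mtrace A + mtrace B"
  by (simp add: mtrace_def sum.distrib)

lemma mtrace_diff:
  "A \<in> carrier_mat n n \<Longrightarrow> B \<in> carrier_mat n n \<Longrightarrow> mtrace (A - B) = mtrace A - mtrace B"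
  by (simp add: mtrace_def sum_subtractf)

lemma mtrace_smult: "A \<in> carrier_mat n n \<Longrightarrow> mtrace (c \<cdot>\<^sub>m A) = c * mtrace A"
  by (simp add: mtrace_def sum_distrib_left)

lemma mtrace_comm:
  assumes "A \<in> carrier_mat n n" "B \<in> carrier_mat n n"
  shows "mtrace (A * B) = mtrace (B * A)"
proof -
  have "mtrace (A * B) = (\<Sum>i<n. \<Sum>k<n. A $$ (i, k) * B $$ (k, i))"
    using assms by (simp add: mtrace_def scalar_prod_def lessThan_atLeast0)
  also have "\<dots> = (\<Sum>k<n. \<Sum>i<n. B $$ (k, i) * A $$ (i, k))"
    by (subst sum.swap) (simp add: mult.commute)
  also have "\<dots> = mtrace (B * A)"
    using assms by (simp add: mtrace_def scalar_prod_def lessThan_atLeast0)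
  finally show ?thesis .
qed

lemma mtrace_cyc3:
  assumes "A \<in> carrier_mat n n" "B \<in> carrier_mat n n" "C \<in> carrier_mat n n"
  shows "mtrace (A * (B * C)) = mtrace (B * (C * A))"
  using mtrace_comm[of A "B * C"] assms by (simp add: sq_assoc[of _ n])

lemma mtrace_cyc4:
  assumes "A \<in> carrier_mat n n" "B \<in> carrier_mat n n" "C \<in> carrier_mat n n" "D \<in> carrier_mat n n"
  shows "mtrace (A * (B * (C * D))) = mtrace (B * (C * (D * A)))"
  using mtrace_cyc3[of A B "C * D"] assms by (simp add: sq_ring[where n=n])

end

lemmas mtrace_linear = mtrace_add mtrace_diff mtrace_smult

lemma mtrace_conj:
  assumes "A \<in> carrier_mat n n" "inverses n g h"
  shows "mtrace (g * A * h) = mtrace A"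
  using mtrace_comm[of "g * A" n h] assms 
  by (auto simp: inverses_def sq_ring[where n=n] sq_cancel[where n=n])

lemma schur_form:
  assumes A: "(A :: cmat) \<in> carrier_mat n n" and as: "char_poly A = (\<Prod>a\<leftarrow>as. [:- a, 1:])"
  obtains T g h where "T \<in> carrier_mat n n" "inverses n g h" "A = g * T * h"
    "\<And>i j. i < n \<Longrightarrow> j < i \<Longrightarrow> T $$ (i, j) = 0" "length as = n" "\<And>i. i < n \<Longrightarrow> T $$ (i, i) = as ! i"
proof -
  obtain T g h where s: "schur_decomposition A as = (T, g, h)" by (cases "schur_decomposition A as") auto
  have *: "similar_mat_wit A T g h" "upper_triangular T" "diag_mat T = as"
    using schur_decomposition[OF A as s] by auto
  from *(1) have c: "T \<in> carrier_mat n n" "inverses n g h" "A = g * T * h"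
    using A by (auto simp: similar_mat_wit_def Let_def inverses_def)
  show thesis
  proof (rule that[OF c])
    show "T $$ (i, j) = 0" if "i < n" "j < i" for i j 
      using *(2) that c by (auto simp: upper_triangular_def)
    show "length as = n" using *(3) c by (auto simp: diag_mat_def)
    show "T $$ (i, i) = as ! i" if "i < n" for i using *(3) c that by (auto simp: diag_mat_def)
  qed
qed

lemma mat_poly_upper_triangular:
  assumes T: "T \<in> carrier_mat n n" and ut: "\<And>i j. i < n \<Longrightarrow> j < i \<Longrightarrow> T $$ (i, j) = 0"
  shows "(\<forall>i<n. \<forall>j<i. mat_poly p T $$ (i, j) = 0) \<and> (\<forall>i<n. mat_poly p T $$ (i, i) = poly p (T $$ (i, i)))"
proof (induct p rule: pCons_induct)
  case 0
  then show ?case using T by (auto simp: mat_poly_0)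
next
  case (pCons a p)
  let ?M = "mat_poly p T"
  have M: "?M \<in> carrier_mat n n" using T by simp
  have e: "(T * ?M) $$ (i, j) = (\<Sum>k\<in>{0..<n}. T $$ (i, k) * ?M $$ (k, j))" if "i < n" "j < n" for i j
    using that T M by (simp add: scalar_prod_def)
  have "(T * ?M) $$ (i, j) = 0" if "i < n" "j < i" for i j
  proof -
    have "T $$ (i, k) * ?M $$ (k, j) = 0" if "k < n" for k
      using ut[of i k] pCons(2) \<open>i < n\<close> \<open>j < i\<close> that by (cases "k < i") auto
    then have "(\<Sum>k\<in>{0..<n}. T $$ (i, k) * ?M $$ (k, j)) = 0"
      by (intro sum.neutral ballI) simp
    then show ?thesis using e that by simp
  qed
  moreover have "(T * ?M) $$ (i, i) = T $$ (i, i) * ?M $$ (i, i)" if "i < n" for i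
  proof -
    have "(\<Sum>k\<in>{0..<n}. T $$ (i, k) * ?M $$ (k, i)) = (\<Sum>k\<in>{i}. T $$ (i, k) * ?M $$ (k, i))"
    proof (rule sum.mono_neutral_right)
      show "\<forall>k\<in>{0..<n} - {i}. T $$ (i, k) * ?M $$ (k, i) = 0"
      proof
        fix k assume "k \<in> {0..<n} - {i}"
        then consider "k < i" "k < n" | "k > i" "k < n" by fastforce
        then show "T $$ (i, k) * ?M $$ (k, i) = 0"
          using ut[of i k] pCons(2) that by cases auto
      qed
    qed (use that in auto)
    then show ?thesis using e that by simp
  qed
  ultimately show ?case using T M pCons(2) by (simp add: mat_poly_pCons[where n=n])
qed

lemma mtrace_mat_poly:
  assumes A: "A \<in> carrier_mat n n" and as: "char_poly A = (\<Prod>a\<leftarrow>as. [:- a, 1:])"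
  shows "mtrace (mat_poly p A) = (\<Sum>a\<leftarrow>as. poly p a)"
proof -
  obtain T g h where T: "T \<in> carrier_mat n n" "inverses n g h" "A = g * T * h"
    "\<And>i j. i < n \<Longrightarrow> j < i \<Longrightarrow> T $$ (i, j) = 0" "length as = n" "\<And>i. i < n \<Longrightarrow> T $$ (i, i) = as ! i"
    using schur_form[OF A as] by metis
  have "mtrace (mat_poly p A) = mtrace (mat_poly p T)"
    using mat_poly_conj[OF T(1), of g h] T(2) mtrace_conj[of "mat_poly p T" n g h] T(1,3)
    by (auto simp: inverses_def)
  also have "\<dots> = (\<Sum>i<n. poly p (as ! i))"
    using mat_poly_upper_triangular[OF T(1,4)] T by (simp add: mtrace_def)
  also have "\<dots> = (\<Sum>a\<leftarrow>as. poly p a)"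
    by (simp add: sum_list_sum_nth T(5) lessThan_atLeast0)
  finally show ?thesis .
qed

text \<open>In triangular form the product of the first \<open>k\<close> linear factors annihilates
  the first \<open>k\<close> basis vectors, each new factor mapping the next basis vector into the
  span of the previous ones.\<close>

lemma cayley_hamilton:
  assumes A: "A \<in> carrier_mat n n"
  shows "mat_poly (char_poly A) A = 0\<^sub>m n n"
proof -
  obtain as where as: "char_poly A = (\<Prod>a\<leftarrow>as. [:- a, 1:])"
    using char_poly_factorized[OF A] by blast
  obtain T g h where T: "T \<in> carrier_mat n n" "inverses n g h" "A = g * T * h"
    "\<And>i j. i < n \<Longrightarrow> j < i \<Longrightarrow> T $$ (i, j) = 0" "length as = n" "\<And>i. i < n \<Longrightarrow> T $$ (i, i) = as ! i"
    using schur_form[OF A as] by metis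
  let ?P = "\<lambda>k. \<Prod>a\<leftarrow>take k as. [:- a, 1:]"
  have "\<forall>i<n. \<forall>j<k. mat_poly (?P k) T $$ (i, j) = 0" if "k \<le> n" for k
    using that
  proof (induct k)
    case 0
    then show ?case by simp
  next
    case (Suc k)
    let ?M = "mat_poly (?P k) T" and ?N = "(- as ! k) \<cdot>\<^sub>m 1\<^sub>m n + T"
    have "?P (Suc k) = ?P k * [:- as ! k, 1:]"
      using Suc T(5) by (simp add: take_Suc_conv_app_nth)
    then have "mat_poly (?P (Suc k)) T = ?M * ?N"
      by (simp only: mat_poly_mult[OF T(1)] mat_poly_X[OF T(1)])
    moreover have "(?M * ?N) $$ (i, j) = 0" if ij: "i < n" "j < Suc k" for i j
    proof -
      have "(?M * ?N) $$ (i, j) = (\<Sum>l\<in>{0..<n}. ?M $$ (i, l) * ?N $$ (l, j))"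
        using ij Suc T(1) by (simp add: scalar_prod_def)
      also have "\<dots> = 0"
      proof (rule sum.neutral, rule ballI)
        fix l assume l: "l \<in> {0..<n}"
        show "?M $$ (i, l) * ?N $$ (l, j) = 0"
        proof (cases "l < k")
          case True
          then show ?thesis using Suc ij by simp
        next
          case False
          have "?N $$ (l, j) = 0"
          proof (cases "j < l")
            case True
            then show ?thesis using T(1) T(4)[of l j] l ij Suc by auto
          next
            case jl: False
            then have "l = k" "j = k" using False ij by auto
            then show ?thesis using T(1) T(6)[of k] l by auto
          qed
          then show ?thesis by simp
        qed
      qed
      finally show ?thesis .
    qed
    ultimately show ?case by simp
  qed
  from this[of n] have "mat_poly (char_poly A) T = 0\<^sub>m n n"
    using T(1,5) unfolding as by (intro eq_matI) auto
  then show ?thesis using mat_poly_conj[OF T(1), of g h "char_poly A"] T(2,3)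
    by (auto simp: inverses_def sq_ring[where n=n])
qed

text \<open>Truncated geometric series: if \<open>v\<close> is \<open>u\<close> normalised to value
  1 at \<open>c\<close>, then \<open>(1 - v) ^ k\<close> is divisible by the modulus and
  \<open>1 - (1 - v) ^ k\<close> is a multiple of \<open>v\<close>.\<close>

lemma inverse_mod_linear_power:
  fixes u :: "complex poly"
  assumes "poly u c \<noteq> 0"
  shows "\<exists>s. [:- c, 1:] ^ k dvd s * u - 1"
proof -
  define v where "v = Polynomial.smult (1 / poly u c) u"
  have "poly (1 - v) c = 0" using assms by (simp add: v_def)
  then have "[:- c, 1:] ^ k dvd (1 - v) ^ k"
    using poly_eq_0_iff_dvd dvd_power_same by blast
  moreover have "v dvd 1 - (1 - v) ^ k"
  proof -
    have "1 - (1 - v) dvd 1 ^ k - (1 - v) ^ k"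
      by (subst power_diff_sumr2) (rule dvd_triv_left)
    then show ?thesis by simp
  qed
  then obtain r where "1 - (1 - v) ^ k = v * r" by (rule dvdE)
  then have "(1 - v) ^ k = - (Polynomial.smult (1 / poly u c) r * u - 1)" 
    by (simp add: v_def algebra_simps)
  ultimately have "[:- c, 1:] ^ k dvd Polynomial.smult (1 / poly u c) r * u - 1"
    by (metis dvd_minus_iff)
  then show ?thesis by blast
qed

lemma quartic_zero:
  fixes a b c d e :: complex
  assumes "\<And>t. a + t * b + t^2 * c + t^3 * d + t^4 * e = 0"
  shows "a = 0 \<and> b = 0 \<and> c = 0 \<and> d = 0 \<and> e = 0"
proof -
  have "poly [:a, b, c, d, e:] t = a + t * b + t^2 * c + t^3 * d + t^4 * e" for t
    by (simp add: algebra_simps power2_eq_square power3_eq_cube power4_eq_xxxx)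
  then have "\<forall>t. poly [:a, b, c, d, e:] t = 0" using assms by simp
  then have "[:a, b, c, d, e:] = 0" using poly_all_0_iff_0 by blast
  then show ?thesis by simp
qed

text \<open>The corner of a rank-one perturbed commutator. The traces of the first, second and fourth power of
  \<open>Y + tX\<close> and of the third power of \<open>Y + tX\<^sup>2\<close> vanish for nilpotent matrices, and
  comparing coefficients of \<open>t\<close> already forces the size of the corner to be 0 or 1.\<close>

lemma corner_size_if_nilpotent_pencil:
  fixes X Y e :: cmat
  assumes c: "X \<in> carrier_mat n n" "Y \<in> carrier_mat n n" "e \<in> carrier_mat n n"
    and e: "e * X = X" "X * e = X" "e * Y = Y" "Y * e = Y" "e * e = e"
    and P: "P = X * Y - Y * X + e"
    and r: "P * P = mtrace P \<cdot>\<^sub>m P"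
    and q2: "\<And>t. mtrace ((Y + t \<cdot>\<^sub>m X) * (Y + t \<cdot>\<^sub>m X)) = 0"
    and q4: "\<And>t. mtrace ((Y + t \<cdot>\<^sub>m X) * ((Y + t \<cdot>\<^sub>m X) * ((Y + t \<cdot>\<^sub>m X) * (Y + t \<cdot>\<^sub>m X)))) = 0"
    and q3: "\<And>t. mtrace ((Y + t \<cdot>\<^sub>m (X * X)) * ((Y + t \<cdot>\<^sub>m (X * X)) * (Y + t \<cdot>\<^sub>m (X * X)))) = 0"
  shows "mtrace e * mtrace e = mtrace e"
proof -
  note R = sq_ring[where n=n] mtrace_linear[where n=n]
  have XY: "mtrace (Y * X) = mtrace (X * Y)" using mtrace_comm c by blast
  have "mtrace (Y * Y) + t * (2 * mtrace (X * Y)) + t^2 * mtrace (X * X) = 0" for t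
    using q2[of t] c XY by (simp add: R algebra_simps power2_eq_square)
  from this[of 0] this[of 1] this[of "-1"] have xy: "mtrace (X * Y) = 0" by simp
  define S where "S = X * X"
  have S: "S \<in> carrier_mat n n" using c by (simp add: S_def)
  have s1: "mtrace (Y * (S * Y)) = mtrace (Y * (Y * S))" "mtrace (S * (Y * Y)) = mtrace (Y * (Y * S))"
    "mtrace (S * (Y * S)) = mtrace (Y * (S * S))" "mtrace (S * (S * Y)) = mtrace (Y * (S * S))"
    using mtrace_cyc3[of Y n S Y] mtrace_cyc3[of S n Y Y] mtrace_cyc3[of S n Y S] mtrace_cyc3[of Y n S S] 
      mtrace_cyc3[of S n S Y] c S by simp_all
  have "mtrace (Y * (Y * Y)) + t * (3 * mtrace (Y * (Y * S))) + t^2 * (3 * mtrace (Y * (S * S))) + 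
      t^3 * mtrace (S * (S * S)) + t^4 * 0 = 0" for t
    using q3[of t] c S unfolding S_def[symmetric]
    by (simp add: R s1 algebra_simps power2_eq_square power3_eq_cube)
  \<comment> \<open>This is the purpose of the pencil with \<open>X * X\<close>: the fourth power of
    the linear pencil controls only the combination \<open>4 tr(YYXX) + 2 tr(XYXY)\<close>, and the
    cube separates the two traces.\<close>
  from quartic_zero[OF this] have "mtrace (Y * (Y * S)) = 0" by simp
  then have yyxx: "mtrace (Y * (Y * (X * X))) = 0" unfolding S_def .
  have s2: "mtrace (Y * (Y * (X * Y))) = mtrace (Y * (Y * (Y * X)))" 
    "mtrace (Y * (X * (Y * Y))) = mtrace (Y * (Y * (Y * X)))"
    "mtrace (X * (Y * (Y * Y))) = mtrace (Y * (Y * (Y * X)))"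
    "mtrace (Y * (X * (X * Y))) = mtrace (Y * (Y * (X * X)))"
    "mtrace (X * (Y * (Y * X))) = mtrace (Y * (Y * (X * X)))"
    "mtrace (X * (X * (Y * Y))) = mtrace (Y * (Y * (X * X)))"
    "mtrace (Y * (X * (Y * X))) = mtrace (X * (Y * (X * Y)))"
    "mtrace (X * (Y * (X * X))) = mtrace (Y * (X * (X * X)))"
    "mtrace (X * (X * (Y * X))) = mtrace (Y * (X * (X * X)))"
    "mtrace (X * (X * (X * Y))) = mtrace (Y * (X * (X * X)))"
    using mtrace_cyc4[of X n Y Y Y] mtrace_cyc4[of Y n X Y Y] mtrace_cyc4[of Y n Y X Y] mtrace_cyc4[of Y n Y Y X] 
      mtrace_cyc4[of Y n Y X X] mtrace_cyc4[of Y n X X Y] mtrace_cyc4[of X n X Y Y] mtrace_cyc4[of X n Y Y X]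
      mtrace_cyc4[of X n Y X Y]
      mtrace_cyc4[of Y n X X X] mtrace_cyc4[of X n Y X X] mtrace_cyc4[of X n X Y X] mtrace_cyc4[of X n X X Y] c
    by simp_all
  have "mtrace (Y * (Y * (Y * Y))) + t * (4 * mtrace (Y * (Y * (Y * X)))) + 
      t^2 * (4 * mtrace (Y * (Y * (X * X))) + 2 * mtrace (X * (Y * (X * Y)))) +
      t^3 * (4 * mtrace (Y * (X * (X * X)))) + t^4 * mtrace (X * (X * (X * X))) = 0" for t
    using q4[of t] c 
    by (simp add: R s2 algebra_simps power2_eq_square power3_eq_cube power4_eq_xxxx)
  from quartic_zero[OF this] have xyxy: "mtrace (X * (Y * (X * Y))) = 0" by (simp add: yyxx)
  have Pc: "P \<in> carrier_mat n n" using c by (simp add: P)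
  have YX: "Y * X = X * Y - P + e" unfolding P using c by (intro eq_matI) (auto simp del: index_mult_mat(1))
  have trP: "mtrace P = mtrace e" using c XY by (simp add: P R)
  \<comment> \<open>Replacing a factor \<open>Y * X\<close> by \<open>X * Y - P + e\<close>, here in
    the trace of \<open>XYXY\<close> and below in that of \<open>YXXY\<close>, leaves only the term
    with \<open>P\<close>, all other traces being zero.\<close>
  have "mtrace (X * (Y * X) * Y) = mtrace (X * (X * Y - P + e) * Y)" unfolding YX ..
  then have "mtrace (X * (P * Y)) = 0"
    using c Pc xyxy yyxx s2(6) xy e by (simp add: R)
  moreover have "mtrace (X * (P * Y)) = mtrace (P * (Y * X))" using mtrace_cyc3[of X n P Y] c Pc by simp
  ultimately have PYX: "mtrace (P * (Y * X)) = 0" by simp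
  have "mtrace (X * (X * (Y * Y))) = mtrace (Y * X * (X * Y))" using s2(4,6) c by (simp add: R)
  also have "\<dots> = mtrace ((X * Y - P + e) * (X * Y))" unfolding YX ..
  also have "\<dots> = - mtrace (P * (X * Y))"
    using c Pc xyxy xy e by (simp add: R) (metis e(1) sq_assoc c xy add.right_neutral)
  finally have PXY: "mtrace (P * (X * Y)) = 0" using s2(6) yyxx by simp
  \<comment> \<open>Expanding one factor \<open>P\<close> shows that the trace of
    \<open>P * P\<close> is that of \<open>P\<close>; by \<open>r\<close> it is also the square of
    that trace, which equals \<open>mtrace e\<close>.\<close>
  have "mtrace (P * P) = mtrace (P * (X * Y - Y * X + e))" unfolding P ..
  also have "\<dots> = mtrace (P * e)" using c Pc PXY PYX by (simp add: R)
  also have "P * e = P" unfolding P using c e by (simp add: R)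
  finally show ?thesis using r trP Pc by (simp add: R)
qed

section \<open>Rank-one perturbed commutators\<close>

text \<open>For \<open>P = v w^T\<close> the middle factor \<open>w^T A v\<close> is a scalar,
  namely the trace of \<open>P * A\<close>.\<close>

lemma rank_one_sandwich:
  assumes P: "P \<in> carrier_mat n n" "rank_one n P" and A: "A \<in> carrier_mat n n"
  shows "P * A * P = mtrace (P * A) \<cdot>\<^sub>m P"
proof -
  obtain v w where vw: "\<And>i j. i < n \<Longrightarrow> j < n \<Longrightarrow> P $$ (i, j) = v i * w j"
    using P(2) unfolding rank_one_def by auto
  have PA: "(P * A) $$ (i, l) = v i * (\<Sum>k\<in>{0..<n}. w k * A $$ (k, l))" if "i < n" "l < n" for i l
    using that P A vw by (simp add: scalar_prod_def sum_distrib_left mult.assoc)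
  have PAc: "P * A \<in> carrier_mat n n" using P A by simp
  have tr: "mtrace (P * A) = (\<Sum>l\<in>{0..<n}. (\<Sum>k\<in>{0..<n}. w k * A $$ (k, l)) * v l)"
    using P(1) PA by (simp add: mtrace_def lessThan_atLeast0 mult.commute del: index_mult_mat(1))
  show ?thesis
  proof (rule eq_matI)
    fix i j assume "i < dim_row (mtrace (P * A) \<cdot>\<^sub>m P)" "j < dim_col (mtrace (P * A) \<cdot>\<^sub>m P)"
    then have ij: "i < n" "j < n" using P by auto
    have "(P * A * P) $$ (i, j) = (\<Sum>l\<in>{0..<n}. (P * A) $$ (i, l) * P $$ (l, j))"
    proof -
      have "(Q * P) $$ (i, j) = (\<Sum>l\<in>{0..<n}. Q $$ (i, l) * P $$ (l, j))" if "Q \<in> carrier_mat n n" for Q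
        using that ij P by (simp add: scalar_prod_def)
      then show ?thesis using PAc by blast
    qed
    also have "\<dots> = (\<Sum>l\<in>{0..<n}. (\<Sum>k\<in>{0..<n}. w k * A $$ (k, l)) * v l * (v i * w j))"
      by (rule sum.cong) (use ij PA vw in \<open>auto simp: mult_ac\<close>)
    also have "\<dots> = mtrace (P * A) * P $$ (i, j)"
      unfolding tr using ij vw by (simp add: sum_distrib_right)
    finally show "(P * A * P) $$ (i, j) = (mtrace (P * A) \<cdot>\<^sub>m P) $$ (i, j)" using ij P by simp
  qed (use P A in auto)
qed

lemma mtrace_mat_poly_nilpotent:
  assumes N: "N \<in> carrier_mat n n" and z: "\<And>z. eigenvalue N z \<Longrightarrow> z = 0" and p: "poly p 0 = 0"
  shows "mtrace (mat_poly p N) = 0"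
proof -
  obtain as where as: "char_poly N = (\<Prod>a\<leftarrow>as. [:- a, 1:])" using char_poly_factorized[OF N] by blast
  have "a = 0" if "a \<in> set as" for a
  proof -
    have "poly (char_poly N) a = 0" unfolding as poly_prod_list using that by (auto simp: prod_list_zero_iff image_iff)
    then show ?thesis using z eigenvalue_root_char_poly[OF N] by blast
  qed
  then have "map (poly p) as = map (\<lambda>a. 0) as" using p by (intro map_cong) auto
  then have "(\<Sum>a\<leftarrow>as. poly p a) = (\<Sum>a\<leftarrow>as. 0)" by (rule arg_cong)
  then show ?thesis unfolding mtrace_mat_poly[OF N as] by simp
qed

text \<open>Eigenvalues of the compression of \<open>B\<close> to the image of \<open>e\<close>,
  with no basis chosen there. Eigenvalues of \<open>e * B * e\<close> on the whole space would
  include a spurious 0 from the kernel of \<open>e\<close>.\<close>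

definition corner_eigenvalue :: "nat \<Rightarrow> cmat \<Rightarrow> cmat \<Rightarrow> complex \<Rightarrow> bool" where
  "corner_eigenvalue n e B z \<longleftrightarrow>
    (\<exists>u\<in>carrier_vec n. u \<noteq> 0\<^sub>v n \<and> e *\<^sub>v u = u \<and> e *\<^sub>v (B *\<^sub>v u) = z \<cdot>\<^sub>v u)"

text \<open>If every compression had at most one eigenvalue, subtracting its mean would leave
  nilpotent matrices. Taking for \<open>q\<close> the multiples of \<open>x - x0\<close> and of its
  square produces the two pencils of \<open>corner_size_if_nilpotent_pencil\<close>, so the trace of
  \<open>e\<close> would be 0 or 1.\<close>

lemma two_corner_eigenvalues:
  assumes a: "a \<in> pairs n" and r: "rank_one n (comm_mat n a)"
    and e: "e = mat_poly E (fst a)" "e * e = e" and m: "mtrace e \<noteq> 0" "mtrace e \<noteq> 1"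
  shows "\<exists>q z1 z2. z1 \<noteq> z2 \<and> corner_eigenvalue n e (snd a + mat_poly q (fst a)) z1 \<and>
    corner_eigenvalue n e (snd a + mat_poly q (fst a)) z2"
proof (rule ccontr)
  assume contra: "\<not> ?thesis"
  define X where "X = fst a"
  define Y where "Y = snd a"
  have X: "X \<in> carrier_mat n n" and Y: "Y \<in> carrier_mat n n" using pairsD[OF a] by (auto simp: X_def Y_def)
  have e1: "e = mat_poly E X" using e by (simp add: X_def)
  have ec: "e \<in> carrier_mat n n" using X by (simp add: e1)
  have eX: "e * mat_poly p X = mat_poly p X * e" for p unfolding e1 by (rule mat_poly_comm2[OF X])
  have ee: "e * e = e" by (rule e)
  have ee': "e * (e * A) = e * A" if "A \<in> carrier_mat n n" for A
    using sq_assoc[OF ec ec that] ee by simp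
  note R = sq_ring[where n=n] mtrace_linear[where n=n]
  define m where "m = mtrace e"
  have m0: "m \<noteq> 0" "m \<noteq> 1" using m by (auto simp: m_def)
  have nil: "eigenvalue (e * (Y + mat_poly q X) * e - (mtrace (e * (Y + mat_poly q X) * e) / m) \<cdot>\<^sub>m e) z \<Longrightarrow> z = 0" for q z
  proof -
    define B where "B = Y + mat_poly q X"
    have B: "B \<in> carrier_mat n n" using X Y by (simp add: B_def)
    have "\<exists>z0. \<forall>z. corner_eigenvalue n e B z \<longrightarrow> z = z0"
      using contra unfolding B_def X_def Y_def by metis
    then obtain z0 where z0: "\<And>z. corner_eigenvalue n e B z \<Longrightarrow> z = z0" by blast
    \<comment> \<open>An eigenvector of \<open>N\<close> with nonzero eigenvalue lies in the image
      of \<open>e\<close> and would give a second corner eigenvalue. So \<open>N\<close> has only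
      the eigenvalue 0, and its trace identifies \<open>z0\<close>.\<close>
    define N where "N = e * B * e - z0 \<cdot>\<^sub>m e"
    have N: "N \<in> carrier_mat n n" using B ec by (auto simp: N_def)
    have eN: "e * N = N" using B ec ee' unfolding N_def by (simp add: R ee)
    have N0: "\<zeta> = 0" if "eigenvalue N \<zeta>" for \<zeta>
    proof (rule ccontr)
      assume \<zeta>: "\<zeta> \<noteq> 0"
      have "\<exists>u. u \<in> carrier_vec n \<and> u \<noteq> 0\<^sub>v n \<and> N *\<^sub>v u = \<zeta> \<cdot>\<^sub>v u"
        using that unfolding eigenvalue_def eigenvector_def carrier_matD(1)[OF N] .
      then obtain u where u: "u \<in> carrier_vec n" "u \<noteq> 0\<^sub>v n" "N *\<^sub>v u = \<zeta> \<cdot>\<^sub>v u" by blast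
      have "e *\<^sub>v (N *\<^sub>v u) = N *\<^sub>v u" using eN sq_vec(1)[OF ec N u(1)] by simp
      then have "\<zeta> \<cdot>\<^sub>v (e *\<^sub>v u) = \<zeta> \<cdot>\<^sub>v u" using u sq_vec(4)[OF ec ec u(1)] by simp
      then have "(1 / \<zeta>) \<cdot>\<^sub>v (\<zeta> \<cdot>\<^sub>v (e *\<^sub>v u)) = (1 / \<zeta>) \<cdot>\<^sub>v (\<zeta> \<cdot>\<^sub>v u)" by simp
      then have eu: "e *\<^sub>v u = u" using \<zeta> by (simp add: smult_smult_assoc)
      have "N *\<^sub>v u = e *\<^sub>v (B *\<^sub>v u) - z0 \<cdot>\<^sub>v u"
        unfolding N_def using ec B u(1) by (simp add: sq_vec[where n=n] sq_ring[where n=n] eu)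
      then have "e *\<^sub>v (B *\<^sub>v u) - z0 \<cdot>\<^sub>v u = \<zeta> \<cdot>\<^sub>v u" using u by simp
      then have "e *\<^sub>v (B *\<^sub>v u) = (z0 + \<zeta>) \<cdot>\<^sub>v u" using u(1) ec B
        by (intro eq_vecI) (auto simp: vec_eq_iff algebra_simps dest!: fun_cong)
      then have "corner_eigenvalue n e B (z0 + \<zeta>)"
        unfolding corner_eigenvalue_def using u eu by blast
      then show False using z0[of "z0 + \<zeta>"] \<zeta> by simp
    qed
    have "mat_poly [:0, 1:] N = N" using mat_poly_X[OF N, of 0] N by (simp add: sq_ring[where n=n]) (intro eq_matI, auto)
    then have "mtrace N = 0" using mtrace_mat_poly_nilpotent[OF N N0, of "[:0, 1:]"] by simp
    then have "mtrace (e * B * e) = z0 * m" unfolding N_def m_def using B ec by (simp add: R)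
    then have "z0 = mtrace (e * B * e) / m" using m0 by simp
    then show "eigenvalue (e * (Y + mat_poly q X) * e - (mtrace (e * (Y + mat_poly q X) * e) / m) \<cdot>\<^sub>m e) z \<Longrightarrow> z = 0"
      using N0 unfolding N_def B_def by simp
  qed
  \<comment> \<open>Means of the compressed matrices, so that \<open>X1\<close> and
    \<open>Y1\<close> have trace zero and the scalar subtracted in \<open>nil\<close> is
    \<open>y0\<close> for all \<open>t\<close>.\<close>
  define x0 where "x0 = mtrace (e * X) / m"
  define y0 where "y0 = mtrace (e * Y * e) / m"
  define X1 where "X1 = mat_poly [:- x0, 1:] X * e"
  define Y1 where "Y1 = e * Y * e - y0 \<cdot>\<^sub>m e"
  have X0: "mat_poly [:- x0, 1:] X = X - x0 \<cdot>\<^sub>m 1\<^sub>m n"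
    unfolding mat_poly_X[OF X] using X by (intro eq_matI) auto
  have eXX: "e * X = X * e" using mat_poly_comm_self[OF X] by (simp add: e1)
  have eXX': "e * (X * A) = X * (e * A)" if "A \<in> carrier_mat n n" for A
    using sq_assoc[OF ec X that] sq_assoc[OF X ec that] eXX by simp
  have c1: "X1 \<in> carrier_mat n n" "Y1 \<in> carrier_mat n n" using X Y ec by (auto simp: X1_def Y1_def)
  have X1': "X1 = X * e - x0 \<cdot>\<^sub>m e" unfolding X1_def X0 using X ec by (simp add: R)
  have t1: "mtrace X1 = 0" using m0 X ec eXX by (simp add: X1' R x0_def m_def)
  have t2: "mtrace Y1 = 0" using m0 Y ec by (simp add: Y1_def R y0_def m_def)
  have ids: "e * X1 = X1" "X1 * e = X1" "e * Y1 = Y1" "Y1 * e = Y1"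
    using X Y ec ee ee' eXX' eXX unfolding X1' Y1_def by (simp_all add: R)
  have N1: "e * (Y + mat_poly (Polynomial.smult t [:- x0, 1:]) X) * e = Y1 + t \<cdot>\<^sub>m X1 + y0 \<cdot>\<^sub>m e" for t
  proof -
    have "mat_poly (Polynomial.smult t [:- x0, 1:]) X = t \<cdot>\<^sub>m mat_poly [:- x0, 1:] X" by (rule mat_poly_smult[OF X])
    moreover have "e * (mat_poly [:- x0, 1:] X * e) = X1" using ids(1) by (simp add: X1_def)
    ultimately have "e * (Y + mat_poly (Polynomial.smult t [:- x0, 1:]) X) * e = e * Y * e + t \<cdot>\<^sub>m X1"
      using X Y ec by (simp add: R)
    then show ?thesis using Y ec c1 unfolding Y1_def by (intro eq_matI) (auto simp del: index_mult_mat(1))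
  qed
  have nil1: "eigenvalue (Y1 + t \<cdot>\<^sub>m X1) z \<Longrightarrow> z = 0" for t z
  proof -
    have "mtrace (Y1 + t \<cdot>\<^sub>m X1 + y0 \<cdot>\<^sub>m e) / m = y0" using c1 ec t1 t2 m0 by (simp add: R m_def)
    then have "e * (Y + mat_poly (Polynomial.smult t [:- x0, 1:]) X) * e - 
        (mtrace (e * (Y + mat_poly (Polynomial.smult t [:- x0, 1:]) X) * e) / m) \<cdot>\<^sub>m e = Y1 + t \<cdot>\<^sub>m X1"
      unfolding N1 using c1 ec by (intro eq_matI) auto
    then show "eigenvalue (Y1 + t \<cdot>\<^sub>m X1) z \<Longrightarrow> z = 0" using nil[of "Polynomial.smult t [:- x0, 1:]" z] by simp
  qed
  have Z: "Y1 + t \<cdot>\<^sub>m X1 \<in> carrier_mat n n" for t using c1 by simp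
  have pw: "mat_poly ([:0, 1:] * p) N = N * mat_poly p N" if "N \<in> carrier_mat n n" for N p
    unfolding mat_poly_mult[OF that] mat_poly_X[OF that] using that by (intro arg_cong2[of _ _ _ _ "(*)"] refl eq_matI) auto
  have p1: "mat_poly [:0, 1:] N = N" if "N \<in> carrier_mat n n" for N
    unfolding mat_poly_X[OF that] using that by (intro eq_matI) auto
  have q2: "mtrace ((Y1 + t \<cdot>\<^sub>m X1) * (Y1 + t \<cdot>\<^sub>m X1)) = 0" for t
  proof -
    have "mtrace (mat_poly ([:0, 1:] * [:0, 1:]) (Y1 + t \<cdot>\<^sub>m X1)) = 0"
      by (rule mtrace_mat_poly_nilpotent[OF Z nil1]) auto
    then show ?thesis unfolding pw[OF Z] p1[OF Z] .
  qed
  have q4: "mtrace ((Y1 + t \<cdot>\<^sub>m X1) * ((Y1 + t \<cdot>\<^sub>m X1) * ((Y1 + t \<cdot>\<^sub>m X1) * (Y1 + t \<cdot>\<^sub>m X1)))) = 0" for t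
  proof -
    have "mtrace (mat_poly ([:0, 1:] * ([:0, 1:] * ([:0, 1:] * [:0, 1:]))) (Y1 + t \<cdot>\<^sub>m X1)) = 0"
      by (rule mtrace_mat_poly_nilpotent[OF Z nil1]) auto
    then show ?thesis unfolding pw[OF Z] p1[OF Z] .
  qed
  \<comment> \<open>Ensures that adding multiples of \<open>X1 * X1\<close> does not change the
    mean, so the second pencil is centred by the same \<open>y0\<close>.\<close>
  have xx: "mtrace (X1 * X1) = 0"
  proof -
    have "mtrace (Y1 * Y1) + t * (mtrace (Y1 * X1) + mtrace (X1 * Y1)) + t^2 * mtrace (X1 * X1) + t^3 * 0 + t^4 * 0 = 0" for t
      using q2[of t] c1 by (simp add: R algebra_simps power2_eq_square)
    from quartic_zero[OF this] show ?thesis by simp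
  qed
  define S where "S = X1 * X1"
  have S: "S \<in> carrier_mat n n" using c1 by (simp add: S_def)
  have N2: "e * (Y + mat_poly (Polynomial.smult t ([:- x0, 1:] * [:- x0, 1:])) X) * e = Y1 + t \<cdot>\<^sub>m S + y0 \<cdot>\<^sub>m e" for t
  proof -
    let ?Q = "mat_poly [:- x0, 1:] X"
    have Q: "?Q \<in> carrier_mat n n" using X by simp
    have "mat_poly (Polynomial.smult t ([:- x0, 1:] * [:- x0, 1:])) X = t \<cdot>\<^sub>m (?Q * ?Q)" 
      by (simp only: mat_poly_smult[OF X] mat_poly_mult[OF X])
    moreover have "e * (?Q * ?Q) * e = S"
    proof -
      have "e * (?Q * ?Q) * e = (e * ?Q) * (?Q * e)" using Q ec by (simp add: R)
      also have "e * ?Q = X1" unfolding X1_def by (rule eX)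
      finally show ?thesis unfolding S_def X1_def .
    qed
    ultimately have "e * (Y + mat_poly (Polynomial.smult t ([:- x0, 1:] * [:- x0, 1:])) X) * e = e * Y * e + t \<cdot>\<^sub>m S"
      using X Y ec Q S by (simp add: R)
    then show ?thesis using Y ec c1 S unfolding Y1_def by (intro eq_matI) (auto simp del: index_mult_mat(1))
  qed
  have nil2: "eigenvalue (Y1 + t \<cdot>\<^sub>m S) z \<Longrightarrow> z = 0" for t z
  proof -
    let ?p = "Polynomial.smult t ([:- x0, 1:] * [:- x0, 1:])"
    have "mtrace (Y1 + t \<cdot>\<^sub>m S + y0 \<cdot>\<^sub>m e) / m = y0" using c1 S ec xx t2 m0 by (simp add: R m_def S_def)
    then have "e * (Y + mat_poly ?p X) * e - (mtrace (e * (Y + mat_poly ?p X) * e) / m) \<cdot>\<^sub>m e = Y1 + t \<cdot>\<^sub>m S"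
      unfolding N2 using c1 S ec by (intro eq_matI) auto
    then show "eigenvalue (Y1 + t \<cdot>\<^sub>m S) z \<Longrightarrow> z = 0" using nil[of ?p z] by simp
  qed
  have W: "Y1 + t \<cdot>\<^sub>m S \<in> carrier_mat n n" for t using c1 S by simp
  have q3: "mtrace ((Y1 + t \<cdot>\<^sub>m (X1 * X1)) * ((Y1 + t \<cdot>\<^sub>m (X1 * X1)) * (Y1 + t \<cdot>\<^sub>m (X1 * X1)))) = 0" for t
  proof -
    have "mtrace (mat_poly ([:0, 1:] * ([:0, 1:] * [:0, 1:])) (Y1 + t \<cdot>\<^sub>m S)) = 0"
      by (rule mtrace_mat_poly_nilpotent[OF W nil2]) auto
    then show ?thesis unfolding pw[OF W] p1[OF W] unfolding S_def .
  qed
  define P where "P = comm_mat n a"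
  have Pc: "P \<in> carrier_mat n n" using X Y by (simp add: P_def comm_mat_def X_def[symmetric] Y_def[symmetric])
  \<comment> \<open>As \<open>e\<close> commutes with \<open>X\<close>, compression turns the
    commutator into the commutator of the compressions and the identity into \<open>e\<close>;
    subtracting multiples of \<open>e\<close> changes nothing.\<close>
  have "e * P * e = X1 * Y1 - Y1 * X1 + e"
  proof -
    have "e * P * e = X * (e * (Y * e)) - e * (Y * (X * e)) + e" 
      unfolding P_def comm_mat_def X_def[symmetric] Y_def[symmetric]
      using X Y ec ee eXX eXX' ee' by (simp add: R)
    also have "\<dots> = X1 * Y1 - Y1 * X1 + e"
      unfolding X1' Y1_def using X Y ec ee ee' eXX eXX'
      by (simp add: R) (intro eq_matI, auto simp: algebra_simps simp del: index_mult_mat(1))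
    finally show ?thesis .
  qed
  then have P1: "X1 * Y1 - Y1 * X1 + e = e * P * e" ..
  have sandwich: "(e * P * e) * (e * P * e) = mtrace (e * P * e) \<cdot>\<^sub>m (e * P * e)"
  proof -
    have "(e * P * e) * (e * P * e) = e * (P * e * P) * e" using Pc ec ee' by (simp add: R)
    also have "P * e * P = mtrace (P * e) \<cdot>\<^sub>m P" using rank_one_sandwich[OF Pc _ ec] r by (simp add: P_def)
    also have "mtrace (P * e) = mtrace (e * P * e)" 
      using mtrace_comm[of "e * P" n e] mtrace_comm[of P n e] Pc ec ee' by (simp add: R)
    finally show ?thesis using Pc ec by (simp add: R)
  qed
  have "m * m = m" unfolding m_def
    by (rule corner_size_if_nilpotent_pencil[OF c1 ec ids ee P1[symmetric] sandwich q2 q4 q3])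
  then show False using m0 by simp
qed

text \<open>A quantitative substitute for the continuity of the roots of a polynomial.\<close>

lemma char_poly_far_root_bound:
  fixes A :: cmat
  assumes A: "A \<in> carrier_mat n n" and \<delta>: "\<delta> > 0" and far: "\<And>\<zeta>. eigenvalue A \<zeta> \<Longrightarrow> \<delta> \<le> norm (z - \<zeta>)"
  shows "norm (poly (char_poly A) k) \<le> (1 + norm (k - z) / \<delta>) ^ n * norm (poly (char_poly A) z)"
proof -
  obtain as where as: "char_poly A = (\<Prod>a\<leftarrow>as. [:- a, 1:])" "length as = n"
    using char_poly_factorized[OF A] by blast
  let ?C = "1 + norm (k - z) / \<delta>"
  have C: "?C \<ge> 0" using \<delta> by simp
  have far': "\<delta> \<le> norm (z - a)" if "a \<in> set as" for a
  proof (rule far)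
    have "poly (char_poly A) a = 0" unfolding as poly_prod_list using that by (auto simp: prod_list_zero_iff image_iff)
    then show "eigenvalue A a" using eigenvalue_root_char_poly[OF A] by blast
  qed
  have "norm (\<Prod>a\<leftarrow>as. k - a) \<le> ?C ^ length as * norm (\<Prod>a\<leftarrow>as. z - a)"
    using far'
  proof (induct as)
    case Nil
    then show ?case by simp
  next
    case (Cons a as)
    have a: "\<delta> \<le> norm (z - a)" using Cons by simp
    have "norm (k - a) \<le> norm (k - z) + norm (z - a)" by (metis diff_add_cancel add_diff_eq norm_triangle_ineq)
    also have "norm (k - z) \<le> norm (k - z) / \<delta> * norm (z - a)"
      using a \<delta> mult_left_mono[OF a, of "norm (k - z) / \<delta>"] by simp
    finally have "norm (k - a) \<le> ?C * norm (z - a)" by (simp add: algebra_simps)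
    then have "norm (k - a) * norm (\<Prod>a\<leftarrow>as. k - a) \<le> (?C * norm (z - a)) * (?C ^ length as * norm (\<Prod>a\<leftarrow>as. z - a))"
      using Cons C by (intro mult_mono) auto
    then show ?case by (simp add: norm_mult mult_ac)
  qed
  then show ?thesis unfolding as poly_prod_list using as(2) by (simp add: comp_def)
qed

text \<open>\<open>M\<close> may have a pole at 0, across which the rescaled characteristic
  polynomial \<open>g\<close> extends. Without an eigenvalue within \<open>\<delta>\<close> of
  \<open>z\<close>, the preceding bound keeps \<open>g k s\<close> below a fixed multiple of
  \<open>g z s\<close>, contradicting the limits. The point \<open>k\<close> only witnesses that the
  limit polynomial is not zero.\<close>

lemma eventually_near_eigenvalue:
  assumes M: "\<And>s. M s \<in> carrier_mat n n" and g: "\<And>z. polyfun1 (g z)"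
    and gM: "\<And>s z. s \<noteq> 0 \<Longrightarrow> g z s = c s * poly (char_poly (M s)) z"
    and z: "g z 0 = 0" and k: "g k 0 \<noteq> 0" and \<delta>: "\<delta> > 0"
  shows "\<forall>\<^sub>F s in at 0. \<exists>\<zeta>. eigenvalue (M s) \<zeta> \<and> norm (z - \<zeta>) < \<delta>"
proof -
  let ?C = "(1 + norm (k - z) / \<delta>) ^ n"
  have "((\<lambda>s. norm (g k s) - ?C * norm (g z s)) \<longlongrightarrow> norm (g k 0) - ?C * norm (g z 0)) (at 0)"
    using polyfun1_isCont[OF g, of 0 k] polyfun1_isCont[OF g, of 0 z] unfolding isCont_def
    by (intro tendsto_intros)
  then have "\<forall>\<^sub>F s in at 0. 0 < norm (g k s) - ?C * norm (g z s)"
    by (rule order_tendstoD(1)) (use z k in simp)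
  moreover have "\<forall>\<^sub>F s in at (0::complex). s \<noteq> 0" by (rule eventually_neq_at_within)
  ultimately show ?thesis
  proof eventually_elim
    case (elim s)
    show ?case
    proof (rule ccontr)
      assume "\<not> ?case"
      then have "norm (poly (char_poly (M s)) k) \<le> ?C * norm (poly (char_poly (M s)) z)"
        using char_poly_far_root_bound[OF M \<delta>] by (metis not_le)
      then have "norm (c s) * norm (poly (char_poly (M s)) k) \<le> norm (c s) * (?C * norm (poly (char_poly (M s)) z))"
        by (rule mult_left_mono) simp
      then show False using elim gM[of s] by (simp add: norm_mult mult_ac)
    qed
  qed
qed

section \<open>Reaching simple spectrum\<close>

lemma finite_separation:
  fixes S :: "'a::metric_space set"
  assumes "finite S"
  shows "\<exists>\<delta>>0. \<forall>p\<in>S. \<forall>q\<in>S. p \<noteq> q \<longrightarrow> 2 * \<delta> \<le> dist p q"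
proof -
  let ?D = "insert 1 ((\<lambda>(p, q). dist p q) ` {(p, q) \<in> S \<times> S. p \<noteq> q})"
  have "finite {(p, q) \<in> S \<times> S. p \<noteq> q}" by (rule finite_subset[of _ "S \<times> S"]) (use assms in auto)
  then have fin: "finite ?D" by simp
  have "Min ?D > 0" using fin by (subst Min_gr_iff) auto
  moreover have "Min ?D \<le> dist p q" if "p \<in> S" "q \<in> S" "p \<noteq> q" for p q
    by (rule Min_le[OF fin]) (use that in auto)
  ultimately show ?thesis by (intro exI[of _ "Min ?D / 2"]) auto
qed

lemma poly_char_poly:
  assumes "(A :: cmat) \<in> carrier_mat n n"
  shows "poly (char_poly A) z = det (z \<cdot>\<^sub>m 1\<^sub>m n - A)"
proof -
  have "- (char_matrix A z) = z \<cdot>\<^sub>m 1\<^sub>m n - A" 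
    using assms by (intro eq_matI) (auto simp: char_matrix_def)
  then show ?thesis using char_poly_matrix[OF assms] by simp
qed

lemma finite_eigenvalues:
  assumes A: "(A :: cmat) \<in> carrier_mat n n"
  shows "finite {z. eigenvalue A z}"
  unfolding eigenvalue_root_char_poly[OF A] by (rule poly_roots_finite[OF char_poly_neq_0[OF A]])

lemma vec_minus_eq_zero:
  fixes x y :: "complex vec"
  assumes "x - y = 0\<^sub>v n" "x \<in> carrier_vec n" "y \<in> carrier_vec n"
  shows "x = y"
proof (rule eq_vecI)
  fix i assume "i < dim_vec y"
  then have i: "i < n" using assms by simp
  have "(x - y) $ i = 0" unfolding assms(1) using i by simp
  moreover have "(x - y) $ i = x $ i - y $ i" using i assms(3) by simp
  ultimately show "x $ i = y $ i" by simp
qed (use assms in auto)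

lemma zero_mat_vec: "u \<in> carrier_vec n \<Longrightarrow> 0\<^sub>m n n *\<^sub>v u = (0\<^sub>v n :: complex vec)"
  by (intro eq_vecI) auto

lemma eigenvalue_set:
  assumes A: "(A :: cmat) \<in> carrier_mat n n" and as: "char_poly A = (\<Prod>a\<leftarrow>as. [:- a, 1:])"
  shows "{z. eigenvalue A z} = set as"
  unfolding eigenvalue_root_char_poly[OF A] as poly_prod_list
  by (auto simp: prod_list_zero_iff image_iff)

lemma eigenvalueE:
  assumes A: "A \<in> carrier_mat n n" and "eigenvalue A z"
  obtains u where "u \<in> carrier_vec n" "u \<noteq> 0\<^sub>v n" "A *\<^sub>v u = z \<cdot>\<^sub>v u"
proof -
  have "\<exists>u. u \<in> carrier_vec n \<and> u \<noteq> 0\<^sub>v n \<and> A *\<^sub>v u = z \<cdot>\<^sub>v u"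
    using assms(2) unfolding eigenvalue_def eigenvector_def carrier_matD(1)[OF A] .
  then show thesis using that by blast
qed

lemma eigenvalueI:
  assumes A: "A \<in> carrier_mat n n" and "u \<in> carrier_vec n" "u \<noteq> 0\<^sub>v n" "A *\<^sub>v u = z \<cdot>\<^sub>v u"
  shows "eigenvalue A z"
  unfolding eigenvalue_def eigenvector_def carrier_matD(1)[OF A] using assms(2-) by blast

lemma prod_list_filter_split:
  fixes f :: "'b \<Rightarrow> 'a::comm_monoid_mult"
  shows "(\<Prod>a\<leftarrow>as. f a) = f l ^ length (filter (\<lambda>a. a = l) as) * (\<Prod>a\<leftarrow>filter (\<lambda>a. a \<noteq> l) as. f a)"
  by (induct as) (auto simp: mult_ac)

text \<open>Some eigenvalue \<open>l\<close> has multiplicity \<open>k\<close> at least 2. With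
  \<open>w\<close> the part of the characteristic polynomial prime to \<open>x - l\<close> and
  \<open>s\<close> its inverse modulo \<open>(x - l)^k\<close>, the matrix \<open>E(X)\<close> for
  \<open>E = s * w\<close> projects onto the generalized eigenspace and has trace
  \<open>k\<close>.\<close>

lemma spectral_idempotent:
  assumes X: "X \<in> carrier_mat n n" and card: "card {z. eigenvalue X z} < n"
  obtains l E where "eigenvalue X l" "poly E l = 1" "\<And>a. eigenvalue X a \<Longrightarrow> a \<noteq> l \<Longrightarrow> poly E a = 0"
    "mat_poly (E * (E - 1)) X = 0\<^sub>m n n" "mtrace (mat_poly E X) \<noteq> 0" "mtrace (mat_poly E X) \<noteq> 1"
proof -
  obtain as where as: "char_poly X = (\<Prod>a\<leftarrow>as. [:- a, 1:])" and len: "length as = n"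
    using char_poly_factorized[OF X] by blast
  note ev = eigenvalue_set[OF X as]
  have "\<not> distinct as" using card distinct_card[of as] len unfolding ev by auto
  then obtain i j where ij: "i < n" "j < n" "i \<noteq> j" "as ! i = as ! j" using len by (auto simp: distinct_conv_nth)
  define l where "l = as ! i"
  define k where "k = length (filter (\<lambda>a. a = l) as)"
  define w where "w = (\<Prod>a\<leftarrow>filter (\<lambda>a. a \<noteq> l) as. [:- a, 1:])"
  have chi: "char_poly X = [:- l, 1:] ^ k * w" unfolding as k_def w_def by (rule prod_list_filter_split)
  have k: "k \<ge> 2"
  proof -
    have "k = card {i. i < n \<and> as ! i = l}" unfolding k_def length_filter_conv_card len ..
    moreover have "card {i, j} \<le> card {i. i < n \<and> as ! i = l}"
      using ij by (intro card_mono) (auto simp: l_def)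
    ultimately show ?thesis using ij by simp
  qed
  have "poly w l \<noteq> 0" unfolding w_def poly_prod_list by (auto simp: prod_list_zero_iff image_iff)
  then obtain s where s: "[:- l, 1:] ^ k dvd s * w - 1" using inverse_mod_linear_power by blast
  define E where "E = s * w"
  have "[:- l, 1:] dvd [:- l, 1:] ^ k" using k by (intro dvd_power) auto
  then have "[:- l, 1:] dvd E - 1" using s dvd_trans unfolding E_def by blast
  then have El: "poly E l = 1" by (auto simp: poly_eq_0_iff_dvd[symmetric])
  have Ea: "poly E a = 0" if "a \<in> set as" "a \<noteq> l" for a
    using that unfolding E_def w_def poly_mult poly_prod_list by (auto simp: prod_list_zero_iff image_iff)
  have "char_poly X dvd E * (E - 1)"
  proof -
    have "char_poly X = w * [:- l, 1:] ^ k" unfolding chi by (rule mult.commute)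
    moreover have "w dvd E" unfolding E_def by simp
    ultimately show ?thesis using s unfolding E_def[symmetric] by (simp only: mult_dvd_mono)
  qed
  then obtain r where "E * (E - 1) = char_poly X * r" by (rule dvdE)
  then have "mat_poly (E * (E - 1)) X = mat_poly (char_poly X) X * mat_poly r X"
    by (simp only: mat_poly_mult[OF X])
  also have "\<dots> = 0\<^sub>m n n" unfolding cayley_hamilton[OF X] by (rule sq_one(4)) (use X in simp)
  finally have idem: "mat_poly (E * (E - 1)) X = 0\<^sub>m n n" .
  have "mtrace (mat_poly E X) = of_nat k"
  proof -
    have "poly E a = (if a = l then 1 else 0)" if "a \<in> set as" for a using El Ea[OF that] by simp
    then have "map (poly E) as = map (\<lambda>a. if a = l then 1 else 0) as" by (intro map_cong refl)
    then have "mtrace (mat_poly E X) = (\<Sum>a\<leftarrow>as. if a = l then 1 else 0)"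
      unfolding mtrace_mat_poly[OF X as] by (rule arg_cong)
    also have "(\<Sum>a\<leftarrow>as. if a = l then 1 else 0) = of_nat (length (filter (\<lambda>a. a = l) as))" for as
      by (induct as) auto
    finally show ?thesis unfolding k_def .
  qed
  moreover have "eigenvalue X l"
  proof -
    have "l \<in> set as" using ij len unfolding l_def by simp
    then have "l \<in> {z. eigenvalue X z}" unfolding ev .
    then show ?thesis by simp
  qed
  moreover have "of_nat k \<noteq> (0 :: complex)" "of_nat k \<noteq> (1 :: complex)" using k by auto
  moreover have "poly E a = 0" if "eigenvalue X a" "a \<noteq> l" for a
  proof (rule Ea)
    have "a \<in> {z. eigenvalue X z}" using that by simp
    then show "a \<in> set as" unfolding ev .
  qed (rule that)
  ultimately show thesis using that[of l E] El idem by simp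
qed

text \<open>The matrices \<open>Y + h/s\<close> are studied as \<open>s\<close> tends to 0, where
  \<open>h\<close> vanishes on the image of \<open>e\<close>. Two bounded eigenvalues approach the
  corner eigenvalues \<open>z1\<close> and \<open>z2\<close>; each other eigenvalue \<open>b\<close>
  of \<open>X\<close> yields one that approaches \<open>b - l\<close> after multiplication by
  \<open>s\<close>. This gives one more eigenvalue than \<open>X\<close> has.\<close>

lemma more_eigenvalues:
  assumes a: "a \<in> pairs n" and r: "rank_one n (comm_mat n a)" and card: "card {z. eigenvalue (fst a) z} < n"
  shows "\<exists>q. card {z. eigenvalue (fst a) z} < card {z. eigenvalue (snd a + mat_poly q (fst a)) z}"
proof -
  define X where "X = fst a"
  have X: "X \<in> carrier_mat n n" and Y0: "snd a \<in> carrier_mat n n" using pairsD[OF a] by (auto simp: X_def)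
  obtain l E where l: "eigenvalue X l" and El: "poly E l = 1" and Ea: "\<And>a. eigenvalue X a \<Longrightarrow> a \<noteq> l \<Longrightarrow> poly E a = 0"
    and idem: "mat_poly (E * (E - 1)) X = 0\<^sub>m n n" and tr: "mtrace (mat_poly E X) \<noteq> 0" "mtrace (mat_poly E X) \<noteq> 1"
    using spectral_idempotent[OF X] card unfolding X_def by metis
  note R = sq_ring[where n=n]
  note V = sq_vec[where n=n]
  define e where "e = mat_poly E X"
  define f where "f = mat_poly (1 - E) X"
  \<comment> \<open>The factor \<open>1 - E\<close> makes \<open>h\<close> zero on the whole
    generalized eigenspace of \<open>l\<close>; at any other eigenvalue \<open>b\<close>, where
    \<open>E\<close> is 0, \<open>H\<close> takes the value \<open>b - l\<close>.\<close>
  define H where "H = (1 - E) * [:- l, 1:]"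
  define h where "h = mat_poly H X"
  have c: "e \<in> carrier_mat n n" "f \<in> carrier_mat n n" "h \<in> carrier_mat n n" using X by (auto simp: e_def f_def h_def)
  have f: "f = 1\<^sub>m n - e" unfolding f_def e_def mat_poly_diff[OF X] mat_poly_1[OF X] ..
  have ee: "e * e = e"
  proof -
    have "e * (e - 1\<^sub>m n) = 0\<^sub>m n n" using idem by (simp add: mat_poly_mult[OF X] mat_poly_diff[OF X] mat_poly_1[OF X] e_def)
    then have z: "e * e - e = 0\<^sub>m n n" using c by (simp add: R)
    have ec: "e * e \<in> carrier_mat n n" using c by simp
    have "(e * e) $$ (i, j) = e $$ (i, j)" if "i < n" "j < n" for i j
      using arg_cong[OF z, of "\<lambda>M. M $$ (i, j)"] that c ec by (simp del: index_mult_mat(1))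
    then show ?thesis using c by (intro eq_matI) auto
  qed
  have eh: "e * h = 0\<^sub>m n n"
  proof -
    have "E * ((1 - E) * L) = (E * (E - 1)) * (- L)" for L by (simp add: algebra_simps)
    then have "E * H = (E * (E - 1)) * (- [:- l, 1:])" unfolding H_def .
    then show ?thesis unfolding e_def h_def mat_poly_mult[OF X, symmetric]
      using mat_poly_mult[OF X, of "E * (E - 1)" "- [:- l, 1:]"] idem X by (simp add: R)
  qed
  have he: "h * e = 0\<^sub>m n n" using eh mat_poly_comm2[OF X, of E H] by (simp add: e_def h_def)
  have fh: "f * h = h" unfolding f using c eh by (simp add: R)
  have hf: "h = (X - l \<cdot>\<^sub>m 1\<^sub>m n) * f"
  proof -
    have "mat_poly [:- l, 1:] X = X - l \<cdot>\<^sub>m 1\<^sub>m n" unfolding mat_poly_X[OF X] using X by (intro eq_matI) auto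
    moreover have "H = [:- l, 1:] * (1 - E)" unfolding H_def by (rule mult.commute)
    ultimately show ?thesis unfolding h_def f_def by (simp only: mat_poly_mult[OF X])
  qed
  obtain q z1 z2 where z12: "z1 \<noteq> z2" and ce: "corner_eigenvalue n e (snd a + mat_poly q X) z1"
    "corner_eigenvalue n e (snd a + mat_poly q X) z2"
    using two_corner_eigenvalues[OF a r _ ee] tr unfolding e_def X_def by blast
  define Y where "Y = snd a + mat_poly q X"
  have Y: "Y \<in> carrier_mat n n" using X Y0 by (simp add: Y_def)
  define D where "D = (\<lambda>z. z \<cdot>\<^sub>m 1\<^sub>m n - Y)"
  have D: "D z \<in> carrier_mat n n" for z using Y by (auto simp: D_def)
  \<comment> \<open>Multiplying \<open>z - M s\<close> by \<open>e + s f\<close> clears the pole,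
    since \<open>e * h = 0\<close> and \<open>f * h = h\<close>. At \<open>s = 0\<close> the
    determinant of \<open>e * D z - h\<close> remains.\<close>
  define g where "g = (\<lambda>z s. det (e * D z + s \<cdot>\<^sub>m (f * D z) + (0\<^sub>m n n - h)))"
  have g: "polyfun1 (g z)" for z unfolding g_def
    by (rule polymat_det[of n], intro polymat_add polymat_smult polymat_const polyfun1_id)
      (use c D in \<open>auto intro!: sq_mult\<close>)
  define M where "M = (\<lambda>s. Y + (1 / s) \<cdot>\<^sub>m h)"
  have M: "M s \<in> carrier_mat n n" for s using Y c by (simp add: M_def)
  have gM: "g z s = det (e + s \<cdot>\<^sub>m f) * poly (char_poly (M s)) z" if s: "s \<noteq> 0" for s z
  proof -
    have DM: "z \<cdot>\<^sub>m 1\<^sub>m n - M s = D z - (1 / s) \<cdot>\<^sub>m h" using Y c by (intro eq_matI) (auto simp: M_def D_def)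
    have "(e + s \<cdot>\<^sub>m f) * (D z - (1 / s) \<cdot>\<^sub>m h) = e * D z + s \<cdot>\<^sub>m (f * D z) - ((1 / s) \<cdot>\<^sub>m (e * h) + s \<cdot>\<^sub>m ((1 / s) \<cdot>\<^sub>m (f * h)))"
      using c D[of z] by (simp add: R) (intro eq_matI, auto simp: algebra_simps simp del: index_mult_mat(1))
    also have "\<dots> = e * D z + s \<cdot>\<^sub>m (f * D z) + (0\<^sub>m n n - h)"
      unfolding eh fh using c D[of z] s by (intro eq_matI) (auto simp del: index_mult_mat(1))
    finally have "g z s = det ((e + s \<cdot>\<^sub>m f) * (D z - (1 / s) \<cdot>\<^sub>m h))" unfolding g_def by simp
    also have "\<dots> = det (e + s \<cdot>\<^sub>m f) * det (D z - (1 / s) \<cdot>\<^sub>m h)"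
      using c D[of z] by (intro det_mult) auto
    finally show ?thesis unfolding poly_char_poly[OF M] DM .
  qed
  have g0: "g z 0 = det (e * D z - h)" for z
  proof -
    have "e * D z + 0 \<cdot>\<^sub>m (f * D z) + (0\<^sub>m n n - h) = e * D z - h"
      using c D[of z] by (intro eq_matI) (auto simp del: index_mult_mat(1))
    then show ?thesis by (simp add: g_def)
  qed
  have KC: "e * D z - h \<in> carrier_mat n n" for z using c D[of z] by auto
  have Du: "D z *\<^sub>v u = z \<cdot>\<^sub>v u - Y *\<^sub>v u" if "u \<in> carrier_vec n" for z u
    using that Y by (simp add: D_def V)
  have gz: "g z 0 = 0" if cz: "corner_eigenvalue n e Y z" for z
  proof -
    obtain u where u: "u \<in> carrier_vec n" "u \<noteq> 0\<^sub>v n" "e *\<^sub>v u = u" "e *\<^sub>v (Y *\<^sub>v u) = z \<cdot>\<^sub>v u"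
      using cz unfolding corner_eigenvalue_def by blast
    have "h *\<^sub>v u = (h * e) *\<^sub>v u" unfolding V(1)[OF c(3,1) u(1)] u(3) ..
    also have "\<dots> = 0\<^sub>v n" unfolding he by (rule zero_mat_vec[OF u(1)])
    finally have hu: "h *\<^sub>v u = 0\<^sub>v n" .
    have "(e * D z - h) *\<^sub>v u = e *\<^sub>v (z \<cdot>\<^sub>v u - Y *\<^sub>v u)"
    proof -
      have "e *\<^sub>v (z \<cdot>\<^sub>v u - Y *\<^sub>v u) \<in> carrier_vec n" using c Y u(1) by simp
      then have "e *\<^sub>v (z \<cdot>\<^sub>v u - Y *\<^sub>v u) - 0\<^sub>v n = e *\<^sub>v (z \<cdot>\<^sub>v u - Y *\<^sub>v u)"
        by (intro eq_vecI) auto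
      then show ?thesis using c D[of z] u(1) hu by (simp add: V Du)
    qed
    also have "\<dots> = z \<cdot>\<^sub>v (e *\<^sub>v u) - e *\<^sub>v (Y *\<^sub>v u)"
      using c Y u(1) by (simp add: mult_minus_distrib_mat_vec[of e n n] V(4)[OF c(1) c(1)])
    also have "\<dots> = 0\<^sub>v n" unfolding u(3,4) using u(1) by simp
    finally show ?thesis unfolding g0 using det_0_iff_vec_prod_zero_field[OF KC] u by blast
  qed
  have "finite {z. eigenvalue (e * Y * e) z}" by (rule finite_eigenvalues) (use c Y in auto)
  then obtain k where k: "\<not> eigenvalue (e * Y * e) k"
    using ex_new_if_finite[OF infinite_UNIV_char_0, of "{z. eigenvalue (e * Y * e) z}"] by blast
  \<comment> \<open>For a kernel vector \<open>u\<close> of \<open>e * D k - h\<close>, applying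
    \<open>f\<close> gives \<open>h u = 0\<close>. On the image of \<open>f\<close> the matrix
    \<open>X - l\<close> is injective, so \<open>f u = 0\<close> and \<open>u\<close> lies in the
    image of \<open>e\<close>; then \<open>k\<close> would be an eigenvalue of
    \<open>e * Y * e\<close>.\<close>
  have gk: "g k 0 \<noteq> 0"
  proof
    assume "g k 0 = 0"
    then obtain u where u: "u \<in> carrier_vec n" "u \<noteq> 0\<^sub>v n" and Ku: "(e * D k - h) *\<^sub>v u = 0\<^sub>v n"
      unfolding g0 using det_0_iff_vec_prod_zero_field[OF KC] by blast
    have "f * (e * D k - h) = 0\<^sub>m n n - h"
    proof -
      have "f * e = 0\<^sub>m n n" unfolding f using c ee by (simp add: R)
      then have "f * (e * D k) = 0\<^sub>m n n" using sq_assoc[OF c(2) c(1) D[of k]] sq_one(4)[OF D[of k]] by simp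
      then show ?thesis using c D[of k] fh by (simp add: R)
    qed
    then have "(0\<^sub>m n n - h) *\<^sub>v u = f *\<^sub>v ((e * D k - h) *\<^sub>v u)" using V(1)[OF c(2) KC[of k] u(1)] by simp
    then have "(0\<^sub>m n n - h) *\<^sub>v u = 0\<^sub>v n" unfolding Ku using c by (auto intro!: eq_vecI)
    moreover have "(0\<^sub>m n n - h) *\<^sub>v u = 0\<^sub>v n - h *\<^sub>v u"
      using V(3)[OF _ c(3) u(1), of "0\<^sub>m n n"] zero_mat_vec[OF u(1)] by simp
    ultimately have "0\<^sub>v n - h *\<^sub>v u = 0\<^sub>v n" by simp
    then have hu: "h *\<^sub>v u = 0\<^sub>v n" using vec_minus_eq_zero[of "0\<^sub>v n" "h *\<^sub>v u" n] c u(1) by simp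
    define v where "v = f *\<^sub>v u"
    have v: "v \<in> carrier_vec n" using c u by (simp add: v_def)
    have Xl: "X - l \<cdot>\<^sub>m 1\<^sub>m n \<in> carrier_mat n n" using X by auto
    have "(X - l \<cdot>\<^sub>m 1\<^sub>m n) *\<^sub>v v = 0\<^sub>v n" using hu unfolding hf v_def V(1)[OF Xl c(2) u(1)] .
    then have "X *\<^sub>v v - l \<cdot>\<^sub>v v = 0\<^sub>v n" using X v by (simp add: V)
    then have "X *\<^sub>v v = l \<cdot>\<^sub>v v" by (rule vec_minus_eq_zero) (use X v in simp_all)
    then have "e *\<^sub>v v = v" unfolding e_def using mat_poly_eigenvector[OF X v] El by simp
    moreover have "e *\<^sub>v v = 0\<^sub>v n"
    proof -
      have "e * f = 0\<^sub>m n n" unfolding f using c ee by (simp add: R)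
      then show ?thesis using V(1)[OF c(1,2) u(1)] zero_mat_vec[OF u(1)] unfolding v_def by simp
    qed
    ultimately have "v = 0\<^sub>v n" by simp
    moreover have "v = u - e *\<^sub>v u" unfolding v_def f using c u(1) by (simp add: V)
    ultimately have "u - e *\<^sub>v u = 0\<^sub>v n" by simp
    then have "u = e *\<^sub>v u" by (rule vec_minus_eq_zero) (use c u(1) in simp_all)
    then have eu: "e *\<^sub>v u = u" by (rule sym)
    have "(e * D k - h) *\<^sub>v u = k \<cdot>\<^sub>v (e *\<^sub>v u) - e *\<^sub>v (Y *\<^sub>v u)"
    proof -
      have "k \<cdot>\<^sub>v (e *\<^sub>v u) - e *\<^sub>v (Y *\<^sub>v u) \<in> carrier_vec n" using c Y u(1) by simp
      then have "k \<cdot>\<^sub>v (e *\<^sub>v u) - e *\<^sub>v (Y *\<^sub>v u) - 0\<^sub>v n = k \<cdot>\<^sub>v (e *\<^sub>v u) - e *\<^sub>v (Y *\<^sub>v u)"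
        by (intro eq_vecI) auto
      then show ?thesis
        using c D[of k] Y u(1) hu by (simp add: V Du mult_minus_distrib_mat_vec[of e n n] V(4)[OF c(1) c(1)])
    qed
    then have "k \<cdot>\<^sub>v u - e *\<^sub>v (Y *\<^sub>v u) = 0\<^sub>v n" using Ku eu by simp
    then have kY: "k \<cdot>\<^sub>v u = e *\<^sub>v (Y *\<^sub>v u)" by (rule vec_minus_eq_zero) (use c Y u(1) in simp_all)
    have "(e * Y * e) *\<^sub>v u = e *\<^sub>v (Y *\<^sub>v (e *\<^sub>v u))" using c Y u(1) by (simp add: R V)
    then have "(e * Y * e) *\<^sub>v u = k \<cdot>\<^sub>v u" unfolding eu kY .
    moreover have "e * Y * e \<in> carrier_mat n n" using c Y by simp
    ultimately show False using k eigenvalueI u by blast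
  qed
  \<comment> \<open>For nonzero \<open>s\<close> this is \<open>s\<close> times \<open>M s\<close>.
    It has no pole, so its eigenvalues near those of \<open>h\<close> are found with scaling factor
    1.\<close>
  define M2 where "M2 = (\<lambda>s. h + s \<cdot>\<^sub>m Y)"
  have M2: "M2 s \<in> carrier_mat n n" for s using Y c by (simp add: M2_def)
  define g2 where "g2 = (\<lambda>z s. det (z \<cdot>\<^sub>m 1\<^sub>m n + ((- 1) \<cdot>\<^sub>m h + (- s) \<cdot>\<^sub>m Y)))"
  have g2: "polyfun1 (g2 z)" for z unfolding g2_def
    by (rule polymat_det[of n], intro polymat_add polymat_smult polymat_const)
      (use c Y polyfun1_diff[OF polyfun1_const[of 0] polyfun1_id] in \<open>auto intro!: polyfun1_const\<close>)
  have g2M: "g2 z s = poly (char_poly (M2 s)) z" for s z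
    unfolding poly_char_poly[OF M2] g2_def using c Y 
    by (intro arg_cong[of _ _ det] eq_matI) (auto simp: M2_def)
  have M20: "M2 0 = h" using c Y by (intro eq_matI) (auto simp: M2_def)
  have "finite {z. eigenvalue h z}" by (rule finite_eigenvalues[OF c(3)])
  then obtain k2 where k2: "\<not> eigenvalue h k2"
    using ex_new_if_finite[OF infinite_UNIV_char_0, of "{z. eigenvalue h z}"] by blast
  have g2k: "g2 k2 0 \<noteq> 0" unfolding g2M M20 using k2 eigenvalue_root_char_poly[OF c(3)] by simp
  define \<Lambda> where "\<Lambda> = {z. eigenvalue X z}"
  have fin: "finite \<Lambda>" unfolding \<Lambda>_def by (rule finite_eigenvalues[OF X])
  have g2z: "g2 (b - l) 0 = 0" if b: "b \<in> \<Lambda> - {l}" for b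
  proof -
    have b': "eigenvalue X b" "b \<noteq> l" using b by (auto simp: \<Lambda>_def)
    obtain u where u: "u \<in> carrier_vec n" "u \<noteq> 0\<^sub>v n" "X *\<^sub>v u = b \<cdot>\<^sub>v u" using eigenvalueE[OF X b'(1)] .
    have "h *\<^sub>v u = poly H b \<cdot>\<^sub>v u" unfolding h_def by (rule mat_poly_eigenvector[OF X u(1,3)])
    also have "poly H b = b - l" using Ea[OF b'] by (simp add: H_def)
    finally have "eigenvalue h (b - l)" using eigenvalueI[OF c(3) u(1,2)] by simp
    then show ?thesis unfolding g2M M20 using eigenvalue_root_char_poly[OF c(3)] by simp
  qed
  \<comment> \<open>Discs of radius \<open>\<delta>\<close> about different target values do not
    meet, so approximating eigenvalues are distinct.\<close>
  obtain \<delta> where \<delta>: "\<delta> > 0" "\<And>p q. p \<in> \<Lambda> \<Longrightarrow> q \<in> \<Lambda> \<Longrightarrow> p \<noteq> q \<Longrightarrow> 2 * \<delta> \<le> dist p q" "2 * \<delta> \<le> dist z1 z2"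
  proof -
    obtain d where d: "d > 0" "\<forall>p\<in>\<Lambda>. \<forall>q\<in>\<Lambda>. p \<noteq> q \<longrightarrow> 2 * d \<le> dist p q" using finite_separation[OF fin] by blast
    show thesis
    proof (rule that[of "min d (dist z1 z2 / 2)"])
      show "2 * min d (dist z1 z2 / 2) \<le> dist p q" if "p \<in> \<Lambda>" "q \<in> \<Lambda>" "p \<noteq> q" for p q
      proof -
        have "2 * d \<le> dist p q" using d that by blast
        then show ?thesis by linarith
      qed
    qed (use d z12 in auto)
  qed
  \<comment> \<open>Bounds the eigenvalues near \<open>z1\<close> and \<open>z2\<close>. With
    \<open>norm s < \<delta> / B\<close> they become smaller than \<open>\<delta>\<close> after
    multiplication by \<open>s\<close>, hence differ from those whose multiples are near some
    nonzero \<open>b - l\<close>.\<close>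
  define B where "B = norm z1 + norm z2 + \<delta>"
  have B: "B > 0" using \<delta> by (simp add: B_def add_nonneg_pos)
  have "\<forall>\<^sub>F s in at 0. \<forall>b\<in>\<Lambda> - {l}. \<exists>\<zeta>. eigenvalue (M2 s) \<zeta> \<and> norm ((b - l) - \<zeta>) < \<delta>"
  proof (rule eventually_ball_finite)
    show "\<forall>b\<in>\<Lambda> - {l}. \<forall>\<^sub>F s in at 0. \<exists>\<zeta>. eigenvalue (M2 s) \<zeta> \<and> norm ((b - l) - \<zeta>) < \<delta>"
    proof
      fix b assume b: "b \<in> \<Lambda> - {l}"
      show "\<forall>\<^sub>F s in at 0. \<exists>\<zeta>. eigenvalue (M2 s) \<zeta> \<and> norm ((b - l) - \<zeta>) < \<delta>"
        by (rule eventually_near_eigenvalue[where c="\<lambda>_. 1" and g=g2 and k=k2, OF M2 g2 _ g2z[OF b] g2k \<delta>(1)])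
          (simp add: g2M)
    qed
  qed (use fin in simp)
  moreover have "\<forall>\<^sub>F s in at 0. \<exists>\<zeta>. eigenvalue (M s) \<zeta> \<and> norm (z1 - \<zeta>) < \<delta>"
    by (rule eventually_near_eigenvalue[OF M g gM _ gk \<delta>(1)]) (use gz ce in \<open>auto simp: Y_def\<close>)
  moreover have "\<forall>\<^sub>F s in at 0. \<exists>\<zeta>. eigenvalue (M s) \<zeta> \<and> norm (z2 - \<zeta>) < \<delta>"
    by (rule eventually_near_eigenvalue[OF M g gM _ gk \<delta>(1)]) (use gz ce in \<open>auto simp: Y_def\<close>)
  moreover have "\<forall>\<^sub>F s::complex in at 0. s \<noteq> 0" by (rule eventually_neq_at_within)
  moreover have "\<forall>\<^sub>F s::complex in at 0. norm s < \<delta> / B"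
  proof -
    have "((\<lambda>s::complex. norm s) \<longlongrightarrow> norm (0::complex)) (at 0)" by (intro tendsto_intros)
    then show ?thesis by (rule order_tendstoD(2)) (use \<delta> B in simp)
  qed
  ultimately have "\<forall>\<^sub>F s in at 0. (\<forall>b\<in>\<Lambda> - {l}. \<exists>\<zeta>. eigenvalue (M2 s) \<zeta> \<and> norm ((b - l) - \<zeta>) < \<delta>) \<and>
      (\<exists>\<zeta>. eigenvalue (M s) \<zeta> \<and> norm (z1 - \<zeta>) < \<delta>) \<and> (\<exists>\<zeta>. eigenvalue (M s) \<zeta> \<and> norm (z2 - \<zeta>) < \<delta>) \<and>
      s \<noteq> 0 \<and> norm s < \<delta> / B"
    by (intro eventually_conj)
  then obtain s where s: "\<forall>b\<in>\<Lambda> - {l}. \<exists>\<zeta>. eigenvalue (M2 s) \<zeta> \<and> norm ((b - l) - \<zeta>) < \<delta>"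
    "\<exists>\<zeta>. eigenvalue (M s) \<zeta> \<and> norm (z1 - \<zeta>) < \<delta>" "\<exists>\<zeta>. eigenvalue (M s) \<zeta> \<and> norm (z2 - \<zeta>) < \<delta>"
    "s \<noteq> 0" "norm s < \<delta> / B"
    using eventually_happens'[OF at_neq_bot] by blast
  obtain \<zeta>1 \<zeta>2 where \<zeta>12: "eigenvalue (M s) \<zeta>1" "norm (z1 - \<zeta>1) < \<delta>" "eigenvalue (M s) \<zeta>2" "norm (z2 - \<zeta>2) < \<delta>"
    using s by blast
  have "\<exists>\<zeta>. eigenvalue (M s) \<zeta> \<and> norm ((b - l) - s * \<zeta>) < \<delta>" if b: "b \<in> \<Lambda> - {l}" for b
  proof -
    obtain \<zeta> where \<zeta>: "eigenvalue (M2 s) \<zeta>" "norm ((b - l) - \<zeta>) < \<delta>" using s(1) b by blast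
    have MM: "M s = (1 / s) \<cdot>\<^sub>m M2 s" using s(4) c Y by (intro eq_matI) (auto simp: M_def M2_def field_simps)
    obtain u where u: "u \<in> carrier_vec n" "u \<noteq> 0\<^sub>v n" "M2 s *\<^sub>v u = \<zeta> \<cdot>\<^sub>v u" using eigenvalueE[OF M2 \<zeta>(1)] .
    have "M s *\<^sub>v u = (\<zeta> / s) \<cdot>\<^sub>v u" unfolding MM using V(5)[OF M2 M2 u(1)] u by (simp add: smult_smult_assoc)
    then have "eigenvalue (M s) (\<zeta> / s)" using eigenvalueI[OF M u(1,2)] by simp
    then show ?thesis using \<zeta>(2) s(4) by (intro exI[of _ "\<zeta> / s"]) simp
  qed
  then obtain \<phi> where \<phi>: "\<And>b. b \<in> \<Lambda> - {l} \<Longrightarrow> eigenvalue (M s) (\<phi> b)" "\<And>b. b \<in> \<Lambda> - {l} \<Longrightarrow> norm ((b - l) - s * \<phi> b) < \<delta>"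
    by metis
  have inj: "inj_on \<phi> (\<Lambda> - {l})"
  proof (rule inj_onI, rule ccontr)
    fix b b' assume bb: "b \<in> \<Lambda> - {l}" "b' \<in> \<Lambda> - {l}" "\<phi> b = \<phi> b'" "b \<noteq> b'"
    have "dist b b' = norm (((b - l) - s * \<phi> b) - ((b' - l) - s * \<phi> b'))" by (simp add: dist_norm bb(3))
    also have "\<dots> \<le> norm ((b - l) - s * \<phi> b) + norm ((b' - l) - s * \<phi> b')" by (rule norm_triangle_ineq4)
    also have "\<dots> < 2 * \<delta>" using \<phi>(2)[OF bb(1)] \<phi>(2)[OF bb(2)] by simp
    finally show False using \<delta>(2)[of b b'] bb by auto
  qed
  have small: "\<zeta> \<notin> \<phi> ` (\<Lambda> - {l})" if \<zeta>: "norm (z - \<zeta>) < \<delta>" "z = z1 \<or> z = z2" for z \<zeta>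
  proof
    assume "\<zeta> \<in> \<phi> ` (\<Lambda> - {l})"
    then obtain b where b: "b \<in> \<Lambda> - {l}" "\<zeta> = \<phi> b" by blast
    have "norm \<zeta> \<le> norm z + norm (z - \<zeta>)" by (metis norm_minus_commute norm_triangle_sub)
    also have "\<dots> \<le> B"
    proof -
      have "norm z \<le> norm z1 + norm z2" using \<zeta>(2) by auto
      then show ?thesis using \<zeta>(1) unfolding B_def by linarith
    qed
    finally have "norm (s * \<zeta>) \<le> norm s * B" by (simp add: norm_mult mult_left_mono)
    also have "\<dots> < \<delta>" using s(5) B by (simp add: field_simps)
    finally have "norm (s * \<zeta>) < \<delta>" .
    have "dist b l = norm (((b - l) - s * \<zeta>) + s * \<zeta>)" by (simp add: dist_norm)
    also have "\<dots> \<le> norm ((b - l) - s * \<zeta>) + norm (s * \<zeta>)" by (rule norm_triangle_ineq)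
    also have "\<dots> < 2 * \<delta>" using \<phi>(2)[OF b(1)] b(2) \<open>norm (s * \<zeta>) < \<delta>\<close> by simp
    finally show False using \<delta>(2)[of b l] b l by (auto simp: \<Lambda>_def)
  qed
  have ne: "\<zeta>1 \<noteq> \<zeta>2"
  proof
    assume "\<zeta>1 = \<zeta>2"
    then have "dist z1 z2 = norm ((z1 - \<zeta>1) - (z2 - \<zeta>2))" by (simp add: dist_norm)
    also have "\<dots> \<le> norm (z1 - \<zeta>1) + norm (z2 - \<zeta>2)" by (rule norm_triangle_ineq4)
    also have "\<dots> < 2 * \<delta>" using \<zeta>12 by simp
    finally show False using \<delta>(3) by simp
  qed
  have "insert \<zeta>1 (insert \<zeta>2 (\<phi> ` (\<Lambda> - {l}))) \<subseteq> {z. eigenvalue (M s) z}" using \<phi>(1) \<zeta>12 by auto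
  then have "card (insert \<zeta>1 (insert \<zeta>2 (\<phi> ` (\<Lambda> - {l})))) \<le> card {z. eigenvalue (M s) z}"
    by (rule card_mono[OF finite_eigenvalues[OF M]])
  moreover have "card (insert \<zeta>1 (insert \<zeta>2 (\<phi> ` (\<Lambda> - {l})))) = card \<Lambda> + 1"
  proof -
    have "card (\<phi> ` (\<Lambda> - {l})) = card \<Lambda> - 1" using card_image[OF inj] fin l by (simp add: \<Lambda>_def)
    moreover have "card \<Lambda> > 0" using fin l by (auto simp: card_gt_0_iff \<Lambda>_def)
    ultimately show ?thesis using small[OF \<zeta>12(2)] small[OF \<zeta>12(4)] ne fin by simp
  qed
  moreover have "M s = snd a + mat_poly (q + Polynomial.smult (1 / s) H) X"
    using X Y0 unfolding M_def Y_def h_def mat_poly_add[OF X] mat_poly_smult[OF X] 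
    by (intro eq_matI) auto
  ultimately show ?thesis unfolding \<Lambda>_def X_def by (intro exI[of _ "q + Polynomial.smult (1 / s) H"]) simp
qed

lemma rsquarefree_if_many_eigenvalues:
  assumes A: "(A :: cmat) \<in> carrier_mat n n" and "card {z. eigenvalue A z} \<ge> n"
  shows "rsquarefree (char_poly A)"
proof -
  obtain as where as: "char_poly A = (\<Prod>a\<leftarrow>as. [:- a, 1:])" and len: "length as = n"
    using char_poly_factorized[OF A] by blast
  have "card (set as) = length as" using assms(2) card_length[of as] len unfolding eigenvalue_set[OF A as] by simp
  then have "distinct as" by (rule card_distinct)
  then show ?thesis unfolding as
  proof (induct as)
    case Nil
    then show ?case by (simp add: rsquarefree_roots)
  next
    case (Cons a as)
    let ?p = "\<Prod>a\<leftarrow>as. [:- a, 1:]"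
    have pa: "poly ?p a \<noteq> 0" using Cons(2) unfolding poly_prod_list by (auto simp: prod_list_zero_iff image_iff)
    have p: "rsquarefree ?p" using Cons by simp
    show ?case unfolding rsquarefree_roots
    proof (intro allI notI)
      fix z assume "poly (\<Prod>a\<leftarrow>a # as. [:- a, 1:]) z = 0 \<and> poly (pderiv (\<Prod>a\<leftarrow>a # as. [:- a, 1:])) z = 0"
      moreover have "poly ([:- a, 1:] * p) z = (z - a) * poly p z"
        "poly (pderiv ([:- a, 1:] * p)) z = (z - a) * poly (pderiv p) z + poly p z" for p
      proof -
        show "poly ([:- a, 1:] * p) z = (z - a) * poly p z" unfolding poly_mult by simp
        show "poly (pderiv ([:- a, 1:] * p)) z = (z - a) * poly (pderiv p) z + poly p z"
          unfolding pderiv_mult poly_add poly_mult by (simp add: pderiv_pCons)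
      qed
      ultimately have z: "(z - a) * poly ?p z = 0" "(z - a) * poly (pderiv ?p) z + poly ?p z = 0"
        by (simp_all only: list.map prod_list.Cons)
      show False
      proof (cases "z = a")
        case True
        then show ?thesis using z pa by simp
      next
        case False
        then show ?thesis using z p unfolding rsquarefree_roots by auto
      qed
    qed
  qed
qed

text \<open>The quarter turn as a product of three elementary shears. It lets statements about the
  second matrix be transferred to the first.\<close>

lemma rotate_act:
  assumes "a \<in> pairs n"
  shows "act [(True, [:0, 1:]), (False, [:0, - 1:]), (True, [:0, 1:])] a = (snd a, 0\<^sub>m n n - fst a)"
proof -
  have *: "mat_poly [:0, c:] A = c \<cdot>\<^sub>m A" if "A \<in> carrier_mat n n" for A c
  proof -
    have "[:0, c:] = Polynomial.smult c [:0, 1:]" by simp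
    then show ?thesis using that unfolding \<open>[:0, c:] = Polynomial.smult c [:0, 1:]\<close> mat_poly_smult[OF that] mat_poly_X[OF that]
      by (intro eq_matI) auto
  qed
  obtain X Y where a: "a = (X, Y)" and X: "X \<in> carrier_mat n n" and Y: "Y \<in> carrier_mat n n"
    using assms by (auto simp: pairs_def)
  have 1: "shiftX [:0, 1:] a = (X + Y, Y)" using X Y unfolding a shiftX_def by (auto simp: * intro!: eq_matI)
  have 2: "shiftY [:0, - 1:] (X + Y, Y) = (X + Y, 0\<^sub>m n n - X)"
    using X Y unfolding shiftY_def by (auto simp: *[of "X + Y"] intro!: eq_matI)
  have 3: "shiftX [:0, 1:] (X + Y, 0\<^sub>m n n - X) = (Y, 0\<^sub>m n n - X)"
  proof -
    have "0\<^sub>m n n - X \<in> carrier_mat n n" using X by auto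
    then show ?thesis using X Y unfolding shiftX_def by (auto simp: * intro!: eq_matI)
  qed
  show ?thesis using 1 2 3 by (simp add: a)
qed

lemma reach_simple_spectrum:
  assumes a: "a \<in> pairs n" and r: "rank_one n (comm_mat n a)"
  shows "\<exists>w. rsquarefree (char_poly (fst (act w a)))"
proof -
  define N where "N = (\<lambda>w. card {z. eigenvalue (fst (act w a)) z})"
  have c: "fst (act w a) \<in> carrier_mat n n" for w using pairsD[OF act_pairs[OF a]] by blast
  have "N w \<le> n" for w
  proof -
    obtain as where as: "char_poly (fst (act w a)) = (\<Prod>a\<leftarrow>as. [:- a, 1:])" and len: "length as = n"
      using char_poly_factorized[OF c] by blast
    show ?thesis using card_length[of as] len unfolding N_def eigenvalue_set[OF c as] by simp
  qed
  then have "\<forall>w. True \<longrightarrow> N w < Suc n" by (simp add: le_imp_less_Suc)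
  from ex_has_greatest_nat[of "\<lambda>_. True", OF TrueI this] obtain w where w: "\<And>v. N v \<le> N w" by blast
  have "N w \<ge> n"
  proof (rule ccontr)
    assume "\<not> N w \<ge> n"
    then obtain q where q: "N w < card {z. eigenvalue (snd (act w a) + mat_poly q (fst (act w a))) z}"
      using more_eigenvalues[OF act_pairs[OF a], of w] r unfolding N_def comm_mat_act[OF a] by force
    define v where "v = [(True, [:0, 1:]), (False, [:0, - 1:]), (True, [:0, 1:])] @ (False, q) # w"
    have "act v a = (snd (act ((False, q) # w) a), 0\<^sub>m n n - fst (act ((False, q) # w) a))"
      unfolding v_def act_append by (rule rotate_act[OF act_pairs[OF a]])
    then have "fst (act v a) = snd (act w a) + mat_poly q (fst (act w a))" by (simp add: shiftY_def)
    then show False using q w[of v] by (simp add: N_def)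
  qed
  then show ?thesis using rsquarefree_if_many_eigenvalues[OF c] unfolding N_def by blast
qed

section \<open>Generic points\<close>

definition genX :: "nat \<Rightarrow> (nat \<Rightarrow> complex) \<Rightarrow> cmat" where
  "genX n x = mat n n (\<lambda>(i, j). if i = j then x i else 0)"

text \<open>The Lax matrix of the Calogero-Moser system with positions \<open>x\<close> and momenta
  \<open>y\<close>.\<close>

definition genY :: "nat \<Rightarrow> (nat \<Rightarrow> complex) \<Rightarrow> (nat \<Rightarrow> complex) \<Rightarrow> cmat" where
  "genY n x y = mat n n (\<lambda>(i, j). if i = j then y i else 1 / (x i - x j))"

lemma gen_carrier [simp]: "genX n x \<in> carrier_mat n n" "genY n x y \<in> carrier_mat n n"
  by (auto simp: genX_def genY_def)

lemma gen_dim [simp]: "dim_row (genX n x) = n" "dim_col (genX n x) = n"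
  "dim_row (genY n x y) = n" "dim_col (genY n x y) = n"
  by (auto simp: genX_def genY_def)

lemma genX_index [simp]: "i < n \<Longrightarrow> j < n \<Longrightarrow> genX n x $$ (i, j) = (if i = j then x i else 0)"
  by (simp add: genX_def)

lemma genY_index [simp]: "i < n \<Longrightarrow> j < n \<Longrightarrow> genY n x y $$ (i, j) = (if i = j then y i else 1 / (x i - x j))"
  by (simp add: genY_def)

lemma genX_mult_index:
  assumes "A \<in> carrier_mat n n" "i < n" "j < n"
  shows "(genX n x * A) $$ (i, j) = x i * A $$ (i, j)" "(A * genX n x) $$ (i, j) = A $$ (i, j) * x j"
proof -
  have "(genX n x * A) $$ (i, j) = (\<Sum>k\<in>{0..<n}. (if i = k then x i * A $$ (k, j) else 0))"
    using assms by (simp add: scalar_prod_def if_distrib[of "\<lambda>a. a * _"] cong: if_cong)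
  then show "(genX n x * A) $$ (i, j) = x i * A $$ (i, j)" using assms by simp
  have "(A * genX n x) $$ (i, j) = (\<Sum>k\<in>{0..<n}. (if k = j then A $$ (i, k) * x k else 0))"
    using assms by (simp add: scalar_prod_def if_distrib[of "\<lambda>a. _ * a"] cong: if_cong)
  then show "(A * genX n x) $$ (i, j) = A $$ (i, j) * x j" using assms by simp
qed

lemma mat_poly_genX: "mat_poly p (genX n x) = genX n (\<lambda>i. poly p (x i))"
proof (induct p rule: pCons_induct)
  case 0
  show ?case unfolding mat_poly_0[OF gen_carrier(1)] by (intro eq_matI) auto
next
  case (pCons a p)
  show ?case unfolding mat_poly_pCons[OF gen_carrier(1)] pCons(2)
    by (intro eq_matI) (auto simp: genX_mult_index[where n=n] simp del: index_mult_mat(1))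
qed

lemma invertible_if_det:
  assumes g: "g \<in> carrier_mat n n" and "det g \<noteq> (0 :: complex)"
  shows "\<exists>h. inverses n g h"
proof -
  have "g \<in> Units (ring_mat TYPE(complex) n ())" using det_non_zero_imp_unit[OF assms] .
  then obtain h where "h \<in> carrier_mat n n" "h * g = 1\<^sub>m n" "g * h = 1\<^sub>m n"
    by (auto simp: Units_def ring_mat_def)
  then show ?thesis using g unfolding inverses_def by blast
qed

lemma inverse_if_left_inverse:
  assumes "g \<in> carrier_mat n n" "h \<in> carrier_mat n n" "g * h = (1\<^sub>m n :: cmat)"
  shows "inverses n g h"
  using mat_mult_left_right_inverse[OF assms] assms by (auto simp: inverses_def)

lemma rank_one_conj:
  assumes P: "P \<in> carrier_mat n n" "rank_one n P" and gh: "g \<in> carrier_mat n n" "h \<in> carrier_mat n n"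
  shows "rank_one n (g * P * h)"
proof -
  obtain v w where vw: "\<And>i j. i < n \<Longrightarrow> j < n \<Longrightarrow> P $$ (i, j) = v i * w j"
    using P(2) unfolding rank_one_def by auto
  have gP: "(g * P) $$ (i, l) = (\<Sum>k\<in>{0..<n}. g $$ (i, k) * v k) * w l" if "i < n" "l < n" for i l
    using that P gh vw by (simp add: scalar_prod_def sum_distrib_right mult.assoc)
  have gPc: "g * P \<in> carrier_mat n n" using gh P by simp
  have "(g * P * h) $$ (i, j) = (\<Sum>k\<in>{0..<n}. g $$ (i, k) * v k) * (\<Sum>l\<in>{0..<n}. w l * h $$ (l, j))"
    if ij: "i < n" "j < n" for i j
  proof -
    have "(Q * h) $$ (i, j) = (\<Sum>l\<in>{0..<n}. Q $$ (i, l) * h $$ (l, j))" if "Q \<in> carrier_mat n n" for Q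
      using that ij gh by (simp add: scalar_prod_def)
    from this[OF gPc] show ?thesis using gP[OF ij(1)] by (simp add: sum_distrib_left mult.assoc del: index_mult_mat(1))
  qed
  then show ?thesis unfolding rank_one_def
    by (intro exI[of _ "\<lambda>i. \<Sum>k\<in>{0..<n}. g $$ (i, k) * v k"] exI[of _ "\<lambda>j. \<Sum>l\<in>{0..<n}. w l * h $$ (l, j)"]) simp
qed

lemma comm_mat_carrier: "a \<in> pairs n \<Longrightarrow> comm_mat n a \<in> carrier_mat n n"
  using pairsD[of a n] unfolding comm_mat_def by auto

lemma diagonalize:
  assumes X: "X \<in> carrier_mat n n" and sf: "rsquarefree (char_poly X)"
  obtains x g h where "inj_on x {..<n}" "inverses n g h" "h * X * g = genX n x"
proof -
  obtain as where as: "char_poly X = (\<Prod>a\<leftarrow>as. [:- a, 1:])" and len: "length as = n"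
    using char_poly_factorized[OF X] by blast
  have dist: "distinct as"
  proof (rule ccontr)
    assume "\<not> distinct as"
    then obtain xs y ys zs where s: "as = xs @ [y] @ ys @ [y] @ zs" using not_distinct_decomp by blast
    have "char_poly X = [:- y, 1:] * ([:- y, 1:] * ((\<Prod>a\<leftarrow>xs @ ys @ zs. [:- a, 1:])))"
      unfolding as s by (simp only: map_append prod_list.append list.map prod_list.Cons prod_list.Nil mult_1_right mult_1_left mult_ac)
    then obtain r where e: "char_poly X = [:- y, 1:] * ([:- y, 1:] * r)" by blast
    have "poly (char_poly X) y = 0 \<and> poly (pderiv (char_poly X)) y = 0"
      unfolding e pderiv_mult poly_add poly_mult by (simp add: pderiv_pCons)
    then show False using sf unfolding rsquarefree_roots by blast
  qed
  define x where "x = (\<lambda>i. as ! i)"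
  have inj: "inj_on x {..<n}" using dist len by (auto simp: inj_on_def x_def nth_eq_iff_index_eq)
  have "\<exists>u. u \<in> carrier_vec n \<and> u \<noteq> 0\<^sub>v n \<and> X *\<^sub>v u = x i \<cdot>\<^sub>v u" if "i < n" for i
  proof -
    have "x i \<in> {z. eigenvalue X z}" unfolding eigenvalue_set[OF X as] x_def using that len by simp
    then have ev: "eigenvalue X (x i)" by simp
    show ?thesis by (rule eigenvalueE[OF X ev]) blast
  qed
  then obtain u where u: "\<And>i. i < n \<Longrightarrow> u i \<in> carrier_vec n" "\<And>i. i < n \<Longrightarrow> u i \<noteq> 0\<^sub>v n"
    "\<And>i. i < n \<Longrightarrow> X *\<^sub>v u i = x i \<cdot>\<^sub>v u i" by metis
  define g where "g = mat n n (\<lambda>(i, j). u j $ i)"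
  have g: "g \<in> carrier_mat n n" by (simp add: g_def)
  have colg: "col g j = u j" if "j < n" for j using u(1)[OF that] that by (intro eq_vecI) (auto simp: g_def)
  have gX: "g * genX n x = X * g"
  proof (rule eq_matI)
    fix i j assume "i < dim_row (X * g)" "j < dim_col (X * g)"
    then have ij: "i < n" "j < n" using X g by auto
    have "(X * g) $$ (i, j) = (X *\<^sub>v u j) $ i" using ij X g colg by simp
    also have "\<dots> = x j * u j $ i" unfolding u(3)[OF ij(2)] using u(1)[OF ij(2)] ij by simp
    finally show "(g * genX n x) $$ (i, j) = (X * g) $$ (i, j)"
      using ij genX_mult_index(2)[OF g ij] by (simp add: g_def)
  qed (use X g in auto)
  have "det g \<noteq> 0"
  proof
    assume "det g = 0"
    then obtain c where c: "c \<in> carrier_vec n" "c \<noteq> 0\<^sub>v n" "g *\<^sub>v c = 0\<^sub>v n"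
      using det_0_iff_vec_prod_zero_field[OF g] by blast
    have "c $ k = 0" if k: "k < n" for k
    proof -
      \<comment> \<open>Lagrange numerator of the node \<open>x k\<close>: \<open>L(X)\<close>
        annihilates all chosen eigenvectors but the \<open>k\<close>th, so applying it to
        \<open>g c = 0\<close> isolates the coefficient \<open>c $ k\<close>.\<close>
      define L where "L = (\<Prod>j\<in>{..<n} - {k}. [:- x j, 1:])"
      have Lk: "poly L (x k) \<noteq> 0" using inj k by (auto simp: L_def poly_prod inj_on_def)
      have Lj: "poly L (x j) = 0" if "j < n" "j \<noteq> k" for j using that by (auto simp: L_def poly_prod)
      let ?D = "genX n (\<lambda>i. poly L (x i))"
      have Dc: "?D *\<^sub>v c = (poly L (x k) * c $ k) \<cdot>\<^sub>v unit_vec n k"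
      proof (rule eq_vecI)
        fix i assume "i < dim_vec ((poly L (x k) * c $ k) \<cdot>\<^sub>v unit_vec n k)"
        then have i: "i < n" by simp
        have "(?D *\<^sub>v c) $ i = (\<Sum>j\<in>{0..<n}. (if i = j then poly L (x i) * c $ j else 0))"
          using i c by (simp add: scalar_prod_def if_distrib[of "\<lambda>a. a * _"] cong: if_cong)
        also have "\<dots> = poly L (x i) * c $ i" using i by simp
        finally show "(?D *\<^sub>v c) $ i = ((poly L (x k) * c $ k) \<cdot>\<^sub>v unit_vec n k) $ i"
          using i k Lj by (cases "i = k") auto
      qed simp
      have "g * ?D = mat_poly L X * g"
        using mat_poly_intertwine[OF gen_carrier(1) X g gX, of L] by (simp add: mat_poly_genX)
      then have "g *\<^sub>v (?D *\<^sub>v c) = mat_poly L X *\<^sub>v (g *\<^sub>v c)"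
        using sq_vec(1)[OF g gen_carrier(1) c(1), of "\<lambda>i. poly L (x i)"]
          sq_vec(1)[OF mat_poly_carrier[OF X] g c(1), of L] by simp
      then have z: "g *\<^sub>v (?D *\<^sub>v c) = 0\<^sub>v n" unfolding c(3) using X by (intro eq_vecI) (auto simp: scalar_prod_def)
      have "g *\<^sub>v unit_vec n k = u k" using k u(1)[OF k] by (intro eq_vecI) (auto simp: g_def)
      then have "(poly L (x k) * c $ k) \<cdot>\<^sub>v u k = 0\<^sub>v n" using z unfolding Dc using sq_vec(4)[OF g g, of "unit_vec n k"] by simp
      then have "poly L (x k) * c $ k = 0"
      proof -
        assume z: "(poly L (x k) * c $ k) \<cdot>\<^sub>v u k = 0\<^sub>v n"
        have "\<exists>i<n. u k $ i \<noteq> 0"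
        proof (rule ccontr)
          assume "\<not> (\<exists>i<n. u k $ i \<noteq> 0)"
          then have "u k = 0\<^sub>v n" using u(1)[OF k] by (intro eq_vecI) auto
          then show False using u(2)[OF k] by simp
        qed
        then obtain i where i: "i < n" "u k $ i \<noteq> 0" by blast
        have "((poly L (x k) * c $ k) \<cdot>\<^sub>v u k) $ i = 0" unfolding z using i by simp
        then show ?thesis using i u(1)[OF k] by simp
      qed
      then show ?thesis using Lk by simp
    qed
    then have "c = 0\<^sub>v n" using c(1) by (intro eq_vecI) auto
    then show False using c(2) by simp
  qed
  then obtain h where h: "inverses n g h" using invertible_if_det[OF g] by blast
  have "h * X * g = h * (g * genX n x)" unfolding gX using h X g by (auto simp: inverses_def sq_ring[where n=n])
  also have "\<dots> = genX n x" using h sq_cancel[of h g n "genX n x"] by (auto simp: inverses_def)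
  finally show thesis using that inj h by blast
qed

text \<open>With \<open>X\<close> diagonal, the commutator has zero diagonal, so the factors of the
  rank-one matrix satisfy \<open>v i * w i = 1\<close>. Conjugation by a diagonal matrix makes all
  of them 1, and then \<open>(x i - x j) * Y_ij = 1\<close> off the diagonal.\<close>

lemma generic_form:
  assumes a: "a \<in> pairs n" and r: "rank_one n (comm_mat n a)" and sf: "rsquarefree (char_poly (fst a))"
  shows "\<exists>x y. inj_on x {..<n} \<and> (genX n x, genY n x y) \<in> conj_orbit n a"
proof -
  obtain x g h where x: "inj_on x {..<n}" and gh: "inverses n g h" and X: "h * fst a * g = genX n x"
    using diagonalize[of "fst a" n] pairsD[OF a] sf by metis
  define b where "b = conj_pair h g a"
  have hg: "inverses n h g" by (rule inverses_sym[OF gh])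
  have b: "b \<in> pairs n" unfolding b_def by (rule conj_pair_pairs[OF a hg])
  have ba: "b \<in> conj_orbit n a" unfolding conj_orbit_alt b_def using hg by blast
  have bX: "fst b = genX n x" using X by (simp add: b_def conj_pair_def)
  define Y where "Y = snd b"
  have Y: "Y \<in> carrier_mat n n" using pairsD[OF b] by (simp add: Y_def)
  have "rank_one n (comm_mat n b)" unfolding b_def comm_mat_conj_pair[OF a hg]
    by (rule rank_one_conj[OF comm_mat_carrier[OF a] r]) (use hg in \<open>auto simp: inverses_def\<close>)
  then obtain v w where vw: "\<And>i j. i < n \<Longrightarrow> j < n \<Longrightarrow> comm_mat n b $$ (i, j) = v i * w j"
    unfolding rank_one_def by auto
  have e: "x i * Y $$ (i, j) - Y $$ (i, j) * x j + (if i = j then 1 else 0) = v i * w j" if ij: "i < n" "j < n" for i j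
  proof -
    have "comm_mat n b $$ (i, j) = (genX n x * Y) $$ (i, j) - (Y * genX n x) $$ (i, j) + (if i = j then 1 else 0)"
      unfolding comm_mat_def bX Y_def[symmetric] using ij Y by (simp del: index_mult_mat(1))
    then show ?thesis unfolding vw[OF ij] genX_mult_index[OF Y ij] by simp
  qed
  have vw1: "v i * w i = 1" if "i < n" for i using e[OF that that] by simp
  have v0: "v i \<noteq> 0" if "i < n" for i using vw1[OF that] by auto
  let ?g = "genX n (\<lambda>i. 1 / v i)" and ?h = "genX n v"
  have gh': "inverses n ?g ?h"
  proof (rule inverse_if_left_inverse)
    show "?g * ?h = 1\<^sub>m n"
      using v0 by (intro eq_matI) (auto simp: genX_mult_index(1)[OF gen_carrier(1)] simp del: index_mult_mat(1))
  qed auto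
  have entry: "(?g * A * ?h) $$ (i, j) = 1 / v i * A $$ (i, j) * v j" if "A \<in> carrier_mat n n" "i < n" "j < n" for A i j
    using genX_mult_index(2)[of "?g * A" n i j v] genX_mult_index(1)[of A n i j] that sq_mult[OF gen_carrier(1) that(1)]
    by (simp del: index_mult_mat(1))
  have dims: "dim_row (?g * A * ?h) = n" "dim_col (?g * A * ?h) = n" for A by simp_all
  have "?g * genX n x * ?h = genX n x"
    by (rule eq_matI) (use v0 in \<open>auto simp: entry[OF gen_carrier(1)] simp del: index_mult_mat(1)\<close>)
  moreover have "?g * Y * ?h = genY n x (\<lambda>i. Y $$ (i, i))"
  proof (rule eq_matI)
    fix i j assume "i < dim_row (genY n x (\<lambda>i. Y $$ (i, i)))" "j < dim_col (genY n x (\<lambda>i. Y $$ (i, i)))"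
    then have ij: "i < n" "j < n" by auto
    show "(?g * Y * ?h) $$ (i, j) = genY n x (\<lambda>i. Y $$ (i, i)) $$ (i, j)"
    proof (cases "i = j")
      case True
      then show ?thesis unfolding entry[OF Y ij] using ij v0 by simp
    next
      case False
      then have xx: "x i - x j \<noteq> 0" using x ij by (auto simp: inj_on_def)
      have "(x i - x j) * Y $$ (i, j) = v i * w j" using e[OF ij] False by (simp add: algebra_simps)
      then have "Y $$ (i, j) = v i * w j / (x i - x j)" using xx by (simp add: field_simps)
      then show ?thesis unfolding entry[OF Y ij] using ij v0 vw1[OF ij(2)] False
        by (simp add: mult.commute)
    qed
  qed simp_all
  ultimately have "conj_pair ?g ?h b = (genX n x, genY n x (\<lambda>i. Y $$ (i, i)))"
    by (simp add: conj_pair_def bX Y_def)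
  then have "(genX n x, genY n x (\<lambda>i. Y $$ (i, i))) \<in> conj_orbit n b"
    unfolding conj_orbit_alt using gh' by (metis (mono_tags, lifting) mem_Collect_eq)
  then show ?thesis using orbit_trans[OF a ba] x by blast
qed

text \<open>Transports permutations of the positions to permutations of the indices and compares the
  two Leibniz sums term by term.\<close>

lemma poly_cm_poly_eq_det:
  assumes x: "inj_on x {..<n}" and d: "\<And>i. i < n \<Longrightarrow> d (x i) = y i"
  shows "poly (cm_poly (x ` {..<n}) d) z = det (z \<cdot>\<^sub>m 1\<^sub>m n - genY n x y)"
proof -
  let ?A = "{0..<n}" let ?S = "x ` ?A"
  have inj: "inj_on x ?A" using x by (simp add: lessThan_atLeast0)
  have bij: "bij_betw x ?A ?S" using inj by (simp add: bij_betw_def)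
  have fin: "finite ?A" by simp
  let ?M = "z \<cdot>\<^sub>m 1\<^sub>m n - genY n x y"
  have M: "?M \<in> carrier_mat n n" by auto
  let ?f = "\<lambda>\<pi>. of_int (sign \<pi>) * (\<Prod>s\<in>?S. poly (cm_entry d s (\<pi> s)) z)"
  let ?g = "\<lambda>\<sigma>. of_int (sign \<sigma>) * (\<Prod>i\<in>?A. ?M $$ (i, \<sigma> i))"
  have "poly (cm_poly ?S d) z = (\<Sum>\<pi> | \<pi> permutes ?S. ?f \<pi>)"
    by (simp add: cm_poly_def perm_term_def poly_sum poly_prod)
  also have "\<dots> = (\<Sum>\<sigma> | \<sigma> permutes ?A. ?g \<sigma>)"
  proof (rule sum.reindex_bij_witness[of _ "map_permutation ?A x" "map_permutation ?S (inv_into ?A x)"])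
    fix \<pi> assume \<pi>: "\<pi> \<in> {\<pi>. \<pi> permutes ?S}"
    have binv: "bij_betw (inv_into ?A x) ?S ?A" by (rule bij_betw_inv_into[OF bij])
    show m: "map_permutation ?S (inv_into ?A x) \<pi> \<in> {\<sigma>. \<sigma> permutes ?A}"
      using map_permutation_permutes[OF binv] \<pi> by simp
    show e: "map_permutation ?A x (map_permutation ?S (inv_into ?A x) \<pi>) = \<pi>"
      by (rule map_permutation_compose_inv[OF binv]) (use \<pi> f_inv_into_f[of _ x ?A] in simp_all)
    show "?g (map_permutation ?S (inv_into ?A x) \<pi>) = ?f \<pi>"
    proof -
      define \<sigma> where "\<sigma> = map_permutation ?S (inv_into ?A x) \<pi>"
      have \<sigma>: "\<sigma> permutes ?A" using m by (simp add: \<sigma>_def)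
      have \<pi>\<sigma>: "\<pi> = map_permutation ?A x \<sigma>" using e by (simp add: \<sigma>_def)
      have "(\<Prod>s\<in>?S. poly (cm_entry d s (\<pi> s)) z) = (\<Prod>i\<in>?A. poly (cm_entry d (x i) (x (\<sigma> i))) z)"
        unfolding prod.reindex[OF inj] o_def
        by (intro prod.cong refl) (simp add: \<pi>\<sigma> map_permutation_apply[OF inj])
      also have "\<dots> = (\<Prod>i\<in>?A. ?M $$ (i, \<sigma> i))"
      proof (rule prod.cong[OF refl])
        fix i assume i: "i \<in> ?A"
        then have "\<sigma> i \<in> ?A" using permutes_in_image[OF \<sigma>] by blast
        then show "poly (cm_entry d (x i) (x (\<sigma> i))) z = ?M $$ (i, \<sigma> i)"
          using i d inj by (cases "\<sigma> i = i") (auto simp: cm_entry_def inj_on_eq_iff)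
      qed
      moreover have "sign \<pi> = sign \<sigma>" unfolding \<pi>\<sigma> by (rule sign_map_permutation[OF inj \<sigma> fin])
      ultimately show ?thesis unfolding \<sigma>_def[symmetric] by simp
    qed
  next
    fix \<sigma> assume \<sigma>: "\<sigma> \<in> {\<sigma>. \<sigma> permutes ?A}"
    show "map_permutation ?A x \<sigma> \<in> {\<pi>. \<pi> permutes ?S}"
      using map_permutation_permutes[OF bij] \<sigma> by simp
    show "map_permutation ?S (inv_into ?A x) (map_permutation ?A x \<sigma>) = \<sigma>"
      by (rule map_permutation_compose_inv[OF bij]) (use \<sigma> inv_into_f_f[OF inj] in simp_all)
  qed
  also have "\<dots> = det ?M" unfolding det_def'[OF M] by simp
  finally show ?thesis by (simp add: lessThan_atLeast0)
qed

section \<open>General position\<close>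

lemma gen_pairs: "(genX n x, genY n x y) \<in> pairs n"
  by (simp add: pairs_def)

text \<open>The order of the positions is immaterial: \<open>g\<close> is the permutation matrix
  matching the two orders.\<close>

lemma gen_same_orbit:
  assumes x: "inj_on x {..<n}" "inj_on x' {..<n}" and S: "x' ` {..<n} = x ` {..<n}"
    and y: "\<And>i j. i < n \<Longrightarrow> j < n \<Longrightarrow> x' i = x j \<Longrightarrow> y' i = y j"
  shows "(genX n x', genY n x' y') \<in> conj_orbit n (genX n x, genY n x y)"
proof -
  have "\<exists>j. j < n \<and> x j = x' i" if "i < n" for i
  proof -
    have "x' i \<in> x ` {..<n}" unfolding S[symmetric] using that by simp
    then show ?thesis by auto
  qed
  then obtain \<tau> where \<tau>: "\<And>i. i < n \<Longrightarrow> \<tau> i < n" "\<And>i. i < n \<Longrightarrow> x (\<tau> i) = x' i" by metis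
  define g where "g = mat n n (\<lambda>(i, j). if x' i = x j then 1 else 0 :: complex)"
  define h where "h = mat n n (\<lambda>(i, j). if x i = x' j then 1 else 0 :: complex)"
  have c: "g \<in> carrier_mat n n" "h \<in> carrier_mat n n" by (auto simp: g_def h_def)
  have eq: "x' i = x k \<longleftrightarrow> k = \<tau> i" if "i < n" "k < n" for i k
    using x(1) \<tau>[OF that(1)] that inj_onD[OF x(1), of k "\<tau> i"] by auto
  have gA: "(g * A) $$ (i, j) = A $$ (\<tau> i, j)" if "A \<in> carrier_mat n n" "i < n" "j < n" for A i j
  proof -
    have "(g * A) $$ (i, j) = (\<Sum>k\<in>{0..<n}. g $$ (i, k) * A $$ (k, j))"
      using that c by (simp add: scalar_prod_def)
    also have "\<dots> = (\<Sum>k\<in>{0..<n}. if k = \<tau> i then A $$ (k, j) else 0)"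
      using that eq[OF that(2)] by (intro sum.cong) (auto simp: g_def)
    finally show ?thesis using \<tau>(1)[OF that(2)] by simp
  qed
  have Ah: "(A * h) $$ (i, j) = A $$ (i, \<tau> j)" if "A \<in> carrier_mat n n" "i < n" "j < n" for A i j
  proof -
    have "(A * h) $$ (i, j) = (\<Sum>k\<in>{0..<n}. A $$ (i, k) * h $$ (k, j))"
      using that c by (simp add: scalar_prod_def)
    also have "\<dots> = (\<Sum>k\<in>{0..<n}. if k = \<tau> j then A $$ (i, k) else 0)"
    proof (rule sum.cong[OF refl])
      fix k assume "k \<in> {0..<n}"
      then have "h $$ (k, j) = (if k = \<tau> j then 1 else 0)"
        using that eq[OF that(3), of k] eq_commute[of "x k" "x' j"] by (simp add: h_def)
      then show "A $$ (i, k) * h $$ (k, j) = (if k = \<tau> j then A $$ (i, k) else 0)" by simp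
    qed
    finally show ?thesis using \<tau>(1)[OF that(3)] by simp
  qed
  have inv: "inverses n g h"
  proof (rule inverse_if_left_inverse[OF c], rule eq_matI)
    fix i j assume "i < dim_row (1\<^sub>m n :: cmat)" "j < dim_col (1\<^sub>m n :: cmat)"
    then have ij: "i < n" "j < n" by auto
    have "(g * h) $$ (i, j) = h $$ (\<tau> i, j)" by (rule gA[OF c(2) ij])
    also have "\<dots> = (if x' i = x' j then 1 else 0)" using \<tau>[OF ij(1)] ij by (simp add: h_def)
    also have "\<dots> = 1\<^sub>m n $$ (i, j)" using ij inj_onD[OF x(2), of i j] by auto
    finally show "(g * h) $$ (i, j) = 1\<^sub>m n $$ (i, j)" .
  qed (use c in auto)
  have conj: "(g * A * h) $$ (i, j) = A $$ (\<tau> i, \<tau> j)" if "A \<in> carrier_mat n n" "i < n" "j < n" for A i j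
    using Ah[OF sq_mult[OF c(1) that(1)] that(2,3)] gA[OF that(1,2) \<tau>(1)[OF that(3)]] by simp
  have tt: "\<tau> i = \<tau> j \<longleftrightarrow> i = j" if "i < n" "j < n" for i j
    using \<tau>(2)[OF that(1)] \<tau>(2)[OF that(2)] inj_onD[OF x(2), of i j] that by auto
  have "g * genX n x * h = genX n x'"
  proof (rule eq_matI)
    fix i j assume "i < dim_row (genX n x')" "j < dim_col (genX n x')"
    then have ij: "i < n" "j < n" by auto
    show "(g * genX n x * h) $$ (i, j) = genX n x' $$ (i, j)"
      unfolding conj[OF gen_carrier(1) ij] using ij \<tau> tt[OF ij] by simp
  qed (use c in auto)
  moreover have "g * genY n x y * h = genY n x' y'"
  proof (rule eq_matI)
    fix i j assume "i < dim_row (genY n x' y')" "j < dim_col (genY n x' y')"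
    then have ij: "i < n" "j < n" by auto
    have "y' i = y (\<tau> i)" "y' j = y (\<tau> j)"
      using y[OF ij(1) \<tau>(1)[OF ij(1)]] \<tau>(2)[OF ij(1)] y[OF ij(2) \<tau>(1)[OF ij(2)]] \<tau>(2)[OF ij(2)] by simp_all
    then show "(g * genY n x y * h) $$ (i, j) = genY n x' y' $$ (i, j)"
      unfolding conj[OF gen_carrier(2) ij] using ij \<tau> tt[OF ij] by simp
  qed (use c in auto)
  ultimately have "(genX n x', genY n x' y') = conj_pair g h (genX n x, genY n x y)" by (simp add: conj_pair_def)
  then show ?thesis using inv unfolding conj_orbit_alt by blast
qed

lemma orbit_char_poly:
  assumes "a \<in> pairs n" "b \<in> conj_orbit n a"
  shows "char_poly (fst b) = char_poly (fst a)" "char_poly (snd b) = char_poly (snd a)"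
proof -
  obtain g h where gh: "inverses n g h" and b: "b = conj_pair g h a" using assms(2) unfolding conj_orbit_alt by blast
  show "char_poly (fst b) = char_poly (fst a)" "char_poly (snd b) = char_poly (snd a)"
    unfolding b conj_pair_def fst_conv snd_conv
    by (rule char_poly_conj[OF conjunct1[OF pairsD[OF assms(1)]] gh], rule char_poly_conj[OF conjunct2[OF pairsD[OF assms(1)]] gh])
qed

lemma shiftY_gen: "shiftY q (genX n x, genY n x y) = (genX n x, genY n x (\<lambda>i. y i + poly q (x i)))"
proof -
  have "genY n x y + genX n (\<lambda>i. poly q (x i)) = genY n x (\<lambda>i. y i + poly q (x i))"
    by (intro eq_matI) auto
  then show ?thesis by (simp add: shiftY_def mat_poly_genX)
qed

text \<open>One modulus at a time: \<open>s * w\<close> is 0 modulo the earlier moduli and 1 modulo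
  the new one, so adding \<open>s * w * (r i - p)\<close> corrects only the new residue.\<close>

lemma chinese_remainder_linear_powers:
  fixes c :: "'j \<Rightarrow> complex"
  assumes "finite J" "inj_on c J"
  shows "\<exists>p. \<forall>j\<in>J. [:- c j, 1:] ^ k j dvd p - r j"
  using assms
proof (induct J rule: finite_induct)
  case empty
  then show ?case by simp
next
  case (insert i J)
  then obtain p where p: "\<forall>j\<in>J. [:- c j, 1:] ^ k j dvd p - r j" by auto
  define w where "w = (\<Prod>j\<in>J. [:- c j, 1:] ^ k j)"
  have "c i \<notin> c ` J" using insert by auto
  then have "poly w (c i) \<noteq> 0" using insert(1) by (auto simp: w_def poly_prod)
  then obtain s where s: "[:- c i, 1:] ^ k i dvd s * w - 1" using inverse_mod_linear_power by blast
  define p' where "p' = p + s * w * (r i - p)"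
  have "[:- c j, 1:] ^ k j dvd p' - r j" if j: "j \<in> J" for j
  proof -
    have "[:- c j, 1:] ^ k j dvd w" unfolding w_def using insert(1) j by (rule dvd_prodI)
    then have "[:- c j, 1:] ^ k j dvd s * w * (r i - p)" by (intro dvd_mult2 dvd_mult)
    moreover have "p' - r j = (p - r j) + s * w * (r i - p)" by (simp add: p'_def)
    ultimately show ?thesis using p j by (simp only: dvd_add)
  qed
  moreover have "[:- c i, 1:] ^ k i dvd p' - r i"
  proof -
    have "p' - r i = (s * w - 1) * (r i - p)" by (simp add: p'_def algebra_simps)
    then show ?thesis using s by (simp only: dvd_mult2)
  qed
  ultimately show ?case by (intro exI[of _ p']) auto
qed

lemma interpolation:
  fixes f :: "complex \<Rightarrow> complex"
  assumes "finite S"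
  shows "\<exists>q. \<forall>s\<in>S. poly q s = f s"
proof -
  have "inj_on (\<lambda>s. s) S" by (rule inj_onI)
  then obtain q where q: "\<forall>s\<in>S. [:- s, 1:] ^ 1 dvd q - [:f s:]"
    using chinese_remainder_linear_powers[OF assms, of "\<lambda>s. s" "\<lambda>_. 1" "\<lambda>s. [:f s:]"] by blast
  have "poly q s = f s" if "s \<in> S" for s
  proof -
    have "[:- s, 1:] dvd q - [:f s:]" using q that by (simp only: power_one_right)
    then have "poly (q - [:f s:]) s = 0" by (simp only: poly_eq_0_iff_dvd)
    then show ?thesis by simp
  qed
  then show ?thesis by blast
qed

definition cm_point :: "nat \<Rightarrow> cpair \<Rightarrow> bool" where
  "cm_point n a \<longleftrightarrow> a \<in> pairs n \<and> rank_one n (comm_mat n a) \<and> n > 0"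

lemma cm_point_act: "cm_point n a \<Longrightarrow> cm_point n (act w a)"
  by (auto simp: cm_point_def act_pairs comm_mat_act)

lemma act_orbit_cancel:
  assumes "a \<in> pairs n" "b \<in> pairs n" "act w a \<in> conj_orbit n (act w b)"
  shows "a \<in> conj_orbit n b"
  using act_orbit_mem[OF act_pairs[OF assms(2)] assms(3), of "inv_word w"]
  unfolding act_inv[OF assms(1)] act_inv[OF assms(2)] .

text \<open>Both spectra are first made simple by one word, so both points have generic form. Equal
  position sets with equal momenta would put them in one orbit, so \<open>separating_shift\<close>
  applies; a quarter turn then brings the shifted second matrices to the first place.\<close>

lemma reach_disjoint_spectra:
  assumes a: "cm_point n a" and b: "cm_point m b" and ne: "n \<noteq> m \<or> a \<notin> conj_orbit n b"
  shows "\<exists>w. disjoint_spectra (fst (act w a)) (fst (act w b))"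
proof -
  have ap: "a \<in> pairs n" and bp: "b \<in> pairs m" and n: "n > 0" and m: "m > 0" using a b by (auto simp: cm_point_def)
  define F where "F = (\<lambda>i w. if i then det (mat_poly (pderiv (char_poly (fst (act w a)))) (fst (act w a)))
    else det (mat_poly (pderiv (char_poly (fst (act w b)))) (fst (act w b))))"
  have ss: "det (mat_poly (pderiv (char_poly (fst (act w a)))) (fst (act w a))) \<noteq> 0 \<longleftrightarrow> rsquarefree (char_poly (fst (act w a)))"
    if "a \<in> pairs n" "n > 0" for w n a
    using simple_spectrum_iff[of "fst (act w a)" n] pairsD[OF act_pairs[OF that(1)]] that(2) 
    unfolding simple_spectrum_def by simp
  have "\<exists>w. \<forall>i\<in>{True, False}. F i w \<noteq> 0"
  proof (rule path_poly_simultaneous)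
    show "path_poly (F i)" for i
      using path_poly_simple_spectrum[OF ap] path_poly_simple_spectrum[OF bp] by (cases i) (simp_all add: F_def)
    show "\<exists>w. F i w \<noteq> 0" for i
      using reach_simple_spectrum[OF ap] reach_simple_spectrum[OF bp] a b ss[OF ap n] ss[OF bp m]
      by (cases i) (simp_all add: F_def cm_point_def)
  qed simp
  then obtain w where w: "rsquarefree (char_poly (fst (act w a)))" "rsquarefree (char_poly (fst (act w b)))"
    using ss[OF ap n] ss[OF bp m] by (auto simp: F_def)
  let ?a = "act w a" and ?b = "act w b"
  have ap': "?a \<in> pairs n" and bp': "?b \<in> pairs m" using ap bp act_pairs by auto
  obtain x y where x: "inj_on x {..<n}" and xy: "(genX n x, genY n x y) \<in> conj_orbit n ?a"
    using generic_form[OF ap' _ w(1)] cm_point_act[OF a, of w] by (auto simp: cm_point_def)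
  obtain x' y' where x': "inj_on x' {..<m}" and xy': "(genX m x', genY m x' y') \<in> conj_orbit m ?b"
    using generic_form[OF bp' _ w(2)] cm_point_act[OF b, of w] by (auto simp: cm_point_def)
  let ?S = "x ` {..<n}" and ?S' = "x' ` {..<m}"
  \<comment> \<open>Momenta as functions of the position, which removes the dependence on the order
    of the indices.\<close>
  define f where "f = (\<lambda>s. y (inv_into {..<n} x s))"
  define f' where "f' = (\<lambda>s. y' (inv_into {..<m} x' s))"
  have f: "f (x i) = y i" if "i < n" for i using that x by (simp add: f_def)
  have f': "f' (x' i) = y' i" if "i < m" for i using that x' by (simp add: f'_def)
  have "?S \<noteq> ?S' \<or> (\<exists>s\<in>?S. f s \<noteq> f' s)"
  proof (rule ccontr)
    assume "\<not> ?thesis"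
    then have S: "?S = ?S'" and "\<forall>s\<in>?S. f s = f' s" by blast+
    then have ff: "f s = f' s" if "s \<in> ?S" for s using that by blast
    have "card ?S = n" "card ?S' = m" using card_image[OF x] card_image[OF x'] by auto
    then have nm: "n = m" using S by simp
    have "(genX n x, genY n x y) \<in> conj_orbit n (genX n x', genY n x' y')"
    proof (rule gen_same_orbit)
      show "y i = y' j" if "i < n" "j < n" "x i = x' j" for i j
      proof -
        have "f (x i) = f' (x i)" by (rule ff, rule imageI) (use that in simp)
        then show ?thesis using f[OF that(1)] f'[of j] that nm by simp
      qed
    qed (use x x' S nm in auto)
    then have "(genX n x, genY n x y) \<in> conj_orbit n ?b"
      using orbit_trans[OF bp' xy'] nm by simp
    then have "?a \<in> conj_orbit n ?b"
      using orbit_trans[of ?b n "(genX n x, genY n x y)" ?a] orbit_sym[OF ap' xy] bp' nm by simp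
    then show False using act_orbit_cancel[OF ap _ ] bp nm ne by blast
  qed
  then obtain q where q: "no_common_root (cm_poly ?S (\<lambda>s. f s + q s)) (cm_poly ?S' (\<lambda>s. f' s + q s))"
    using separating_shift[of ?S ?S' f f'] by auto
  obtain p where p: "\<And>s. s \<in> ?S \<union> ?S' \<Longrightarrow> poly p s = q s" using interpolation[of "?S \<union> ?S'" q] by auto
  define v where "v = [(True, [:0, 1:]), (False, [:0, - 1:]), (True, [:0, 1:])] @ [(False, p)] @ w"
  have va: "fst (act v c) = snd (shiftY p (act w c))" if c: "c \<in> pairs k" for c k
  proof -
    have "act v c = act [(True, [:0, 1:]), (False, [:0, - 1:]), (True, [:0, 1:])] (act ((False, p) # w) c)"
    proof -
      have "v = [(True, [:0, 1:]), (False, [:0, - 1:]), (True, [:0, 1:])] @ ((False, p) # w)" by (simp add: v_def)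
      then show ?thesis by (simp only: act_append)
    qed
    then show ?thesis using rotate_act[OF act_pairs[OF c], of "(False, p) # w"] by simp
  qed
  have ch: "poly (char_poly (snd (shiftY p (act w c)))) z = poly (cm_poly (x ` {..<k}) (\<lambda>s. f s + q s)) z"
    if "c \<in> pairs k" "inj_on x {..<k}" "(genX k x, genY k x y) \<in> conj_orbit k (act w c)" 
      "\<And>i. i < k \<Longrightarrow> f (x i) = y i" "\<And>i. i < k \<Longrightarrow> poly p (x i) = q (x i)" for c k x y f z
  proof -
    have c: "act w c \<in> pairs k" using act_pairs that(1) by blast
    have "shiftY p (genX k x, genY k x y) \<in> conj_orbit k (shiftY p (act w c))"
      using act_orbit_mem[OF c that(3), of "[(False, p)]"] by simp
    then have "char_poly (snd (shiftY p (act w c))) = char_poly (genY k x (\<lambda>i. y i + poly p (x i)))"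
    proof -
      assume mem: "shiftY p (genX k x, genY k x y) \<in> conj_orbit k (shiftY p (act w c))"
      have "shiftY p (act w c) \<in> pairs k" using act_pairs[OF c, of "[(False, p)]"] by simp
      from orbit_char_poly(2)[OF this mem] show ?thesis unfolding shiftY_gen snd_conv by (rule sym)
    qed
    moreover have "poly (char_poly (genY k x (\<lambda>i. y i + poly p (x i)))) z = poly (cm_poly (x ` {..<k}) (\<lambda>s. f s + q s)) z"
      unfolding poly_char_poly[OF gen_carrier(2)]
      by (rule poly_cm_poly_eq_det[symmetric, OF that(2)]) (use that in auto)
    ultimately show ?thesis by simp
  qed
  have c: "fst (act v a) \<in> carrier_mat n n" "fst (act v b) \<in> carrier_mat m m"
    using pairsD[OF act_pairs[OF ap]] pairsD[OF act_pairs[OF bp]] by auto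
  have "poly (char_poly (fst (act v a))) z = poly (cm_poly ?S (\<lambda>s. f s + q s)) z"
    "poly (char_poly (fst (act v b))) z = poly (cm_poly ?S' (\<lambda>s. f' s + q s)) z" for z
    unfolding va[OF ap] va[OF bp] using ch[OF ap x xy f] ch[OF bp x' xy' f'] p by simp_all
  then have "disjoint_spectra (fst (act v a)) (fst (act v b))"
    unfolding disjoint_spectra_iff[OF c] eigenvalue_root_char_poly[OF c(1)] eigenvalue_root_char_poly[OF c(2)]
    using q unfolding no_common_root_def by simp
  then show ?thesis by blast
qed

text \<open>The conditions are indexed by \<open>J\<close> times \<open>J\<close>: simplicity on the
  diagonal, disjointness off it. Each is attained by some word, so all are attained by one.\<close>

lemma general_position:
  assumes J: "finite J" and a: "\<And>j. j \<in> J \<Longrightarrow> cm_point (n j) (a j)"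
    and ne: "\<And>i j. i \<in> J \<Longrightarrow> j \<in> J \<Longrightarrow> i \<noteq> j \<Longrightarrow> n i \<noteq> n j \<or> a i \<notin> conj_orbit (n i) (a j)"
  shows "\<exists>w. (\<forall>j\<in>J. rsquarefree (char_poly (fst (act w (a j))))) \<and>
    (\<forall>i\<in>J. \<forall>j\<in>J. i \<noteq> j \<longrightarrow> disjoint_spectra (fst (act w (a i))) (fst (act w (a j))))"
proof -
  define F where "F = (\<lambda>(i, j) w. if i = j then det (mat_poly (pderiv (char_poly (fst (act w (a i))))) (fst (act w (a i))))
    else det (mat_poly (char_poly (fst (act w (a i)))) (fst (act w (a j)))))"
  have p: "a j \<in> pairs (n j)" "n j > 0" "rank_one (n j) (comm_mat (n j) (a j))" if "j \<in> J" for j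
    using a[OF that] by (auto simp: cm_point_def)
  have ss: "F (j, j) w \<noteq> 0 \<longleftrightarrow> rsquarefree (char_poly (fst (act w (a j))))" if "j \<in> J" for j w
    using simple_spectrum_iff[of "fst (act w (a j))" "n j"] pairsD[OF act_pairs[OF p(1)[OF that]]] p(2)[OF that]
    unfolding simple_spectrum_def F_def by simp
  have "\<exists>w. \<forall>ij\<in>J \<times> J. F ij w \<noteq> 0"
  proof (rule path_poly_simultaneous)
    show "path_poly (F ij)" if m: "ij \<in> J \<times> J" for ij
    proof -
      obtain i j where ij: "ij = (i, j)" "i \<in> J" "j \<in> J" using m by auto
      then show ?thesis
        using path_poly_simple_spectrum[OF p(1)[OF ij(2)]] path_poly_disjoint_spectra[OF p(1)[OF ij(2)] p(1)[OF ij(3)]]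
        by (cases "i = j") (simp_all add: F_def)
    qed
    show "\<exists>w. F ij w \<noteq> 0" if m: "ij \<in> J \<times> J" for ij
    proof -
      obtain i j where ij: "ij = (i, j)" "i \<in> J" "j \<in> J" using m by auto
      show ?thesis
      proof (cases "i = j")
        case True
        then show ?thesis using ss[OF ij(2)] reach_simple_spectrum[OF p(1,3)[OF ij(2)]] ij by blast
      next
        case False
        then have "\<exists>w. disjoint_spectra (fst (act w (a i))) (fst (act w (a j)))"
          using reach_disjoint_spectra[OF a[OF ij(2)] a[OF ij(3)]] ne[OF ij(2,3)] by blast
        then show ?thesis using ij False unfolding disjoint_spectra_def F_def by auto
      qed
    qed
  qed (use J in simp)
  then obtain w where w: "\<And>i j. i \<in> J \<Longrightarrow> j \<in> J \<Longrightarrow> F (i, j) w \<noteq> 0" by blast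
  have "disjoint_spectra (fst (act w (a i))) (fst (act w (a j)))" if "i \<in> J" "j \<in> J" "i \<noteq> j" for i j
    using w[OF that(1,2)] that(3) by (simp add: F_def disjoint_spectra_def)
  moreover have "rsquarefree (char_poly (fst (act w (a j))))" if "j \<in> J" for j
    using w[OF that that] ss[OF that] by simp
  ultimately show ?thesis by blast
qed

section \<open>Points with nilpotent second matrix\<close>

text \<open>Multiplication by the variable modulo a monic polynomial \<open>P\<close>, and differentiation, on the
  polynomials of degree less than \<open>n\<close> in the monomial basis.\<close>

definition comp_mat :: "nat \<Rightarrow> complex poly \<Rightarrow> cmat" where
  "comp_mat n P = mat n n (\<lambda>(i, j). (if i = Suc j then 1 else 0) - (if Suc j = n then coeff P i else 0))"

definition deriv_mat :: "nat \<Rightarrow> cmat" where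
  "deriv_mat n = mat n n (\<lambda>(i, j). if j = Suc i then of_nat j else 0)"

lemma comp_deriv_carrier [simp]: "comp_mat n P \<in> carrier_mat n n" "deriv_mat n \<in> carrier_mat n n"
  "dim_row (comp_mat n P) = n" "dim_col (comp_mat n P) = n" "dim_row (deriv_mat n) = n" "dim_col (deriv_mat n) = n"
  by (auto simp: comp_mat_def deriv_mat_def)

lemma mult_deriv_index:
  assumes "A \<in> carrier_mat n n" "i < n" "j < n"
  shows "(A * deriv_mat n) $$ (i, j) = (if j = 0 then 0 else of_nat j * A $$ (i, j - 1))"
    "(deriv_mat n * A) $$ (i, j) = (if Suc i < n then of_nat (Suc i) * A $$ (Suc i, j) else 0)"
proof -
  have "(A * deriv_mat n) $$ (i, j) = (\<Sum>k\<in>{0..<n}. A $$ (i, k) * deriv_mat n $$ (k, j))"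
    using assms by (simp add: scalar_prod_def)
  also have "\<dots> = (\<Sum>k\<in>{0..<n}. if k = j - 1 then (if j = 0 then 0 else of_nat j * A $$ (i, j - 1)) else 0)"
    using assms by (intro sum.cong refl) (auto simp: deriv_mat_def)
  also have "\<dots> = (if j = 0 then 0 else of_nat j * A $$ (i, j - 1))" using assms by simp
  finally show "(A * deriv_mat n) $$ (i, j) = (if j = 0 then 0 else of_nat j * A $$ (i, j - 1))" .
  have "(deriv_mat n * A) $$ (i, j) = (\<Sum>k\<in>{0..<n}. deriv_mat n $$ (i, k) * A $$ (k, j))"
    using assms by (simp add: scalar_prod_def)
  also have "\<dots> = (\<Sum>k\<in>{0..<n}. if k = Suc i then of_nat (Suc i) * A $$ (Suc i, j) else 0)"
    using assms by (intro sum.cong refl) (auto simp: deriv_mat_def)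
  also have "\<dots> = (if Suc i < n then of_nat (Suc i) * A $$ (Suc i, j) else 0)" using assms by simp
  finally show "(deriv_mat n * A) $$ (i, j) = (if Suc i < n then of_nat (Suc i) * A $$ (Suc i, j) else 0)" .
qed

text \<open>The relation \<open>[x, d/dx] = -1\<close> cancels the identity on every monomial except
  \<open>x^(n-1)\<close>, where reduction modulo \<open>P\<close> leaves the derivative of
  \<open>P\<close> as the last column.\<close>

lemma comm_mat_comp:
  assumes ij: "i < n" "j < n" and P: "coeff P n = 1"
  shows "comm_mat n (comp_mat n P, deriv_mat n) $$ (i, j) = (if Suc j = n then coeff (pderiv P) i else 0)"
proof -
  have "comm_mat n (comp_mat n P, deriv_mat n) $$ (i, j) =
      (comp_mat n P * deriv_mat n) $$ (i, j) - (deriv_mat n * comp_mat n P) $$ (i, j) + (if i = j then 1 else 0)"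
    using ij by (simp add: comm_mat_def del: index_mult_mat(1))
  also have "\<dots> = (if Suc j = n then coeff (pderiv P) i else 0)"
  proof (cases "Suc i = n")
    case True
    then have "coeff P (Suc i) = 1" using P by simp
    then show ?thesis unfolding mult_deriv_index[OF comp_deriv_carrier(1) ij] using True ij
      by (cases j) (auto simp: comp_mat_def coeff_pderiv)
  next
    case False
    then show ?thesis unfolding mult_deriv_index[OF comp_deriv_carrier(1) ij] using ij
      by (cases j) (auto simp: comp_mat_def coeff_pderiv algebra_simps)
  qed
  finally show ?thesis .
qed

text \<open>Evaluation at the roots \<open>x i\<close> of \<open>P\<close> diagonalizes
  multiplication modulo \<open>P\<close>. With a suitable scaling the rank-one commutator becomes
  the all-ones matrix, which forces the off-diagonal entries of the Lax matrix.\<close>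

lemma gen_conj_comp:
  assumes x: "inj_on x {..<n}"
  shows "\<exists>y P. degree P = n \<and> coeff P n = 1 \<and> (comp_mat n P, deriv_mat n) \<in> conj_orbit n (genX n x, genY n x y)"
proof -
  define P where "P = (\<Prod>i<n. [:- x i, 1:])"
  have deg: "degree P = n" unfolding P_def by (subst degree_prod_sum_eq) auto
  have "lead_coeff P = 1" unfolding P_def by (subst lead_coeff_prod) simp
  then have lc: "coeff P n = 1" using deg by simp
  have Px: "poly P (x i) = 0" if "i < n" for i using that by (auto simp: P_def poly_prod)
  have dPx: "poly (pderiv P) (x i) \<noteq> 0" if i: "i < n" for i
  proof -
    define Q where "Q = (\<Prod>k\<in>{..<n} - {i}. [:- x k, 1:])"
    have e: "P = [:- x i, 1:] * Q" unfolding P_def Q_def using i by (subst prod.remove[of _ i]) auto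
    have "poly (pderiv P) (x i) = poly Q (x i)" unfolding e pderiv_mult poly_add poly_mult by (simp add: pderiv_pCons)
    moreover have "poly Q (x i) \<noteq> 0" using x i by (auto simp: Q_def poly_prod inj_on_def)
    ultimately show ?thesis by simp
  qed
  \<comment> \<open>This scaling makes \<open>V\<close> send the derivative of \<open>P\<close>, the
    only nonzero column of the commutator, to the all-ones vector.\<close>
  define d where "d = (\<lambda>i. 1 / poly (pderiv P) (x i))"
  have d0: "d i \<noteq> 0" if "i < n" for i using dPx[OF that] by (simp add: d_def)
  define V where "V = mat n n (\<lambda>(i, k). x i ^ k * d i)"
  have V: "V \<in> carrier_mat n n" by (simp add: V_def)
  let ?C = "comp_mat n P" and ?N = "deriv_mat n"
  have "V * ?C = genX n x * V"
  proof (rule eq_matI)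
    fix i j assume "i < dim_row (genX n x * V)" "j < dim_col (genX n x * V)"
    then have ij: "i < n" "j < n" using V by auto
    have "(V * ?C) $$ (i, j) = (\<Sum>k\<in>{0..<n}. x i ^ k * d i * ((if k = Suc j then 1 else 0) - (if Suc j = n then coeff P k else 0)))"
      using ij by (simp add: scalar_prod_def V_def comp_mat_def)
    also have "\<dots> = (\<Sum>k\<in>{0..<n}. (if k = Suc j then x i ^ k * d i else 0)) - (\<Sum>k\<in>{0..<n}. x i ^ k * d i * (if Suc j = n then coeff P k else 0))"
      unfolding sum_subtractf[symmetric] by (intro sum.cong) (auto simp: algebra_simps)
    also have "\<dots> = x i ^ Suc j * d i"
    proof (cases "Suc j = n")
      case True
      have "poly P (x i) = (\<Sum>k\<in>{0..<n}. coeff P k * x i ^ k) + x i ^ n"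
        unfolding poly_altdef deg using lc by (simp add: lessThan_Suc_atMost[symmetric] lessThan_atLeast0)
      then have s: "(\<Sum>k\<in>{0..<n}. coeff P k * x i ^ k) = - (x i ^ n)" using Px[OF ij(1)] by (simp add: add_eq_0_iff2)
      have "(\<Sum>k\<in>{0..<n}. x i ^ k * d i * (if Suc j = n then coeff P k else 0)) = d i * (\<Sum>k\<in>{0..<n}. coeff P k * x i ^ k)"
        unfolding sum_distrib_left using True by (intro sum.cong) auto
      then show ?thesis unfolding s using True by simp
    next
      case False
      then show ?thesis using ij by simp
    qed
    also have "\<dots> = (genX n x * V) $$ (i, j)" unfolding genX_mult_index(1)[OF V ij] using ij by (simp add: V_def)
    finally show "(V * ?C) $$ (i, j) = (genX n x * V) $$ (i, j)" .
  qed (use V in auto)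
  then have VC: "V * ?C = genX n x * V" .
  have "det V \<noteq> 0"
  proof
    assume "det V = 0"
    then obtain c where c: "c \<in> carrier_vec n" "c \<noteq> 0\<^sub>v n" "V *\<^sub>v c = 0\<^sub>v n"
      using det_0_iff_vec_prod_zero_field[OF V] by blast
    \<comment> \<open>A kernel vector of \<open>V\<close> is the coefficient vector of a polynomial
      of degree less than \<open>n\<close> with the \<open>n\<close> roots
      \<open>x i\<close>.\<close>
    define p where "p = (\<Sum>k<n. monom (c $ k) k)"
    have cp: "coeff p k = (if k < n then c $ k else 0)" for k
    proof -
      have "coeff p k = (\<Sum>j<n. if j = k then c $ j else 0)" unfolding p_def coeff_sum coeff_monom ..
      then show ?thesis by simp
    qed
    have "p = 0"
    proof (rule ccontr)
      assume p0: "p \<noteq> 0"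
      have n0: "n > 0"
      proof (rule ccontr)
        assume "\<not> n > 0"
        then show False using p0 by (simp add: p_def)
      qed
      have "degree p \<le> n - 1" by (rule degree_le) (use cp in auto)
      have "poly p (x i) = 0" if i: "i < n" for i
      proof -
        have "(V *\<^sub>v c) $ i = (\<Sum>k<n. x i ^ k * d i * c $ k)"
          using i c(1) by (simp add: V_def scalar_prod_def lessThan_atLeast0)
        also have "\<dots> = d i * poly p (x i)"
          unfolding p_def poly_sum poly_monom sum_distrib_left by (intro sum.cong) auto
        finally show ?thesis using c(3) i d0[OF i] by simp
      qed
      then have "x ` {..<n} \<subseteq> {z. poly p z = 0}" by auto
      then have "card (x ` {..<n}) \<le> card {z. poly p z = 0}" by (rule card_mono[OF poly_roots_finite[OF p0]])
      also have "\<dots> \<le> degree p" by (rule card_poly_roots_bound[OF p0])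
      finally show False using \<open>degree p \<le> n - 1\<close> card_image[OF x] n0 by simp
    qed
    have "c $ k = 0" if "k < n" for k using cp[of k] \<open>p = 0\<close> that by simp
    then have "c = 0\<^sub>v n" using c(1) by (intro eq_vecI) auto
    then show False using c(2) by simp
  qed
  then obtain W where VW: "inverses n V W" using invertible_if_det[OF V] by blast
  have W: "W \<in> carrier_mat n n" "W * V = 1\<^sub>m n" "V * W = 1\<^sub>m n" using VW by (auto simp: inverses_def)
  let ?b = "(?C, ?N)"
  have b: "?b \<in> pairs n" by (simp add: pairs_def)
  define Y where "Y = V * ?N * W"
  have Y: "Y \<in> carrier_mat n n" unfolding Y_def by (intro sq_mult V W(1) comp_deriv_carrier(2))
  have "V * ?C * W = genX n x"
    unfolding VC using V W by (simp add: sq_assoc[where n=n] sq_one[where n=n])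
  then have conj: "conj_pair V W ?b = (genX n x, Y)" by (simp add: conj_pair_def Y_def)
  let ?D = "comm_mat n ?b"
  have D: "?D \<in> carrier_mat n n" by (rule comm_mat_carrier[OF b])
  have comm: "comm_mat n (genX n x, Y) = V * ?D * W" unfolding conj[symmetric] by (rule comm_mat_conj_pair[OF b VW])
  have VD: "(V * ?D) $$ (i, j) = (if Suc j = n then 1 else 0)" if ij: "i < n" "j < n" for i j
  proof -
    have "(V * ?D) $$ (i, j) = (\<Sum>k\<in>{0..<n}. x i ^ k * d i * (if Suc j = n then coeff (pderiv P) k else 0))"
      using ij V D comm_mat_comp[of _ n j P] lc by (simp add: scalar_prod_def V_def)
    also have "\<dots> = (if Suc j = n then d i * poly (pderiv P) (x i) else 0)"
    proof (cases "Suc j = n")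
      case True
      have "degree (pderiv P) = n - 1" by (simp add: degree_pderiv deg)
      then have "poly (pderiv P) (x i) = (\<Sum>k\<le>n - 1. coeff (pderiv P) k * x i ^ k)" by (simp add: poly_altdef)
      also have "{..n - 1} = {0..<n}" using ij by auto
      finally show ?thesis using True by (simp add: sum_distrib_left mult_ac)
    qed simp
    finally show ?thesis using dPx[OF ij(1)] by (simp add: d_def)
  qed
  have VDc: "V * ?D \<in> carrier_mat n n" using V D by simp
  have VDW: "(V * ?D * W) $$ (i, j) = W $$ (n - 1, j)" if ij: "i < n" "j < n" for i j
  proof -
    have "(Q * W) $$ (i, j) = (\<Sum>k\<in>{0..<n}. Q $$ (i, k) * W $$ (k, j))" if "Q \<in> carrier_mat n n" for Q
      using that ij W by (simp add: scalar_prod_def)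
    from this[OF VDc] have "(V * ?D * W) $$ (i, j) = (\<Sum>k\<in>{0..<n}. (V * ?D) $$ (i, k) * W $$ (k, j))" .
    also have "\<dots> = (\<Sum>k\<in>{0..<n}. if k = n - 1 then W $$ (k, j) else 0)"
      by (rule sum.cong[OF refl]) (use ij VD[OF ij(1)] in auto)
    finally show ?thesis using ij by simp
  qed
  have e: "x i * Y $$ (i, j) - Y $$ (i, j) * x j + (if i = j then 1 else 0) = W $$ (n - 1, j)" if ij: "i < n" "j < n" for i j
  proof -
    have "comm_mat n (genX n x, Y) $$ (i, j) = (genX n x * Y) $$ (i, j) - (Y * genX n x) $$ (i, j) + (if i = j then 1 else 0)"
      unfolding comm_mat_def using ij Y by (simp del: index_mult_mat(1))
    then show ?thesis unfolding comm VDW[OF ij] genX_mult_index[OF Y ij] by simp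
  qed
  \<comment> \<open>A commutator with a diagonal matrix has zero diagonal, so \<open>e\<close> at
    \<open>i = j\<close> reads off the last row of \<open>W\<close>.\<close>
  have W1: "W $$ (n - 1, j) = 1" if "j < n" for j using e[OF that that] by simp
  have "Y = genY n x (\<lambda>i. Y $$ (i, i))"
  proof (rule eq_matI)
    fix i j assume "i < dim_row (genY n x (\<lambda>i. Y $$ (i, i)))" "j < dim_col (genY n x (\<lambda>i. Y $$ (i, i)))"
    then have ij: "i < n" "j < n" by auto
    show "Y $$ (i, j) = genY n x (\<lambda>i. Y $$ (i, i)) $$ (i, j)"
    proof (cases "i = j")
      case False
      then have "x i - x j \<noteq> 0" using x ij by (auto simp: inj_on_def)
      moreover have "(x i - x j) * Y $$ (i, j) = 1" using e[OF ij] W1[OF ij(2)] False by (simp add: algebra_simps)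
      ultimately show ?thesis using ij False by (simp add: field_simps)
    qed (use ij in simp)
  qed (use Y in auto)
  then have "(genX n x, genY n x (\<lambda>i. Y $$ (i, i))) = conj_pair V W ?b" using conj by simp
  then have "(genX n x, genY n x (\<lambda>i. Y $$ (i, i))) \<in> conj_orbit n ?b" using VW unfolding conj_orbit_alt by blast
  then have "?b \<in> conj_orbit n (genX n x, genY n x (\<lambda>i. Y $$ (i, i)))" by (rule orbit_sym[OF b])
  then show ?thesis using deg lc by blast
qed

section \<open>The derivation as a cyclic nilpotent matrix\<close>

context
  fixes n :: nat
  assumes n: "n > 0"
begin

text \<open>The last column of \<open>p(N)\<close> is \<open>p(d/dx)\<close> applied to
  \<open>x^(n-1)\<close>, and the derivatives of \<open>x^(n-1)\<close> span all polynomials of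
  degree less than \<open>n\<close>.\<close>

lemma deriv_cyclic:
  fixes v :: "nat \<Rightarrow> complex"
  shows "\<exists>p. \<forall>i<n. mat_poly p (deriv_mat n) $$ (i, n - 1) = v i"
proof -
  let ?N = "deriv_mat n"
  have M: "mat_poly p ?N \<in> carrier_mat n n" for p by simp
  have basis: "\<exists>p. \<forall>i<n. mat_poly p ?N $$ (i, n - 1) = (if i = n - 1 - m then 1 else 0)" if "m < n" for m
    using that
  proof (induct m)
    case 0
    show ?case using n by (intro exI[of _ 1]) (auto simp: mat_poly_1[of _ n])
  next
    case (Suc m)
    then obtain p where p: "\<And>i. i < n \<Longrightarrow> mat_poly p ?N $$ (i, n - 1) = (if i = n - 1 - m then 1 else 0)" by auto
    \<comment> \<open>Differentiating \<open>x^(n-1-m)\<close> produces the factor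
      \<open>n-1-m\<close>, nonzero because \<open>Suc m < n\<close>.\<close>
    let ?c = "1 / of_nat (n - 1 - m) :: complex"
    have "mat_poly (Polynomial.smult ?c ([:0, 1:] * p)) ?N = ?c \<cdot>\<^sub>m (?N * mat_poly p ?N)"
    proof -
      have "mat_poly [:0, 1:] ?N = ?N" unfolding mat_poly_X[OF comp_deriv_carrier(2)] by (intro eq_matI) auto
      then show ?thesis by (simp only: mat_poly_smult[OF comp_deriv_carrier(2)] mat_poly_mult[OF comp_deriv_carrier(2)])
    qed
    moreover have "(?c \<cdot>\<^sub>m (?N * mat_poly p ?N)) $$ (i, n - 1) = (if i = n - 1 - Suc m then 1 else 0)" if i: "i < n" for i
    proof -
      have "(?c \<cdot>\<^sub>m (?N * mat_poly p ?N)) $$ (i, n - 1) = ?c * (?N * mat_poly p ?N) $$ (i, n - 1)"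
        using i n by (simp del: index_mult_mat(1))
      also have "\<dots> = ?c * (if Suc i < n then of_nat (Suc i) * mat_poly p ?N $$ (Suc i, n - 1) else 0)"
        using mult_deriv_index(2)[OF M i, of "n - 1" p] n by simp
      also have "\<dots> = (if i = n - 1 - Suc m then 1 else 0)"
      proof (cases "i = n - 1 - Suc m")
        case True
        then have "Suc i = n - 1 - m" "Suc i < n" using Suc(2) by auto
        then show ?thesis using p[of "Suc i"] True by (simp del: of_nat_Suc)
      next
        case False
        then have "Suc i \<noteq> n - 1 - m" by auto
        then show ?thesis using p[of "Suc i"] False by simp
      qed
      finally show ?thesis .
    qed
    ultimately show ?case by (intro exI[of _ "Polynomial.smult ?c ([:0, 1:] * p)"]) simp
  qed
  have "\<exists>p. \<forall>i<n. mat_poly p ?N $$ (i, n - 1) = (if i < m then v i else 0)" if "m \<le> n" for m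
    using that
  proof (induct m)
    case 0
    show ?case using n by (intro exI[of _ 0]) (auto simp: mat_poly_0[of _ n])
  next
    case (Suc m)
    then obtain p where p: "\<And>i. i < n \<Longrightarrow> mat_poly p ?N $$ (i, n - 1) = (if i < m then v i else 0)" by auto
    obtain q where q: "\<And>i. i < n \<Longrightarrow> mat_poly q ?N $$ (i, n - 1) = (if i = m then 1 else 0)"
      using basis[of "n - 1 - m"] Suc(2) n by auto
    have "mat_poly (p + Polynomial.smult (v m) q) ?N $$ (i, n - 1) = (if i < Suc m then v i else 0)" if i: "i < n" for i
    proof -
      have "mat_poly (p + Polynomial.smult (v m) q) ?N $$ (i, n - 1) = mat_poly p ?N $$ (i, n - 1) + v m * mat_poly q ?N $$ (i, n - 1)"
        using i n by (simp add: mat_poly_add[of _ n] mat_poly_smult[of _ n])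
      then show ?thesis using p[OF i] q[OF i] by (auto simp: less_Suc_eq)
    qed
    then show ?case by blast
  qed
  from this[of n] show ?thesis by auto
qed

text \<open>A matrix commuting with \<open>N\<close> is determined by its value on the cyclic
  vector, where it agrees with some polynomial in \<open>N\<close>.\<close>

lemma commutes_with_deriv:
  assumes K: "K \<in> carrier_mat n n" "K * deriv_mat n = deriv_mat n * K"
  shows "\<exists>p. K = mat_poly p (deriv_mat n)"
proof -
  let ?N = "deriv_mat n"
  have M: "mat_poly p ?N \<in> carrier_mat n n" for p by simp
  have idx: "(A * B) $$ (i, j) = (\<Sum>k\<in>{0..<n}. A $$ (i, k) * B $$ (k, j))"
    if "A \<in> carrier_mat n n" "B \<in> carrier_mat n n" "i < n" "j < n" for A B :: cmat and i j
    using that by (simp add: scalar_prod_def)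
  have n1: "n - 1 < n" using n by simp
  obtain p where p: "\<And>i. i < n \<Longrightarrow> mat_poly p ?N $$ (i, n - 1) = K $$ (i, n - 1)"
    using deriv_cyclic[of "\<lambda>i. K $$ (i, n - 1)"] by blast
  have "K $$ (i, k) = mat_poly p ?N $$ (i, k)" if ik: "i < n" "k < n" for i k
  proof -
    obtain q where q: "\<And>i. i < n \<Longrightarrow> mat_poly q ?N $$ (i, n - 1) = (if i = k then 1 else 0)"
      using deriv_cyclic[of "\<lambda>i. if i = k then 1 else 0"] by blast
    have col: "(A * mat_poly q ?N) $$ (i, n - 1) = A $$ (i, k)" if A: "A \<in> carrier_mat n n" for A
    proof -
      have "(A * mat_poly q ?N) $$ (i, n - 1) = (\<Sum>l\<in>{0..<n}. if l = k then A $$ (i, l) else 0)"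
        unfolding idx[OF A M ik(1) n1] using q by (intro sum.cong) auto
      then show ?thesis using ik by simp
    qed
    have "K $$ (i, k) = (K * mat_poly q ?N) $$ (i, n - 1)" using col[OF K(1)] by simp
    also have "K * mat_poly q ?N = mat_poly q ?N * K"
      using mat_poly_comm[OF comp_deriv_carrier(2) K(1) K(2)[symmetric]] by simp
    also have "(mat_poly q ?N * K) $$ (i, n - 1) = (mat_poly q ?N * mat_poly p ?N) $$ (i, n - 1)"
      unfolding idx[OF M K(1) ik(1) n1] idx[OF M M ik(1) n1] using p by (intro sum.cong) auto
    also have "mat_poly q ?N * mat_poly p ?N = mat_poly p ?N * mat_poly q ?N" by (rule mat_poly_comm2[OF comp_deriv_carrier(2)])
    also have "(mat_poly p ?N * mat_poly q ?N) $$ (i, n - 1) = mat_poly p ?N $$ (i, k)" by (rule col[OF M])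
    finally show ?thesis .
  qed
  then show ?thesis using K(1) by (intro exI[of _ p] eq_matI) auto
qed

lemma char_poly_deriv: "char_poly (deriv_mat n) = [:0, 1:] ^ n"
proof -
  have "upper_triangular (deriv_mat n)" by (auto simp: upper_triangular_def deriv_mat_def)
  then have "char_poly (deriv_mat n) = (\<Prod>a\<leftarrow>diag_mat (deriv_mat n). [:- a, 1:])"
    by (rule char_poly_upper_triangular[OF comp_deriv_carrier(2)])
  also have "diag_mat (deriv_mat n) = replicate n 0"
    by (intro nth_equalityI) (auto simp: diag_mat_def deriv_mat_def)
  finally show ?thesis by (simp add: prod_list_replicate)
qed

lemma deriv_last_row:
  assumes "j < n"
  shows "mat_poly p (deriv_mat n) $$ (n - 1, j) = (if j = n - 1 then poly p 0 else 0)"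
proof (induct p rule: pCons_induct)
  case 0
  then show ?case using assms by (simp add: mat_poly_0[of _ n])
next
  case (pCons a p)
  have M: "mat_poly p (deriv_mat n) \<in> carrier_mat n n" by simp
  have "(deriv_mat n * mat_poly p (deriv_mat n)) $$ (n - 1, j) = 0"
    using mult_deriv_index(2)[OF M, of "n - 1" j] assms n by simp
  then show ?case using assms n by (simp add: mat_poly_pCons[where n=n] del: index_mult_mat(1))
qed

text \<open>An invertible \<open>G\<close>, polynomial in \<open>N\<close>, matches the commutators
  of the two companion matrices. Then \<open>E = X G - G Q\<close> commutes with \<open>N\<close>,
  so \<open>E\<close> times the inverse of \<open>G\<close> is a polynomial in \<open>N\<close>;
  subtracting it from \<open>X\<close> leaves the conjugate of \<open>Q\<close> by
  \<open>G\<close>.\<close>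

lemma comp_shift:
  assumes P: "coeff P n = 1"
  shows "\<exists>p. (comp_mat n P + mat_poly p (deriv_mat n), deriv_mat n) \<in> conj_orbit n (comp_mat n (monom 1 n), deriv_mat n)"
proof -
  note R = sq_ring[where n=n]
  let ?N = "deriv_mat n" and ?X = "comp_mat n P" and ?Q = "comp_mat n (monom 1 n)"
  have N: "?N \<in> carrier_mat n n" by simp
  have idx: "(A * B) $$ (i, j) = (\<Sum>k\<in>{0..<n}. A $$ (i, k) * B $$ (k, j))"
    if "A \<in> carrier_mat n n" "B \<in> carrier_mat n n" "i < n" "j < n" for A B :: cmat and i j
    using that by (simp add: scalar_prod_def)
  \<comment> \<open>Chosen so that \<open>\<gamma>(d/dx)\<close> sends \<open>n x^(n-1)\<close>, the
    derivative of \<open>x^n\<close>, to the derivative of \<open>P\<close>. As \<open>P\<close> is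
    monic, \<open>\<gamma>\<close> has constant term 1, which makes \<open>G\<close>
    invertible.\<close>
  obtain \<gamma> where \<gamma>: "\<And>i. i < n \<Longrightarrow> mat_poly \<gamma> ?N $$ (i, n - 1) = coeff (pderiv P) i / of_nat n"
    using deriv_cyclic[of "\<lambda>i. coeff (pderiv P) i / of_nat n"] by blast
  have \<gamma>0: "poly \<gamma> 0 = 1"
    using \<gamma>[of "n - 1"] deriv_last_row[of "n - 1" \<gamma>] n P by (simp add: coeff_pderiv)
  define G where "G = mat_poly \<gamma> ?N"
  have G: "G \<in> carrier_mat n n" by (simp add: G_def)
  have GN: "G * ?N = ?N * G" unfolding G_def by (rule mat_poly_comm_self[OF N])
  have "det G \<noteq> 0"
  proof
    assume "det G = 0"
    moreover have "\<gamma> \<noteq> 0" using \<gamma>0 by auto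
    ultimately obtain z where "poly \<gamma> z = 0" "eigenvalue ?N z"
      unfolding G_def using det_mat_poly_eq_0_iff[OF N] by blast
    then show False using \<gamma>0 unfolding eigenvalue_root_char_poly[OF N] char_poly_deriv by simp
  qed
  then obtain H where GH: "inverses n G H" using invertible_if_det[OF G] by blast
  have H: "H \<in> carrier_mat n n" "H * G = 1\<^sub>m n" "G * H = 1\<^sub>m n" using GH by (auto simp: inverses_def)
  have HN: "H * ?N = ?N * H"
  proof -
    have "H * ?N = H * (?N * (G * H))" using H N by (simp add: R)
    also have "\<dots> = H * ((?N * G) * H)" using H N G by (simp add: R)
    also have "\<dots> = H * (G * (?N * H))" unfolding GN[symmetric] using H N G by (simp add: R)
    also have "\<dots> = ?N * H" using H N G by (simp add: sq_cancel[where n=n] R)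
    finally show ?thesis .
  qed
  define CP where "CP = comm_mat n (?X, ?N)"
  define CQ where "CQ = comm_mat n (?Q, ?N)"
  have C: "CP \<in> carrier_mat n n" "CQ \<in> carrier_mat n n" by (auto simp: CP_def CQ_def comm_mat_def)
  have CPi: "CP $$ (i, j) = (if Suc j = n then coeff (pderiv P) i else 0)" if "i < n" "j < n" for i j
    unfolding CP_def by (rule comm_mat_comp[OF that P])
  have CQi: "CQ $$ (i, j) = (if Suc j = n then coeff (pderiv (monom 1 n)) i else 0)" if "i < n" "j < n" for i j
    unfolding CQ_def by (rule comm_mat_comp[OF that]) simp
  have GC: "G * CQ = CP"
  proof (rule eq_matI)
    fix i j assume "i < dim_row CP" "j < dim_col CP"
    then have ij: "i < n" "j < n" using C by auto
    have "(G * CQ) $$ (i, j) = (\<Sum>k\<in>{0..<n}. if k = n - 1 then (if Suc j = n then G $$ (i, k) * of_nat n else 0) else 0)"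
      unfolding idx[OF G C(2) ij] using ij by (intro sum.cong) (auto simp: CQi coeff_pderiv)
    also have "\<dots> = CP $$ (i, j)" using ij n \<gamma>[OF ij(1)] CPi[OF ij] by (simp add: G_def)
    finally show "(G * CQ) $$ (i, j) = CP $$ (i, j)" .
  qed (use G C in auto)
  \<comment> \<open>\<open>CP\<close> sees only the last row of \<open>G\<close>, which is that of
    the identity because \<open>\<gamma>\<close> has constant term 1.\<close>
  have CG: "CP * G = CP"
  proof (rule eq_matI)
    fix i j assume "i < dim_row CP" "j < dim_col CP"
    then have ij: "i < n" "j < n" using C by auto
    have "(CP * G) $$ (i, j) = (\<Sum>k\<in>{0..<n}. if k = n - 1 then coeff (pderiv P) i * G $$ (k, j) else 0)"
      unfolding idx[OF C(1) G ij] using ij by (intro sum.cong) (auto simp: CPi)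
    also have "\<dots> = coeff (pderiv P) i * G $$ (n - 1, j)" using n by simp
    also have "\<dots> = CP $$ (i, j)" using ij n \<gamma>0 deriv_last_row[OF ij(2), of \<gamma>] CPi[OF ij] by (auto simp: G_def)
    finally show "(CP * G) $$ (i, j) = CP $$ (i, j)" .
  qed (use G C in auto)
  define E where "E = ?X * G - G * ?Q"
  have E: "E \<in> carrier_mat n n" using G by (auto simp: E_def)
  have XN: "?X * ?N = CP + ?N * ?X - 1\<^sub>m n" "?Q * ?N = CQ + ?N * ?Q - 1\<^sub>m n"
    unfolding CP_def CQ_def comm_mat_def by (intro eq_matI; auto simp del: index_mult_mat(1))+
  have EN: "E * ?N = ?N * E"
  proof -
    have "E * ?N = ?X * (G * ?N) - G * (?Q * ?N)" unfolding E_def using G N by (simp add: R)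
    also have "?X * (G * ?N) = (?X * ?N) * G" unfolding GN using G N by (simp add: R)
    also have "\<dots> = CP + ?N * (?X * G) - G" unfolding XN using G N C CG by (simp add: R)
    also have "G * (?Q * ?N) = CP + ?N * (G * ?Q) - G"
    proof -
      have "G * (?N * ?Q) = ?N * (G * ?Q)"
        using sq_assoc[OF G N comp_deriv_carrier(1), of "monom 1 n"] sq_assoc[OF N G comp_deriv_carrier(1), of "monom 1 n"] GN by simp
      then show ?thesis unfolding XN using G N C GC by (simp add: R)
    qed
    also have "CP + ?N * (?X * G) - G - (CP + ?N * (G * ?Q) - G) = ?N * (?X * G) - ?N * (G * ?Q)"
      using G C by (intro eq_matI) (auto simp del: index_mult_mat(1))
    also have "\<dots> = ?N * E" unfolding E_def using G N by (simp add: R)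
    finally show ?thesis .
  qed
  have K: "E * H \<in> carrier_mat n n" using E H by simp
  have "E * H * ?N = ?N * (E * H)"
  proof -
    have "E * H * ?N = E * (?N * H)" using E H N HN by (simp add: R)
    also have "\<dots> = (E * ?N) * H" using E H N by (simp add: R)
    also have "\<dots> = ?N * (E * H)" unfolding EN using E H N by (simp add: R)
    finally show ?thesis .
  qed
  then obtain \<kappa> where \<kappa>: "E * H = mat_poly \<kappa> ?N" using commutes_with_deriv[OF K] by blast
  have "?X + mat_poly (Polynomial.smult (- 1) \<kappa>) ?N = G * ?Q * H"
  proof -
    have "E * H = ?X * (G * H) - G * ?Q * H" unfolding E_def using G H(1) by (simp add: R)
    then have "mat_poly \<kappa> ?N = ?X - G * ?Q * H" unfolding \<kappa> H(3) by (simp add: R)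
    then show ?thesis unfolding mat_poly_smult[OF N] using G H(1) by (intro eq_matI) (auto simp del: index_mult_mat(1))
  qed
  moreover have "?N = G * ?N * H" unfolding GN using G H N by (simp add: R)
  ultimately have "(?X + mat_poly (Polynomial.smult (- 1) \<kappa>) ?N, ?N) = conj_pair G H (?Q, ?N)" by (simp add: conj_pair_def)
  then show ?thesis unfolding conj_orbit_alt using GH by blast
qed

end

section \<open>Collective transitivity\<close>

lemma mat_poly_translate:
  assumes N: "N \<in> carrier_mat n n"
  shows "mat_poly (pcompose p [:- c, 1:]) (N + c \<cdot>\<^sub>m 1\<^sub>m n) = mat_poly p N"
proof (induct p rule: pCons_induct)
  case 0
  then show ?case using N by (simp add: mat_poly_0[of _ n])
next
  case (pCons a p)
  have M: "N + c \<cdot>\<^sub>m 1\<^sub>m n \<in> carrier_mat n n" using N by simp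
  have "mat_poly [:- c, 1:] (N + c \<cdot>\<^sub>m 1\<^sub>m n) = N" unfolding mat_poly_X[OF M] using N by (intro eq_matI) auto
  then show ?case unfolding pcompose_pCons mat_poly_add[OF M] mat_poly_mult[OF M] pCons(2) mat_poly_const[OF M] mat_poly_pCons[OF N]
    by simp
qed

lemma shiftY_const: "a \<in> pairs n \<Longrightarrow> shiftY [:c:] a = (fst a, snd a + c \<cdot>\<^sub>m 1\<^sub>m n)"
  using pairsD[of a n] by (simp add: shiftY_def mat_poly_const[of _ n])

lemma shift_orbit:
  assumes "a \<in> pairs n" "b \<in> conj_orbit n a"
  shows "shiftX p b \<in> conj_orbit n (shiftX p a)" "shiftY p b \<in> conj_orbit n (shiftY p a)"
  using act_orbit_mem[OF assms, of "[(True, p)]"] act_orbit_mem[OF assms, of "[(False, p)]"] by simp_all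

lemma shift_pairs:
  assumes "a \<in> pairs n"
  shows "shiftX p a \<in> pairs n" "shiftY p a \<in> pairs n"
  using act_pairs[OF assms, of "[(True, p)]"] act_pairs[OF assms, of "[(False, p)]"] by simp_all

text \<open>Multiplication by \<open>x\<close> modulo \<open>x^n\<close> and
  \<open>c + d/dx\<close>; the constant \<open>c\<close> serves as the label of a point within a
  family.\<close>

definition canonical_point :: "nat \<Rightarrow> complex \<Rightarrow> cpair" where
  "canonical_point n c = (comp_mat n (monom 1 n), deriv_mat n + c \<cdot>\<^sub>m 1\<^sub>m n)"

lemma comp_pairs: "(comp_mat n P, deriv_mat n) \<in> pairs n" "canonical_point n c \<in> pairs n"
  "(comp_mat n P, deriv_mat n + c \<cdot>\<^sub>m 1\<^sub>m n) \<in> pairs n"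
  by (simp_all add: pairs_def canonical_point_def)

lemma eigenvalue_genX:
  assumes i: "i < n"
  shows "eigenvalue (genX n x) (x i)"
proof (rule eigenvalueI[OF gen_carrier(1)])
  show "unit_vec n i \<noteq> (0\<^sub>v n :: complex vec)" using i by simp
  show "genX n x *\<^sub>v unit_vec n i = x i \<cdot>\<^sub>v unit_vec n i" using i by (intro eq_vecI) (auto simp: genX_def)
qed simp

text \<open>Only the values of \<open>q\<close> at the eigenvalues of the first matrix matter: they
  replace the momenta by those of the companion form, raised by \<open>c\<close>. Quantifying over
  all such \<open>q\<close> lets one polynomial serve several points.\<close>

lemma shiftY_to_nilpotent:
  assumes b: "cm_point n b" and sf: "rsquarefree (char_poly (fst b))"
  shows "\<exists>f. \<forall>q. (\<forall>s. eigenvalue (fst b) s \<longrightarrow> poly q s = f s) \<longrightarrow>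
    (\<exists>P. coeff P n = 1 \<and> (comp_mat n P, deriv_mat n + c \<cdot>\<^sub>m 1\<^sub>m n) \<in> conj_orbit n (shiftY q b))"
proof -
  have bp: "b \<in> pairs n" "rank_one n (comm_mat n b)" using b by (auto simp: cm_point_def)
  obtain x y where x: "inj_on x {..<n}" and xy: "(genX n x, genY n x y) \<in> conj_orbit n b"
    using generic_form[OF bp sf] by blast
  obtain y0 P where P: "coeff P n = 1" and o: "(comp_mat n P, deriv_mat n) \<in> conj_orbit n (genX n x, genY n x y0)"
    using gen_conj_comp[OF x] by blast
  define f where "f = (\<lambda>s. let i = inv_into {..<n} x s in y0 i + c - y i)"
  show ?thesis
  proof (rule exI[of _ f], intro allI impI)
    fix q assume q: "\<forall>s. eigenvalue (fst b) s \<longrightarrow> poly q s = f s"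
    have qx: "poly q (x i) = y0 i + c - y i" if i: "i < n" for i
    proof -
      have X: "fst b \<in> carrier_mat n n" using pairsD[OF bp(1)] by blast
      have "char_poly (genX n x) = char_poly (fst b)" using orbit_char_poly(1)[OF bp(1) xy] by simp
      then have "eigenvalue (fst b) (x i)"
        using eigenvalue_genX[OF i, of x] unfolding eigenvalue_root_char_poly[OF X] eigenvalue_root_char_poly[OF gen_carrier(1)] by simp
      then show ?thesis using q i inv_into_f_f[OF x] by (simp add: f_def)
    qed
    have "shiftY q (genX n x, genY n x y) = shiftY [:c:] (genX n x, genY n x y0)"
      unfolding shiftY_gen by (rule arg_cong[of _ _ "Pair (genX n x)"], rule eq_matI) (auto simp: qx)
    then have 1: "shiftY [:c:] (genX n x, genY n x y0) \<in> conj_orbit n (shiftY q b)"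
      using shift_orbit(2)[OF bp(1) xy, of q] by simp
    have "shiftY [:c:] (comp_mat n P, deriv_mat n) \<in> conj_orbit n (shiftY [:c:] (genX n x, genY n x y0))"
      by (rule shift_orbit(2)[OF gen_pairs o])
    then have "(comp_mat n P, deriv_mat n + c \<cdot>\<^sub>m 1\<^sub>m n) \<in> conj_orbit n (shiftY [:c:] (genX n x, genY n x y0))"
      unfolding shiftY_const[OF comp_pairs(1)] by simp
    then have "(comp_mat n P, deriv_mat n + c \<cdot>\<^sub>m 1\<^sub>m n) \<in> conj_orbit n (shiftY q b)"
      by (rule orbit_trans[OF shift_pairs(2)[OF bp(1)] 1])
    then show "\<exists>P. coeff P n = 1 \<and> (comp_mat n P, deriv_mat n + c \<cdot>\<^sub>m 1\<^sub>m n) \<in> conj_orbit n (shiftY q b)"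
      using P by blast
  qed
qed

text \<open>The matrix \<open>c + d/dx\<close> is annihilated by \<open>(x - c)^n\<close>, so only
  the residue of \<open>p\<close> modulo this power matters. The residue \<open>r\<close> is the
  polynomial of \<open>comp_shift\<close> translated by \<open>c\<close>.\<close>

lemma shiftX_to_canonical:
  assumes n: "n > 0" and P: "coeff P n = 1" and b: "b \<in> pairs n"
    and o: "(comp_mat n P, deriv_mat n + c \<cdot>\<^sub>m 1\<^sub>m n) \<in> conj_orbit n b"
  shows "\<exists>r. \<forall>p. [:- c, 1:] ^ n dvd p - r \<longrightarrow> canonical_point n c \<in> conj_orbit n (shiftX p b)"
proof -
  obtain p0 where p0: "(comp_mat n P + mat_poly p0 (deriv_mat n), deriv_mat n) \<in> conj_orbit n (comp_mat n (monom 1 n), deriv_mat n)"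
    using comp_shift[OF n P] by blast
  show ?thesis
  proof (rule exI[of _ "pcompose p0 [:- c, 1:]"], intro allI impI)
    fix p assume "[:- c, 1:] ^ n dvd p - pcompose p0 [:- c, 1:]"
    then obtain u where "p - pcompose p0 [:- c, 1:] = [:- c, 1:] ^ n * u" by (rule dvdE)
    then have p: "p = pcompose p0 [:- c, 1:] + [:- c, 1:] ^ n * u" by (simp add: algebra_simps)
    let ?M = "deriv_mat n + c \<cdot>\<^sub>m 1\<^sub>m n"
    have M: "?M \<in> carrier_mat n n" by simp
    have N: "deriv_mat n \<in> carrier_mat n n" by simp
    have "[:- c, 1:] ^ n = pcompose ([:0, 1:] ^ n) [:- c, 1:]"
    proof -
      have "pcompose ([:0, 1:] ^ k) [:- c, 1:] = [:- c, 1:] ^ k" for k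
        by (induct k) (simp_all only: power_0 power_Suc pcompose_1 pcompose_mult pcompose_pCons pcompose_0 
            mult_zero_right add_0_right mult_1_right, simp)
      then show ?thesis by simp
    qed
    then have "mat_poly ([:- c, 1:] ^ n) ?M = 0\<^sub>m n n"
      using mat_poly_translate[OF N, of "[:0, 1:] ^ n" c] cayley_hamilton[OF N] unfolding char_poly_deriv[OF n] by simp
    then have "mat_poly p ?M = mat_poly p0 (deriv_mat n)"
      unfolding p mat_poly_add[OF M] mat_poly_mult[OF M] mat_poly_translate[OF N] by (simp add: sq_one[where n=n])
    then have "shiftX p (comp_mat n P, ?M) = shiftY [:c:] (comp_mat n P + mat_poly p0 (deriv_mat n), deriv_mat n)"
      by (subst shiftY_const[of _ n]) (simp_all add: shiftX_def pairs_def)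
    moreover have "canonical_point n c = shiftY [:c:] (comp_mat n (monom 1 n), deriv_mat n)"
      unfolding shiftY_const[OF comp_pairs(1)] by (simp add: canonical_point_def)
    ultimately have "shiftX p (comp_mat n P, ?M) \<in> conj_orbit n (canonical_point n c)"
      using shift_orbit(2)[OF comp_pairs(1) p0, of "[:c:]"] by simp
    then have "canonical_point n c \<in> conj_orbit n (shiftX p (comp_mat n P, ?M))" by (rule orbit_sym[OF comp_pairs(2)])
    then show "canonical_point n c \<in> conj_orbit n (shiftX p b)"
      by (rule orbit_trans[OF shift_pairs(1)[OF b] shift_orbit(1)[OF b o]])
  qed
qed

text \<open>Once the spectra of the first matrices are disjoint, interpolation makes the shift of the second
  matrices independent for the different points; moving these to nilpotent matrices translated by distinct
  constants makes the next shift of the first matrices independent as well.\<close>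

lemma reach_canonical:
  assumes J: "finite J" and a: "\<And>j. j \<in> J \<Longrightarrow> cm_point (n j) (a j)"
    and ne: "\<And>i j. i \<in> J \<Longrightarrow> j \<in> J \<Longrightarrow> i \<noteq> j \<Longrightarrow> n i \<noteq> n j \<or> a i \<notin> conj_orbit (n i) (a j)"
    and c: "inj_on c J"
  shows "\<exists>w. \<forall>j\<in>J. canonical_point (n j) (c j) \<in> conj_orbit (n j) (act w (a j))"
proof -
  obtain w where w: "\<And>j. j \<in> J \<Longrightarrow> rsquarefree (char_poly (fst (act w (a j))))"
    "\<And>i j. i \<in> J \<Longrightarrow> j \<in> J \<Longrightarrow> i \<noteq> j \<Longrightarrow> disjoint_spectra (fst (act w (a i))) (fst (act w (a j)))"
    using general_position[where n=n and a=a, OF J a ne] by blast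
  define b where "b = (\<lambda>j. act w (a j))"
  have b: "cm_point (n j) (b j)" if "j \<in> J" for j using cm_point_act[OF a[OF that]] by (simp add: b_def)
  have bp: "b j \<in> pairs (n j)" "n j > 0" if "j \<in> J" for j using b[OF that] by (auto simp: cm_point_def)
  have X: "fst (b j) \<in> carrier_mat (n j) (n j)" if "j \<in> J" for j using pairsD[OF bp(1)[OF that]] by blast
  have "\<forall>j\<in>J. \<exists>f. \<forall>q. (\<forall>s. eigenvalue (fst (b j)) s \<longrightarrow> poly q s = f s) \<longrightarrow>
    (\<exists>P. coeff P (n j) = 1 \<and> (comp_mat (n j) P, deriv_mat (n j) + c j \<cdot>\<^sub>m 1\<^sub>m (n j)) \<in> conj_orbit (n j) (shiftY q (b j)))"
    using shiftY_to_nilpotent[OF b] w(1) by (simp add: b_def)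
  from bchoice[OF this] obtain f where f: "\<And>j q. j \<in> J \<Longrightarrow> (\<And>s. eigenvalue (fst (b j)) s \<Longrightarrow> poly q s = f j s) \<Longrightarrow>
    (\<exists>P. coeff P (n j) = 1 \<and> (comp_mat (n j) P, deriv_mat (n j) + c j \<cdot>\<^sub>m 1\<^sub>m (n j)) \<in> conj_orbit (n j) (shiftY q (b j)))"
    by blast
  define S where "S = (\<Union>j\<in>J. {s. eigenvalue (fst (b j)) s})"
  have "finite S" unfolding S_def using J finite_eigenvalues[OF X] by blast
  \<comment> \<open>The spectra are disjoint, so at each eigenvalue in \<open>S\<close> the choice
    picks the only point that has it, and the prescriptions for different points cannot
    conflict.\<close>
  define F where "F = (\<lambda>s. f (SOME j. j \<in> J \<and> eigenvalue (fst (b j)) s) s)"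
  obtain q where q: "\<And>s. s \<in> S \<Longrightarrow> poly q s = F s" using interpolation[OF \<open>finite S\<close>, of F] by blast
  have qf: "poly q s = f j s" if j: "j \<in> J" and s: "eigenvalue (fst (b j)) s" for j s
  proof -
    have "(SOME j. j \<in> J \<and> eigenvalue (fst (b j)) s) = j"
    proof (rule some_equality)
      fix i assume i: "i \<in> J \<and> eigenvalue (fst (b i)) s"
      show "i = j"
      proof (rule ccontr)
        assume "i \<noteq> j"
        then have "disjoint_spectra (fst (b i)) (fst (b j))" using w(2) i j by (simp add: b_def)
        then show False using disjoint_spectra_iff[of "fst (b i)" "n i" "fst (b j)" "n j"] X i j s by blast
      qed
    qed (use j s in simp)
    moreover have "s \<in> S" using j s by (auto simp: S_def)
    ultimately show ?thesis using q by (simp add: F_def)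
  qed
  have "\<forall>j\<in>J. \<exists>r. \<forall>p. [:- c j, 1:] ^ n j dvd p - r \<longrightarrow> canonical_point (n j) (c j) \<in> conj_orbit (n j) (shiftX p (shiftY q (b j)))"
  proof
    fix j assume j: "j \<in> J"
    obtain P where P: "coeff P (n j) = 1" "(comp_mat (n j) P, deriv_mat (n j) + c j \<cdot>\<^sub>m 1\<^sub>m (n j)) \<in> conj_orbit (n j) (shiftY q (b j))"
      using f[OF j qf[OF j]] by blast
    show "\<exists>r. \<forall>p. [:- c j, 1:] ^ n j dvd p - r \<longrightarrow> canonical_point (n j) (c j) \<in> conj_orbit (n j) (shiftX p (shiftY q (b j)))"
      by (rule shiftX_to_canonical[OF bp(2)[OF j] P(1) shift_pairs(2)[OF bp(1)[OF j]] P(2)])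
  qed
  from bchoice[OF this] obtain r where r: "\<And>j p. j \<in> J \<Longrightarrow> [:- c j, 1:] ^ n j dvd p - r j \<Longrightarrow>
    canonical_point (n j) (c j) \<in> conj_orbit (n j) (shiftX p (shiftY q (b j)))" by blast
  obtain p where p: "\<And>j. j \<in> J \<Longrightarrow> [:- c j, 1:] ^ n j dvd p - r j"
    using chinese_remainder_linear_powers[OF J c, of n r] by blast
  have "canonical_point (n j) (c j) \<in> conj_orbit (n j) (act ((True, p) # (False, q) # w) (a j))" if "j \<in> J" for j
    using r[OF that p[OF that]] by (simp add: b_def)
  then show ?thesis by blast
qed

text \<open>Both families are carried to the same labelled canonical points; the first word followed
  by the inverse of the second takes one family to the other.\<close>

lemma collective_transitivity:
  assumes J: "finite J" and a: "\<And>j. j \<in> J \<Longrightarrow> cm_point (n j) (a j)" and b: "\<And>j. j \<in> J \<Longrightarrow> cm_point (n j) (b j)"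
    and ne: "\<And>i j. i \<in> J \<Longrightarrow> j \<in> J \<Longrightarrow> i \<noteq> j \<Longrightarrow> n i \<noteq> n j \<or> a i \<notin> conj_orbit (n i) (a j)"
    "\<And>i j. i \<in> J \<Longrightarrow> j \<in> J \<Longrightarrow> i \<noteq> j \<Longrightarrow> n i \<noteq> n j \<or> b i \<notin> conj_orbit (n i) (b j)"
  shows "\<exists>w. \<forall>j\<in>J. conj_orbit (n j) (act w (a j)) = conj_orbit (n j) (b j)"
proof -
  obtain e :: "'a \<Rightarrow> nat" where e: "inj_on e J" using finite_imp_inj_to_nat_seg[OF J] by blast
  define c where "c = (\<lambda>j. of_nat (e j) :: complex)"
  have c: "inj_on c J" using e by (auto simp: c_def inj_on_def)
  obtain u where u: "\<And>j. j \<in> J \<Longrightarrow> canonical_point (n j) (c j) \<in> conj_orbit (n j) (act u (a j))"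
    using reach_canonical[where n=n and a=a and c=c, OF J a ne(1) c] by blast
  obtain v where v: "\<And>j. j \<in> J \<Longrightarrow> canonical_point (n j) (c j) \<in> conj_orbit (n j) (act v (b j))"
    using reach_canonical[where n=n and a=b and c=c, OF J b ne(2) c] by blast
  have "conj_orbit (n j) (act (inv_word v @ u) (a j)) = conj_orbit (n j) (b j)" if j: "j \<in> J" for j
  proof -
    have p: "a j \<in> pairs (n j)" "b j \<in> pairs (n j)" using a[OF j] b[OF j] by (auto simp: cm_point_def)
    have "act u (a j) \<in> conj_orbit (n j) (canonical_point (n j) (c j))" by (rule orbit_sym[OF act_pairs[OF p(1)] u[OF j]])
    then have "act u (a j) \<in> conj_orbit (n j) (act v (b j))" by (rule orbit_trans[OF act_pairs[OF p(2)] v[OF j]])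
    then have "act (inv_word v) (act u (a j)) \<in> conj_orbit (n j) (act (inv_word v) (act v (b j)))"
      by (rule act_orbit_mem[OF act_pairs[OF p(2)]])
    then have "act (inv_word v @ u) (a j) \<in> conj_orbit (n j) (b j)" unfolding act_append act_inv[OF p(2)] .
    then show ?thesis by (rule orbit_eqI[OF p(2)])
  qed
  then show ?thesis by blast
qed

section \<open>From pairs of matrices to points, regular functions and automorphisms\<close>

lemma locus_pairs: "a \<in> CM_locus n \<Longrightarrow> a \<in> pairs n"
  by (auto simp: CM_locus_def pairs_def)

lemma locus_iff: "a \<in> CM_locus n \<longleftrightarrow> a \<in> pairs n \<and> vec_space.rank n (comm_mat n a) = 1"
  by (cases a) (auto simp: CM_locus_def pairs_def comm_mat_def)

lemma act_locus: "a \<in> CM_locus n \<Longrightarrow> act w a \<in> CM_locus n"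
  unfolding locus_iff using act_pairs comm_mat_act by simp

lemma CM_cm_point:
  assumes "n \<ge> 1" "x \<in> CM n"
  shows "\<exists>a. x = conj_orbit n a \<and> cm_point n a"
proof -
  obtain a where x: "x = conj_orbit n a" and a: "a \<in> CM_locus n" using assms(2) by (auto simp: CM_def)
  have p: "a \<in> pairs n" by (rule locus_pairs[OF a])
  have "rank_one n (comm_mat n a)"
    by (rule rank_one_if_rank_1[OF comm_mat_carrier[OF p]]) (use a in \<open>simp add: locus_iff\<close>)
  then show ?thesis using x p assms(1) by (intro exI[of _ a]) (simp add: cm_point_def)
qed

lemma G_act_orbit: "a \<in> pairs n \<Longrightarrow> G_act (act w) (conj_orbit n a) = conj_orbit n (act w a)"
  unfolding G_act_def by (rule act_orbit)

text \<open>Agreement is asked only on \<open>n\<close> by \<open>n\<close> pairs: entries of a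
  word's image expand as polynomials in the entries when the sizes are right.\<close>

definition polyfun_on_pairs :: "nat \<Rightarrow> (cpair \<Rightarrow> complex) \<Rightarrow> bool" where
  "polyfun_on_pairs n F \<longleftrightarrow> (\<exists>P\<in>polyfun n. \<forall>a\<in>pairs n. F a = P a)"

lemma polyfun_on_pairs_intros:
  "P \<in> polyfun n \<Longrightarrow> polyfun_on_pairs n P"
  "polyfun_on_pairs n F \<Longrightarrow> polyfun_on_pairs n H \<Longrightarrow> polyfun_on_pairs n (\<lambda>a. F a + H a)"
  "polyfun_on_pairs n F \<Longrightarrow> polyfun_on_pairs n H \<Longrightarrow> polyfun_on_pairs n (\<lambda>a. F a * H a)"
proof -
  show "P \<in> polyfun n \<Longrightarrow> polyfun_on_pairs n P" unfolding polyfun_on_pairs_def by blast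
  assume "polyfun_on_pairs n F" "polyfun_on_pairs n H"
  then obtain P Q where PQ: "P \<in> polyfun n" "Q \<in> polyfun n" "\<forall>a\<in>pairs n. F a = P a" "\<forall>a\<in>pairs n. H a = Q a"
    unfolding polyfun_on_pairs_def by blast
  show "polyfun_on_pairs n (\<lambda>a. F a + H a)" unfolding polyfun_on_pairs_def
    by (rule bexI[of _ "\<lambda>a. P a + Q a"]) (use PQ in \<open>auto intro: pf_add\<close>)
  show "polyfun_on_pairs n (\<lambda>a. F a * H a)" unfolding polyfun_on_pairs_def
    by (rule bexI[of _ "\<lambda>a. P a * Q a"]) (use PQ in \<open>auto intro: pf_mult\<close>)
qed

lemma polyfun_on_pairs_cong:
  assumes "polyfun_on_pairs n H" "\<And>a. a \<in> pairs n \<Longrightarrow> F a = H a"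
  shows "polyfun_on_pairs n F"
  using assms unfolding polyfun_on_pairs_def by simp

lemma polyfun_on_pairs_sum:
  "(\<And>i. i \<in> I \<Longrightarrow> polyfun_on_pairs n (F i)) \<Longrightarrow> polyfun_on_pairs n (\<lambda>a. \<Sum>i\<in>I. F i a)"
  by (induct I rule: infinite_finite_induct)
    (simp_all add: polyfun_on_pairs_intros(1)[OF pf_const] polyfun_on_pairs_intros(2))

lemma polyfun_on_pairs_mat_poly:
  assumes A: "\<And>a. a \<in> pairs n \<Longrightarrow> A a \<in> carrier_mat n n"
    and p: "\<And>i j. i < n \<Longrightarrow> j < n \<Longrightarrow> polyfun_on_pairs n (\<lambda>a. A a $$ (i, j))" and ij: "i < n" "j < n"
  shows "polyfun_on_pairs n (\<lambda>a. mat_poly p (A a) $$ (i, j))"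
  using ij
proof (induct p arbitrary: i j rule: pCons_induct)
  case 0
  show ?case
    by (rule polyfun_on_pairs_cong[OF polyfun_on_pairs_intros(1)[OF pf_const[of 0]]]) (use A 0 in \<open>simp add: mat_poly_0[of _ n]\<close>)
next
  case (pCons b q)
  show ?case
  proof (rule polyfun_on_pairs_cong)
    show "polyfun_on_pairs n (\<lambda>a. b * (if i = j then 1 else 0) + (\<Sum>k\<in>{0..<n}. A a $$ (i, k) * mat_poly q (A a) $$ (k, j)))"
      by (intro polyfun_on_pairs_intros(2,3) polyfun_on_pairs_sum polyfun_on_pairs_intros(1)[OF pf_const] p pCons) auto
    fix a assume "a \<in> pairs n"
    from A[OF this] show "mat_poly (pCons b q) (A a) $$ (i, j) = b * (if i = j then 1 else 0) + (\<Sum>k\<in>{0..<n}. A a $$ (i, k) * mat_poly q (A a) $$ (k, j))"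
      using pCons(3,4) by (simp add: mat_poly_pCons[of _ n] scalar_prod_def)
  qed
qed

lemma polyfun_on_pairs_subst:
  assumes P: "P \<in> polyfun n" and g: "\<And>a. a \<in> pairs n \<Longrightarrow> g a \<in> pairs n"
    and X: "\<And>i j. i < n \<Longrightarrow> j < n \<Longrightarrow> polyfun_on_pairs n (\<lambda>a. fst (g a) $$ (i, j))"
    and Y: "\<And>i j. i < n \<Longrightarrow> j < n \<Longrightarrow> polyfun_on_pairs n (\<lambda>a. snd (g a) $$ (i, j))"
  shows "polyfun_on_pairs n (\<lambda>a. P (g a))"
  using P
proof (induct P rule: polyfun.induct)
  case (pf_const c)
  then show ?case by (rule polyfun_on_pairs_intros(1)[OF polyfun.pf_const])
qed (auto intro: X Y polyfun_on_pairs_intros)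

lemma polyfun_on_pairs_act_entries:
  "(\<forall>i<n. \<forall>j<n. polyfun_on_pairs n (\<lambda>a. fst (act w a) $$ (i, j))) \<and>
   (\<forall>i<n. \<forall>j<n. polyfun_on_pairs n (\<lambda>a. snd (act w a) $$ (i, j)))"
proof (induct w)
  case Nil
  then show ?case by (auto intro: polyfun_on_pairs_intros(1) pf_X pf_Y)
next
  case (Cons s w)
  obtain b p where s: "s = (b, p)" by (cases s)
  have c: "a \<in> pairs n \<Longrightarrow> fst (act w a) \<in> carrier_mat n n" "a \<in> pairs n \<Longrightarrow> snd (act w a) \<in> carrier_mat n n" for a
    using pairsD[OF act_pairs] by blast+
  have "polyfun_on_pairs n (\<lambda>a. fst (shiftX p (act w a)) $$ (i, j))" "polyfun_on_pairs n (\<lambda>a. snd (shiftY p (act w a)) $$ (i, j))"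
    if ij: "i < n" "j < n" for i j
  proof -
    have e: "polyfun_on_pairs n (\<lambda>a. fst (act w a) $$ (i, j))" "polyfun_on_pairs n (\<lambda>a. snd (act w a) $$ (i, j))"
      if "i < n" "j < n" for i j using Cons that by auto
    have mX: "polyfun_on_pairs n (\<lambda>a. mat_poly p (snd (act w a)) $$ (i, j))"
      by (rule polyfun_on_pairs_mat_poly[OF c(2) e(2) ij])
    have mY: "polyfun_on_pairs n (\<lambda>a. mat_poly p (fst (act w a)) $$ (i, j))"
      by (rule polyfun_on_pairs_mat_poly[OF c(1) e(1) ij])
    show "polyfun_on_pairs n (\<lambda>a. fst (shiftX p (act w a)) $$ (i, j))"
      by (rule polyfun_on_pairs_cong[OF polyfun_on_pairs_intros(2)[OF e(1)[OF ij] mX]])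
        (use carrier_matD[OF c(2)] ij in \<open>simp add: shiftX_def\<close>)
    show "polyfun_on_pairs n (\<lambda>a. snd (shiftY p (act w a)) $$ (i, j))"
      by (rule polyfun_on_pairs_cong[OF polyfun_on_pairs_intros(2)[OF e(2)[OF ij] mY]])
        (use carrier_matD[OF c(1)] ij in \<open>simp add: shiftY_def\<close>)
  qed
  then show ?case using Cons by (cases b) (simp_all add: s shiftX_def shiftY_def)
qed

lemma CM_regular_act:
  assumes "CM_regular n f"
  shows "CM_regular n (f \<circ> G_act (act w))"
proof -
  obtain P where P: "P \<in> polyfun n" "\<And>a. a \<in> CM_locus n \<Longrightarrow> f (conj_orbit n a) = P a"
    using assms unfolding CM_regular_def by blast
  have "polyfun_on_pairs n (\<lambda>a. P (act w a))"
    by (rule polyfun_on_pairs_subst[OF P(1) act_pairs]) (use polyfun_on_pairs_act_entries[of n w] in auto)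
  then obtain Q where Q: "Q \<in> polyfun n" "\<And>a. a \<in> pairs n \<Longrightarrow> P (act w a) = Q a"
    unfolding polyfun_on_pairs_def by blast
  have "(f \<circ> G_act (act w)) (conj_orbit n a) = Q a" if a: "a \<in> CM_locus n" for a
    using P(2)[OF act_locus[OF a, of w]] Q(2)[OF locus_pairs[OF a]] G_act_orbit[OF locus_pairs[OF a], of w] by simp
  then show ?thesis unfolding CM_regular_def using Q(1) by blast
qed

lemma CM_morphism_act: "CM_morphism n (G_act (act w))"
  unfolding CM_morphism_def
proof (intro conjI ballI allI impI)
  fix x assume "x \<in> CM n"
  then obtain a where "x = conj_orbit n a" "a \<in> CM_locus n" by (auto simp: CM_def)
  then show "G_act (act w) x \<in> CM n"
    using G_act_orbit[OF locus_pairs] act_locus unfolding CM_def by blast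
qed (rule CM_regular_act)

text \<open>Needed for the inverse map: \<open>the_inv_into\<close> agrees with the action of the
  inverse word only on \<open>CM n\<close>.\<close>

lemma CM_morphism_cong:
  assumes m: "CM_morphism n \<psi>" and eq: "\<And>x. x \<in> CM n \<Longrightarrow> \<phi> x = \<psi> x"
  shows "CM_morphism n \<phi>"
  unfolding CM_morphism_def
proof (intro conjI ballI allI impI)
  fix x assume x: "x \<in> CM n"
  then show "\<phi> x \<in> CM n" using m eq[OF x] unfolding CM_morphism_def by simp
next
  fix f assume "CM_regular n f"
  then have "CM_regular n (f \<circ> \<psi>)" using m unfolding CM_morphism_def by blast
  moreover have "f (\<phi> (conj_orbit n a)) = f (\<psi> (conj_orbit n a))" if "a \<in> CM_locus n" for a
    using eq[of "conj_orbit n a"] that by (simp add: CM_def)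
  ultimately show "CM_regular n (f \<circ> \<phi>)" unfolding CM_regular_def by simp
qed

lemma CM_aut_act: "CM_aut n (G_act (act w))"
proof -
  let ?\<phi> = "G_act (act w)" and ?\<psi> = "G_act (act (inv_word w))"
  have inv: "?\<psi> (?\<phi> x) = x" "?\<phi> (?\<psi> x) = x" if x: "x \<in> CM n" for x
  proof -
    obtain a where a: "x = conj_orbit n a" "a \<in> pairs n" using x locus_pairs by (auto simp: CM_def)
    show "?\<psi> (?\<phi> x) = x" "?\<phi> (?\<psi> x) = x"
      unfolding a(1) G_act_orbit[OF a(2)] G_act_orbit[OF act_pairs[OF a(2)]] act_inv[OF a(2)] act_inv'[OF a(2)] by simp_all
  qed
  have maps: "?\<phi> x \<in> CM n" "?\<psi> x \<in> CM n" if "x \<in> CM n" for x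
    using CM_morphism_act[of n w] CM_morphism_act[of n "inv_word w"] that unfolding CM_morphism_def by auto
  have bij: "bij_betw ?\<phi> (CM n) (CM n)"
    by (rule bij_betw_byWitness[where f'="?\<psi>"]) (use inv maps in auto)
  have "the_inv_into (CM n) ?\<phi> x = ?\<psi> x" if "x \<in> CM n" for x
    by (rule the_inv_into_f_eq) (use bij inv maps that in \<open>auto simp: bij_betw_def\<close>)
  then have "CM_morphism n (the_inv_into (CM n) ?\<phi>)"
    using CM_morphism_cong[OF CM_morphism_act] by blast
  then show ?thesis unfolding CM_aut_def using bij CM_morphism_act by blast
qed

text \<open>The double index is flattened to pairs \<open>(j, l)\<close> and orbits are replaced by
  representatives.\<close>

lemma collective_transitivity_CM:
  fixes n :: "nat \<Rightarrow> nat" and a b :: "nat \<Rightarrow> nat \<Rightarrow> cpair set"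
  assumes n: "\<And>j. j < k \<Longrightarrow> n j \<ge> 1" "inj_on n {..<k}"
    and a: "\<And>j l. j < k \<Longrightarrow> l < m j \<Longrightarrow> a j l \<in> CM (n j)" "\<And>j. j < k \<Longrightarrow> inj_on (a j) {..<m j}"
    and b: "\<And>j l. j < k \<Longrightarrow> l < m j \<Longrightarrow> b j l \<in> CM (n j)" "\<And>j. j < k \<Longrightarrow> inj_on (b j) {..<m j}"
  shows "\<exists>w. \<forall>j<k. \<forall>l<m j. G_act (act w) (a j l) = b j l"
proof -
  define J where "J = (SIGMA j:{..<k}. {..<m j})"
  have J: "finite J" unfolding J_def by blast
  define nn where "nn = (\<lambda>jl :: nat \<times> nat. n (fst jl))"
  have rep: "\<exists>f. \<forall>i\<in>J. c (fst i) (snd i) = conj_orbit (nn i) (f i) \<and> cm_point (nn i) (f i)"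
    if "\<And>j l. j < k \<Longrightarrow> l < m j \<Longrightarrow> c j l \<in> CM (n j)" for c
    by (rule bchoice) (use that CM_cm_point n(1) in \<open>auto simp: J_def nn_def\<close>)
  obtain f where f: "\<And>i. i \<in> J \<Longrightarrow> a (fst i) (snd i) = conj_orbit (nn i) (f i)" "\<And>i. i \<in> J \<Longrightarrow> cm_point (nn i) (f i)"
    using rep[where c=a, OF a(1)] by blast
  obtain g where g: "\<And>i. i \<in> J \<Longrightarrow> b (fst i) (snd i) = conj_orbit (nn i) (g i)" "\<And>i. i \<in> J \<Longrightarrow> cm_point (nn i) (g i)"
    using rep[where c=b, OF b(1)] by blast
  \<comment> \<open>Equal sizes force equal \<open>j\<close> by injectivity of \<open>n\<close>;
    then equal orbits force equal \<open>l\<close>, as the points of one space are distinct.\<close>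
  have ne: "nn i \<noteq> nn i' \<or> h i \<notin> conj_orbit (nn i) (h i')"
    if i: "i \<in> J" "i' \<in> J" "i \<noteq> i'" and inj: "\<And>j. j < k \<Longrightarrow> inj_on (c j) {..<m j}"
      and h: "\<And>i. i \<in> J \<Longrightarrow> c (fst i) (snd i) = conj_orbit (nn i) (h i)" "\<And>i. i \<in> J \<Longrightarrow> cm_point (nn i) (h i)"
    for i i' and c :: "nat \<Rightarrow> nat \<Rightarrow> cpair set" and h
  proof (rule ccontr)
    assume "\<not> ?thesis"
    then have nn: "nn i = nn i'" and o: "h i \<in> conj_orbit (nn i) (h i')" by auto
    have k: "fst i < k" "fst i' < k" "snd i < m (fst i)" "snd i' < m (fst i')" using i by (auto simp: J_def)
    have fs: "fst i = fst i'" using inj_onD[OF n(2), of "fst i" "fst i'"] nn k by (simp add: nn_def)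
    have "h i' \<in> pairs (nn i)" using h(2)[OF i(2)] nn by (simp add: cm_point_def)
    then have "conj_orbit (nn i) (h i) = conj_orbit (nn i) (h i')" by (rule orbit_eqI[OF _ o])
    then have "c (fst i) (snd i) = c (fst i) (snd i')" using h(1)[OF i(1)] h(1)[OF i(2)] nn fs by simp
    then have "snd i = snd i'" using inj_onD[OF inj[OF k(1)], of "snd i" "snd i'"] k fs by simp
    then show False using fs i(3) by (simp add: prod_eq_iff)
  qed
  obtain w where w: "\<And>i. i \<in> J \<Longrightarrow> conj_orbit (nn i) (act w (f i)) = conj_orbit (nn i) (g i)"
  proof -
    have "nn i \<noteq> nn i' \<or> f i \<notin> conj_orbit (nn i) (f i')" if "i \<in> J" "i' \<in> J" "i \<noteq> i'" for i i'
      by (rule ne[where c=a, OF that a(2) f])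
    moreover have "nn i \<noteq> nn i' \<or> g i \<notin> conj_orbit (nn i) (g i')" if "i \<in> J" "i' \<in> J" "i \<noteq> i'" for i i'
      by (rule ne[where c=b, OF that b(2) g])
    ultimately show thesis
      using collective_transitivity[where n=nn and a=f and b=g, OF J f(2) g(2)] that by blast
  qed
  have "G_act (act w) (a j l) = b j l" if jl: "j < k" "l < m j" for j l
  proof -
    have i: "(j, l) \<in> J" using jl by (simp add: J_def)
    have "f (j, l) \<in> pairs (nn (j, l))" using f(2)[OF i] by (simp add: cm_point_def)
    then show ?thesis using f(1)[OF i] g(1)[OF i] w[OF i] G_act_orbit by simp
  qed
  then show ?thesis by blast
qed

theorem theorem3:
  shows "(\<forall>n::nat. n \<ge> 1 \<longrightarrow>
            (\<forall>(m::nat) (a::nat \<Rightarrow> cpair set) (b::nat \<Rightarrow> cpair set).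
               (\<forall>i<m. a i \<in> CM n) \<and> (\<forall>i<m. b i \<in> CM n) \<and>
               inj_on a {..<m} \<and> inj_on b {..<m} \<longrightarrow>
               (\<exists>\<phi>. CM_aut n \<phi> \<and> (\<forall>i<m. \<phi> (a i) = b i))))
       \<and>
         (\<forall>(k::nat) (n::nat \<Rightarrow> nat). (\<forall>j<k. n j \<ge> 1) \<and> inj_on n {..<k} \<longrightarrow>
            (\<forall>(m::nat \<Rightarrow> nat) (a::nat \<Rightarrow> nat \<Rightarrow> cpair set) (b::nat \<Rightarrow> nat \<Rightarrow> cpair set).
               (\<forall>j<k. (\<forall>l<m j. a j l \<in> CM (n j)) \<and> (\<forall>l<m j. b j l \<in> CM (n j)) \<and>
                       inj_on (a j) {..<m j} \<and> inj_on (b j) {..<m j}) \<longrightarrow>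
               (\<exists>g\<in>Ggrp. \<forall>j<k. \<forall>l<m j. G_act g (a j l) = b j l)))"
proof (intro conjI allI impI)
  fix n m :: nat and a b :: "nat \<Rightarrow> cpair set"
  assume n: "n \<ge> 1" and ab: "(\<forall>i<m. a i \<in> CM n) \<and> (\<forall>i<m. b i \<in> CM n) \<and> inj_on a {..<m} \<and> inj_on b {..<m}"
  \<comment> \<open>The case of a single space; the word found acts by an automorphism.\<close>
  have "\<exists>w. \<forall>j<(1::nat). \<forall>l<m. G_act (act w) (a l) = b l"
    by (rule collective_transitivity_CM[where n="\<lambda>_. n" and m="\<lambda>_. m" and a="\<lambda>_. a" and b="\<lambda>_. b"])
      (use n ab in \<open>auto simp: inj_on_def\<close>)
  then obtain w where "\<forall>l<m. G_act (act w) (a l) = b l" by auto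
  then show "\<exists>\<phi>. CM_aut n \<phi> \<and> (\<forall>i<m. \<phi> (a i) = b i)" using CM_aut_act by blast
next
  fix k :: nat and n m :: "nat \<Rightarrow> nat" and a b :: "nat \<Rightarrow> nat \<Rightarrow> cpair set"
  assume n: "(\<forall>j<k. n j \<ge> 1) \<and> inj_on n {..<k}"
    and ab: "\<forall>j<k. (\<forall>l<m j. a j l \<in> CM (n j)) \<and> (\<forall>l<m j. b j l \<in> CM (n j)) \<and>
                       inj_on (a j) {..<m j} \<and> inj_on (b j) {..<m j}"
  have "\<exists>w. \<forall>j<k. \<forall>l<m j. G_act (act w) (a j l) = b j l"
    by (rule collective_transitivity_CM[where n=n and m=m and a=a and b=b]) (use n ab in blast)+
  then show "\<exists>g\<in>Ggrp. \<forall>j<k. \<forall>l<m j. G_act g (a j l) = b j l" using act_Ggrp by blast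
qed

end
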